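(* Let $V_h(\hat K)\subset H(\mathrm{div};\hat K)$ and $\bar Q_h(\hat F)$ be finite-dimensional polynomial spaces on the reference cell and the reference facet such that $\bar Q_h(\hat F)\supseteq\{\hat v_h|_{\hat F}\cdot\hat n:\hat v_h\in V_h(\hat K)\}$. Let $V_h(K)=\{\psi_K^{-1}(\hat v):\hat v\in V_h(\hat K)\}$ with $\psi_K$ the contravariant Piola transform $\psi_K(v)=\det(J_K)J_K^{-1}(v\circ T_K)$, and let $\bar Q_h(F)$ be generated from $\bar Q_h(\hat F)$ in the same way using the composition $\psi_F(\bar q_h)=\bar q_h\circ T_K|_{\hat F}$. If moreover $V_h(\hat K)$ and $Q_h(\hat K)$ are chosen such that $$\hat\nabla\cdot V_h(\hat K)\subseteq Q_h(\hat K),$$ then discretely divergence-free functions are weakly divergence-free, i.e. $X_h\subset X$.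
   Context: $\Omega\subset\mathbb R^d$, $d\in\{2,3\}$, is exactly partitioned by a conforming mesh $\mathcal T_h$ of triangular/quadrilateral ($d=2$) or tetrahedral/hexahedral ($d=3$), possibly curved, cells $K=T_K(\hat K)$, where $\hat K$ is a reference cell and $T_K$ is a $C^1$-diffeomorphism (from a Lagrange geometric reference element) with Jacobian matrix $J_K$. $\hat F$ denotes a facet of $\hat K$, $F=T_K(\hat F)$ a facet of the mesh, $\hat n$ and $n$ the outward unit normals to $\partial\hat K$ and $\partial K$; $\hat\nabla\cdot$ is the divergence on $\hat K$. $\mathcal F_h$ is the set of all facets, $\Gamma_h=\bigcup_{F\in\mathcal F_h}F$. The condition on $\bar Q_h(\hat F)$ is understood for every facet of $\hat K$, and the space $\bar Q_h(F)$ of an interior facet does not depend on which of the two adjacent cells is used to generate it. $Q_h(\hat K)$ is a finite-dimensional space on $\hat K$ and $Q_h(K)=\{\hat q\circ T_K^{-1}:\hat q\in Q_h(\hat K)\}$. Set $V_h=\{v_h\in[L^2(\Omega)]^d: v_h|_K\in V_h(K)\ \forall K\}$, $Q_h=\{q_h\in L^2(\Omega): q_h|_K\in Q_h(K)\ \forall K\}$, $\bar Q_h=\{\bar q_h\in L^2(\Gamma_h):\bar q_h|_F\in\bar Q_h(F)\ \forall F\in\mathcal F_h\}$, $\boldsymbol Q_h=Q_h\times\bar Q_h$, $b_h(v_h,(q_h,\bar q_h))=-\sum_K\int_Kq_h\nabla\cdot v_h\,dx+\sum_K\int_{\partial K}v_h\cdot n\,\bar q_h\,ds$, $X_h=\{v_h\in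 V_h:b_h(v_h,\boldsymbol q_h)=0\ \forall\boldsymbol q_h\in\boldsymbol Q_h\}$ (discretely divergence-free functions), and $X=\{v\in H(\mathrm{div};\Omega):\int_\Omega v\cdot\nabla\psi\,dx=0\ \forall\psi\in C_0^\infty(\Omega)\}$ (weakly divergence-free functions). *)

theory Defs
  imports "HOL-Analysis.Analysis"
begin

section \<open>Function spaces\<close>

definition grad :: "(real^'n \<Rightarrow> real) \<Rightarrow> real^'n \<Rightarrow> real^'n" where
  "grad f x = (\<chi> i. frechet_derivative f (at x) (axis i 1))"

primrec Ck :: "nat \<Rightarrow> (real^'n \<Rightarrow> real) \<Rightarrow> bool" where
  "Ck 0 f \<longleftrightarrow> continuous_on UNIV f"
| "Ck (Suc k) f \<longleftrightarrow> (\<forall>x. f differentiable (at x)) \<and> (\<forall>i. Ck k (\<lambda>x. grad f x $ i))"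

text \<open>\<open>C\<^sub>0\<^sup>\<infinity>(U)\<close>, its members being extended by zero to the whole space.\<close>

definition test_functions :: "(real^'n) set \<Rightarrow> (real^'n \<Rightarrow> real) set" where
  "test_functions U = {\<phi>. (\<forall>k. Ck k \<phi>) \<and> compact (closure {x. \<phi> x \<noteq> 0}) \<and> closure {x. \<phi> x \<noteq> 0} \<subseteq> U}"

text \<open>Elements of \<open>L\<^sup>2\<close> spaces are represented by functions; equality in them is equality
  almost everywhere.\<close>

definition square_integrable :: "'a measure \<Rightarrow> ('a \<Rightarrow> 'b::euclidean_space) \<Rightarrow> bool" where
  "square_integrable M f \<longleftrightarrow> f \<in> borel_measurable M \<and> integrable M (\<lambda>x. (norm (f x))\<^sup>2)"

definition has_weak_div :: "(real^'n) set \<Rightarrow> (real^'n \<Rightarrow> real^'n) \<Rightarrow> (real^'n \<Rightarrow> real) \<Rightarrow> bool" where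
  "has_weak_div U v g \<longleftrightarrow> square_integrable (lebesgue_on U) g \<and>
     (\<forall>\<phi>\<in>test_functions U.
        (\<integral>x. v x \<bullet> grad \<phi> x \<partial>lebesgue_on U) = - (\<integral>x. g x * \<phi> x \<partial>lebesgue_on U))"

text \<open>The divergence of an \<open>H(div)\<close> function; determined up to a null set.\<close>

definition weak_div :: "(real^'n) set \<Rightarrow> (real^'n \<Rightarrow> real^'n) \<Rightarrow> real^'n \<Rightarrow> real" where
  "weak_div U v = (SOME g. has_weak_div U v g)"

definition H_div :: "(real^'n) set \<Rightarrow> (real^'n \<Rightarrow> real^'n) set" where
  "H_div U = {v. square_integrable (lebesgue_on U) v \<and> (\<exists>g. has_weak_div U v g)}"

definition weakly_div_free :: "(real^'n) set \<Rightarrow> (real^'n \<Rightarrow> real^'n) set" where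
  "weakly_div_free \<Omega> = {v \<in> H_div \<Omega>. \<forall>\<psi>\<in>test_functions \<Omega>. (\<integral>x. v x \<bullet> grad \<psi> x \<partial>lebesgue_on \<Omega>) = 0}"

definition finite_dim_space :: "('a \<Rightarrow> 'b::real_vector) set \<Rightarrow> bool" where
  "finite_dim_space V \<longleftrightarrow> (\<exists>B. finite B \<and> V = {f. \<exists>c. f = (\<lambda>x. \<Sum>b\<in>B. c b *\<^sub>R b x)})"


section \<open>Reference cells and geometry maps\<close>

definition poly_span :: "('n \<Rightarrow> nat) set \<Rightarrow> (real^'n \<Rightarrow> real) set" where
  "poly_span A = {f. \<exists>c. f = (\<lambda>x. \<Sum>\<alpha>\<in>A. c \<alpha> * (\<Prod>i\<in>UNIV. (x $ i) ^ \<alpha> i))}"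

text \<open>A \<open>d\<close>-simplex with the space \<open>P\<^sub>m\<close> of polynomials of total degree at most \<open>m\<close>, or a box
  with the space \<open>Q\<^sub>m\<close> of polynomials of degree at most \<open>m\<close> in each variable.\<close>

definition lagrange_reference :: "(real^'n) set \<Rightarrow> (real^'n \<Rightarrow> real) set \<Rightarrow> bool" where
  "lagrange_reference Khat G \<longleftrightarrow> (\<exists>m\<ge>1.
      int CARD('n) simplex Khat \<and> G = poly_span {\<alpha>. (\<Sum>i\<in>UNIV. \<alpha> i) \<le> m} \<or>
      (\<exists>a b. box a b \<noteq> {} \<and> Khat = cbox a b) \<and> G = poly_span {\<alpha>. \<forall>i. \<alpha> i \<le> m})"

text \<open>Derivatives are taken within the closed cell, so that they also make sense on its boundary;
  values outside the cell are irrelevant.\<close>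

definition jac :: "(real^'n) set \<Rightarrow> (real^'n \<Rightarrow> real^'n) \<Rightarrow> real^'n \<Rightarrow> real^'n^'n" where
  "jac S T x = matrix (frechet_derivative T (at x within S))"

text \<open>On a compact set, invertibility of the Jacobian makes the inverse \<open>C\<^sup>1\<close>.\<close>

definition C1_diffeo_on :: "(real^'n) set \<Rightarrow> (real^'n \<Rightarrow> real^'n) \<Rightarrow> bool" where
  "C1_diffeo_on S T \<longleftrightarrow> inj_on T S \<and> T differentiable_on S \<and> continuous_on S (jac S T) \<and>
     (\<forall>x\<in>S. det (jac S T x) \<noteq> 0)"

text \<open>A cell \<open>K\<close> is the set \<open>T K ` Khat\<close>.  Conformity: distinct cells meet in the image of a common
  face (possibly empty), and there the two parametrizations agree up to an affine identification
  of the two faces of the reference cell, as is the case when neighbouring cells share the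
  Lagrange geometry nodes of their common face.\<close>

definition conforming_mesh ::
  "(real^'n) set \<Rightarrow> (real^'n \<Rightarrow> real) set \<Rightarrow> (real^'n) set set \<Rightarrow>
   ((real^'n) set \<Rightarrow> real^'n \<Rightarrow> real^'n) \<Rightarrow> (real^'n) set \<Rightarrow> bool" where
  "conforming_mesh Khat G mesh T \<Omega> \<longleftrightarrow>
     finite mesh \<and> \<Union> mesh = closure \<Omega> \<and> (\<forall>K\<in>mesh. interior K \<subseteq> \<Omega>) \<and>
     (\<forall>K\<in>mesh. K = T K ` Khat \<and> C1_diffeo_on Khat (T K) \<and>
        (\<forall>i. \<exists>p\<in>G. \<forall>x\<in>Khat. T K x $ i = p x)) \<and>
     (\<forall>K\<in>mesh. \<forall>L\<in>mesh. K \<noteq> L \<longrightarrow> interior K \<inter> interior L = {} \<and>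
        (\<exists>f g A c. f face_of Khat \<and> g face_of Khat \<and> linear A \<and> (\<lambda>x. A x + c) ` g = f \<and>
           K \<inter> L = T K ` f \<and> (\<forall>x\<in>g. T L x = T K (A x + c))))"


section \<open>Normals and surface integrals\<close>

text \<open>The unit vector spanning the Frechet normal cone of \<open>S\<close> at \<open>x\<close>.  It is unique at every
  boundary point in whose neighbourhood \<open>S\<close> is a \<open>C\<^sup>1\<close> domain, that is, on the facets of a cell
  without their relative boundaries.\<close>

definition outward_normal :: "(real^'n) set \<Rightarrow> real^'n \<Rightarrow> real^'n" where
  "outward_normal S x =
     (THE n. norm n = 1 \<and> (\<forall>e>0. \<forall>\<^sub>F y in at x within S. n \<bullet> (y - x) \<le> e * norm (y - x)))"

text \<open>For a set \<open>F\<close> spanning a hyperplane, the result is unique up to the sign, which does not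
  affect the definitions below.\<close>

definition unit_normal :: "(real^'n) set \<Rightarrow> real^'n" where
  "unit_normal F = (SOME n. norm n = 1 \<and> (\<forall>x\<in>F. \<forall>y\<in>F. n \<bullet> (x - y) = 0))"

text \<open>\<open>(d-1)\<close>-dimensional Lebesgue measure on a flat facet \<open>F\<close>: the measure of a part of \<open>F\<close> is the
  volume of the right prism of height one above it.\<close>

definition flat_measure :: "(real^'n) set \<Rightarrow> (real^'n) measure" where
  "flat_measure F =
     distr (restrict_space lborel {x + t *\<^sub>R unit_normal F | x t. x \<in> F \<and> 0 \<le> t \<and> t \<le> 1})
       (restrict_space borel F) (closest_point (affine hull F))"

text \<open>The Gram factor \<open>sqrt (det (B\<^sup>T B))\<close>, where \<open>B\<close> is the restriction of \<open>J\<close> to the directions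
  parallel to \<open>F\<close>: in an orthonormal basis containing the normal, the matrix below is block
  diagonal with blocks \<open>B\<^sup>T B\<close> and \<open>1\<close>.\<close>

definition area_factor :: "(real^'n) set \<Rightarrow> real^'n^'n \<Rightarrow> real" where
  "area_factor F J =
     (let n = unit_normal F; N = (\<chi> i j. n $ i * n $ j); P = mat 1 - N
      in sqrt (det (P ** transpose J ** J ** P + N)))"

text \<open>Surface measure \<open>ds\<close> on the parametrized facet \<open>T ` F\<close>, for a facet \<open>F\<close> of \<open>S\<close>.\<close>

definition surface_measure ::
  "(real^'n) set \<Rightarrow> (real^'n \<Rightarrow> real^'n) \<Rightarrow> (real^'n) set \<Rightarrow> (real^'n) measure" where
  "surface_measure S T F =
     completion (distr (density (flat_measure F) (\<lambda>x. ennreal (area_factor F (jac S T x))))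
       (restrict_space borel (T ` F)) T)"


section \<open>Discrete spaces\<close>

definition piola :: "(real^'n) set \<Rightarrow> (real^'n \<Rightarrow> real^'n) \<Rightarrow> (real^'n \<Rightarrow> real^'n) \<Rightarrow> real^'n \<Rightarrow> real^'n" where
  "piola Khat TK v x = det (jac Khat TK x) *\<^sub>R (matrix_inv (jac Khat TK x) *v v (TK x))"

text \<open>Functions on a cell (or facet) are represented by functions on the whole space whose values
  elsewhere are arbitrary.\<close>

definition V_cell ::
  "(real^'n) set \<Rightarrow> (real^'n \<Rightarrow> real^'n) set \<Rightarrow> (real^'n \<Rightarrow> real^'n) \<Rightarrow> (real^'n \<Rightarrow> real^'n) set" where
  "V_cell Khat Vhat TK = {v. \<exists>vhat\<in>Vhat. \<forall>x\<in>Khat. piola Khat TK v x = vhat x}"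

text \<open>Used with \<open>S\<close> the reference cell as well as with \<open>S\<close> one of its facets.\<close>

definition pulled_space ::
  "(real^'n) set \<Rightarrow> (real^'n \<Rightarrow> real) set \<Rightarrow> (real^'n \<Rightarrow> real^'n) \<Rightarrow> (real^'n \<Rightarrow> real) set" where
  "pulled_space S Shat TK = {q. \<exists>qhat\<in>Shat. \<forall>x\<in>S. q (TK x) = qhat x}"

definition V_h where
  "V_h Khat Vhat mesh T \<Omega> = {v::real^'n \<Rightarrow> real^'n. square_integrable (lebesgue_on \<Omega>) v \<and>
     (\<forall>K\<in>mesh. \<exists>w\<in>V_cell Khat Vhat (T K). AE x in lebesgue_on K. v x = w x)}"

definition Q_h where
  "Q_h Khat Qhat mesh T \<Omega> = {q::real^'n \<Rightarrow> real. square_integrable (lebesgue_on \<Omega>) q \<and>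
     (\<forall>K\<in>mesh. \<exists>r\<in>pulled_space Khat Qhat (T K). AE x in lebesgue_on K. q x = r x)}"

text \<open>The mesh facets are the sets \<open>T K ` F\<close> with \<open>K\<close> a cell and \<open>F\<close> a facet of \<open>Khat\<close>.  As there are
  finitely many, \<open>L\<^sup>2\<close> on their union is \<open>L\<^sup>2\<close> on each of them.\<close>

definition Qbar_h where
  "Qbar_h Khat Qbarhat mesh T = {qbar::real^'n \<Rightarrow> real. \<forall>K\<in>mesh. \<forall>F. F facet_of Khat \<longrightarrow>
     square_integrable (surface_measure Khat (T K) F) qbar \<and>
     (\<exists>r\<in>pulled_space F (Qbarhat F) (T K). AE x in surface_measure Khat (T K) F. qbar x = r x)}"

text \<open>The continuous representative on the closed cell \<open>K\<close> of the class of \<open>v\<close>; its values on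
  the boundary are the trace of \<open>v\<close> from inside \<open>K\<close>.\<close>

definition cell_rep :: "(real^'n) set \<Rightarrow> (real^'n \<Rightarrow> real^'n) \<Rightarrow> real^'n \<Rightarrow> real^'n" where
  "cell_rep K v = (SOME w. continuous_on K w \<and> (AE x in lebesgue_on K. w x = v x))"

definition b_h ::
  "(real^'n) set \<Rightarrow> (real^'n) set set \<Rightarrow> ((real^'n) set \<Rightarrow> real^'n \<Rightarrow> real^'n) \<Rightarrow>
   (real^'n \<Rightarrow> real^'n) \<Rightarrow> (real^'n \<Rightarrow> real) \<times> (real^'n \<Rightarrow> real) \<Rightarrow> real" where
  "b_h Khat mesh T v = (\<lambda>(q, qbar).
     - (\<Sum>K\<in>mesh. \<integral>x. q x * weak_div (interior K) v x \<partial>lebesgue_on K)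
     + (\<Sum>K\<in>mesh. \<Sum>F | F facet_of Khat.
          \<integral>x. (cell_rep K v x \<bullet> outward_normal K x) * qbar x \<partial>surface_measure Khat (T K) F))"

definition X_h where
  "X_h Khat Vhat Qhat Qbarhat mesh T \<Omega> = {v \<in> V_h Khat Vhat mesh T \<Omega>.
     \<forall>q \<in> Q_h Khat Qhat mesh T \<Omega> \<times> Qbar_h Khat Qbarhat mesh T. b_h Khat mesh T v q = 0}"

end

theory Submission
  imports Defs
begin

text \<open>
  On each cell \<open>v\<close> is the inverse Piola transform of a polynomial field \<open>u\<^sub>K\<close>.  The Piola transform
  carries \<open>\<integral> q div v\<close> and \<open>\<integral> (v \<bullet> n) q ds\<close> to the corresponding integrals of \<open>u\<^sub>K\<close> over the
  reference cell and its facets, up to the constant sign \<open>\<sigma>\<^sub>K\<close> of the Jacobian determinant.  So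
  \<open>q = \<sigma>\<^sub>K (div u\<^sub>K) \<circ> T\<^sub>K\<inverse>\<close> is an admissible pressure, and testing with it makes \<open>v\<close> divergence-free on
  every cell.

  Conformity makes the parametrizations of a common facet differ by an affine map, so that fluxes
  from the two sides are multiples of integrals over a single reference facet.  The jump of the
  normal flux pulled back to that facet is therefore an admissible facet pressure; testing with it,
  extended by zero to the other facets, shows that the jump vanishes.  Green's formula on the
  reference cell, summed over all cells, then gives \<open>\<integral> v \<bullet> \<nabla>\<psi> = 0\<close>.

  The surface measure of a reference facet is defined by the prism above it.  Green's formula is
  obtained from this by multiplying the field by a \<open>C\<^sup>1\<close> cut-off function with layers of width \<open>\<epsilon>\<close>
  along the facets and letting \<open>\<epsilon>\<close> tend to zero.
\<close>

section \<open>Change of variables\<close>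

text \<open>\<open>weak_div\<close>, \<open>cell_rep\<close> and \<open>outward_normal\<close> are
  choices or descriptions, so each becomes usable only after a uniqueness argument: the fundamental
  lemma for the first, continuity up to the boundary for the second, and a computation of the normal
  cone for the third, which covers only the relative interiors of the facets. By Nanson's formula
  the area factor of a facet is |det J| times the length of J^-T n. This is exactly what the Piola
  transform and the normalisation of the normal divide out, up to the sign of det J, so after
  pulling back to a flat reference facet only u_K \<bullet> n and that sign remain. Testing with the
  jump works whatever the weights of the two sides are, because the facet term becomes the integral
  of the squared jump. A facet with a single adjacent cell is treated alike; there the normal flux
  itself plays the part of the jump. The divergence of a transformed field is found in weak form, by
  pulling back the test function, so only first derivatives of the cell maps enter. Membership in
  H(div) follows at the very end, with the zero function as weak divergence.\<close>

text \<open>The change of variables theorem of the library requires a well-ordered index type.\<close>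

typedef 'a ord_copy = "UNIV :: 'a set" by simp

instance ord_copy :: (finite) finite
proof
  have "finite (range (Abs_ord_copy :: 'a \<Rightarrow> 'a ord_copy))" by simp
  moreover have "range (Abs_ord_copy :: 'a \<Rightarrow> 'a ord_copy) = UNIV"
    by (metis Rep_ord_copy_inverse surjI)
  ultimately show "finite (UNIV :: 'a ord_copy set)" by simp
qed

text \<open>The order is pulled back along the injection \<open>to_nat\<close>, so linearity and
  induction are inherited from the natural numbers.\<close>

instantiation ord_copy :: (countable) wellorder
begin

definition "x \<le> y \<longleftrightarrow> to_nat (Rep_ord_copy x) \<le> to_nat (Rep_ord_copy y)"
definition "x < y \<longleftrightarrow> to_nat (Rep_ord_copy x) < to_nat (Rep_ord_copy y)"

instance
proof
  fix P :: "'a ord_copy \<Rightarrow> bool" and a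
  assume step: "\<And>x. (\<And>y. y < x \<Longrightarrow> P y) \<Longrightarrow> P x"
  have "\<forall>x. to_nat (Rep_ord_copy x) = k \<longrightarrow> P x" for k
    by (induction k rule: less_induct) (use step less_ord_copy_def in blast)
  then show "P a" by blast
next
  fix x y z :: "'a ord_copy"
  show "x < y \<longleftrightarrow> x \<le> y \<and> \<not> y \<le> x" "x \<le> x" "x \<le> y \<or> y \<le> x"
    unfolding less_ord_copy_def less_eq_ord_copy_def by linarith+
  show "x \<le> z" if "x \<le> y" "y \<le> z"
    using that unfolding less_eq_ord_copy_def by linarith
  show "x = y" if "x \<le> y" "y \<le> x"
  proof -
    have "to_nat (Rep_ord_copy x) = to_nat (Rep_ord_copy y)"
      using that unfolding less_eq_ord_copy_def by linarith
    then show ?thesis by (simp add: Rep_ord_copy_inject)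
  qed
qed

end

definition relabel :: "('m \<Rightarrow> 'n) \<Rightarrow> real^'n \<Rightarrow> real^'m" where
  "relabel e x = (\<chi> i. x $ e i)"

lemma linear_relabel: "linear (relabel e)"
  by (auto simp: relabel_def linear_iff vec_eq_iff)

lemma relabel_inverse:
  assumes "bij e"
  shows "relabel (inv e) (relabel e x) = x" "relabel e (relabel (inv e) y) = y"
proof -
  have "e (inv e j) = j" "inv e (e i) = i" for i j
    using assms by (simp_all add: bij_is_inj bij_is_surj surj_f_inv_f)
  then show "relabel (inv e) (relabel e x) = x" "relabel e (relabel (inv e) y) = y"
    by (simp_all add: relabel_def)
qed

lemma prod_inner_Basis_cart: "(\<Prod>b\<in>Basis. (v::real^'n) \<bullet> b) = (\<Prod>i\<in>UNIV. v $ i)"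
proof -
  have "Basis = range (\<lambda>i. axis i (1::real) :: real^'n)"
    by (auto simp: Basis_vec_def)
  moreover have "inj (\<lambda>i. axis i (1::real) :: real^'n)"
    by (auto simp: inj_on_def axis_eq_axis)
  ultimately have "(\<Prod>b\<in>Basis. v \<bullet> b) = (\<Prod>i\<in>UNIV. v \<bullet> axis i 1)"
    by (metis (mono_tags, lifting) prod.reindex_cong)
  then show ?thesis by (simp add: inner_axis)
qed

text \<open>Permuting coordinates maps boxes to boxes with the same side lengths in another order,
  and \<open>lborel\<close> is characterised by the volumes of boxes. Passing to
  \<open>lebesgue\<close> is a completion, which commutes with the image measure because the null
  sets agree.\<close>

lemma lebesgue_distr_relabel:
  fixes e :: "'m::finite \<Rightarrow> 'n::finite"
  assumes "bij e"
  shows "distr lebesgue lebesgue (relabel e) = lebesgue" and "relabel e \<in> lebesgue \<rightarrow>\<^sub>M lebesgue"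
proof -
  have m: "relabel e \<in> borel_measurable borel"
    by (intro borel_measurable_continuous_onI linear_continuous_on linear_conv_bounded_linear[THEN iffD1] linear_relabel)
  have eq: "lborel = distr lborel borel (relabel e)"
  proof (rule lborel_eqI)
    fix l u :: "real^'m"
    assume lu: "\<And>b. b \<in> Basis \<Longrightarrow> l \<bullet> b \<le> u \<bullet> b"
    have "relabel e -` box l u = box (relabel (inv e) l) (relabel (inv e) u)"
      using assms by (auto simp: relabel_def mem_box_cart)
        (metis bij_inv_eq_iff)+
    moreover have le: "l $ i \<le> u $ i" for i using lu[of "axis i 1"] by (simp add: inner_axis axis_in_Basis_iff)
    moreover have "(\<Prod>b\<in>Basis. (relabel (inv e) u - relabel (inv e) l) \<bullet> b) = (\<Prod>b\<in>Basis. (u - l) \<bullet> b)"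
      using prod.reindex_bij_betw[of "inv e" UNIV UNIV "\<lambda>i. u $ i - l $ i"] assms
      by (simp add: prod_inner_Basis_cart relabel_def bij_imp_bij_inv)
    moreover have "relabel (inv e) l \<bullet> b \<le> relabel (inv e) u \<bullet> b" if "b \<in> Basis" for b
      using that le by (auto simp: Basis_vec_def inner_axis relabel_def)
    ultimately show "emeasure (distr lborel borel (relabel e)) (box l u) = (\<Prod>b\<in>Basis. (u - l) \<bullet> b)"
      using m by (simp add: emeasure_distr emeasure_lborel_box_eq)
  qed simp
  have "emeasure lborel A = emeasure (distr lebesgue lborel (relabel e)) A" if "A \<in> sets borel" for A
    using that m by (subst eq) (simp add: distr_completion cong: distr_cong)
  then have null: "null_sets (distr lebesgue lborel (relabel e)) = null_sets lborel"
    by (auto simp: null_sets_def)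
  have "lebesgue = completion (distr lebesgue lborel (relabel e))"
    using m by (subst eq) (simp add: distr_completion cong: distr_cong)
  also have "\<dots> = distr lebesgue lebesgue (relabel e)"
    using m null by (subst completion.completion_distr_eq) (auto simp: measurable_completion)
  finally show "distr lebesgue lebesgue (relabel e) = lebesgue" by simp
  show "relabel e \<in> lebesgue \<rightarrow>\<^sub>M lebesgue"
    using m null by (intro completion.measurable_completion2) (auto simp: measurable_completion)
qed

text \<open>Conjugation by \<open>e\<close> is a sign-preserving bijection between the permutations
  of the two index types, and it matches the Leibniz formulas term by term.\<close>

lemma det_relabel:
  fixes A :: "real^'n^'n" and e :: "'m::finite \<Rightarrow> 'n::finite"
  assumes "bij e"
  shows "det (\<chi> i j. A $ e i $ e j) = det A"
proof -
  have bi: "bij_betw (map_permutation UNIV e) {p. p permutes UNIV} {p. p permutes UNIV}"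
  proof (rule bij_betw_byWitness[where f' = "map_permutation UNIV (inv e)"])
    have "map_permutation UNIV (inv e) (map_permutation UNIV e p) = p" if "p permutes UNIV" for p
      using that assms by (subst map_permutation_compose) (auto simp: bij_is_inj bij_is_surj map_permutation_id' bij_imp_bij_inv)
    then show "\<forall>p\<in>{p. p permutes UNIV}. map_permutation UNIV (inv e) (map_permutation UNIV e p) = p" by simp
    have "map_permutation UNIV e (map_permutation UNIV (inv e) p) = p" if "p permutes UNIV" for p
      using that assms bij_imp_bij_inv[OF assms]
      by (subst map_permutation_compose) (auto simp: comp_def surj_f_inv_f bij_is_surj bij_is_inj)
    then show "\<forall>p\<in>{p. p permutes UNIV}. map_permutation UNIV e (map_permutation UNIV (inv e) p) = p" by simp
  qed (use assms bij_imp_bij_inv[OF assms] in \<open>auto intro!: map_permutation_permutes simp: bij_betw_def\<close>)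
  have "det A = (\<Sum>p | p permutes UNIV. of_int (sign (map_permutation UNIV e p)) *
           (\<Prod>i\<in>UNIV. A $ i $ map_permutation UNIV e p i))"
    unfolding det_def by (rule sum.reindex_bij_betw[OF bi, symmetric])
  also have "\<dots> = (\<Sum>p | p permutes UNIV. of_int (sign p) * (\<Prod>i\<in>UNIV. A $ e i $ e (p i)))"
  proof (rule sum.cong[OF refl], clarify)
    fix p :: "'m \<Rightarrow> 'm" assume p: "p permutes UNIV"
    have "(\<Prod>i\<in>UNIV. A $ i $ map_permutation UNIV e p i) = (\<Prod>i\<in>UNIV. A $ e i $ map_permutation UNIV e p (e i))"
      using prod.reindex_bij_betw[OF assms, of "\<lambda>i. A $ i $ map_permutation UNIV e p i"] by simp
    moreover have "map_permutation UNIV e p (e i) = e (p i)" for i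
      using assms by (simp add: map_permutation_apply bij_is_inj)
    ultimately show "of_int (sign (map_permutation UNIV e p)) * (\<Prod>i\<in>UNIV. A $ i $ map_permutation UNIV e p i) =
        of_int (sign p) * (\<Prod>i\<in>UNIV. A $ e i $ e (p i))"
      using p assms by (simp add: sign_map_permutation bij_is_inj)
  qed
  finally show ?thesis by (simp add: det_def)
qed

text \<open>Real functions are embedded into \<open>real^1\<close> by \<open>v\<close>, to fit a
  theorem on vector-valued absolutely integrable functions. If one side is not integrable then
  neither is the other, and both Bochner integrals are 0 by convention.\<close>

lemma change_of_variables_wellorder:
  fixes f :: "real^'m::{finite,wellorder} \<Rightarrow> real" and g :: "real^'m::_ \<Rightarrow> real^'m::_"
  assumes S: "S \<in> sets lebesgue"
    and der: "\<And>x. x \<in> S \<Longrightarrow> (g has_derivative g' x) (at x within S)"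
    and inj: "inj_on g S"
  shows "integrable (lebesgue_on S) (\<lambda>x. \<bar>det (matrix (g' x))\<bar> * f (g x)) \<longleftrightarrow>
           integrable (lebesgue_on (g ` S)) f" (is "?A \<longleftrightarrow> ?B")
    and "(\<integral>x. \<bar>det (matrix (g' x))\<bar> * f (g x) \<partial>lebesgue_on S) = (\<integral>x. f x \<partial>lebesgue_on (g ` S))"
proof -
  define v :: "real \<Rightarrow> real^1" where "v = vec"
  have v: "bounded_linear v" "bounded_linear (\<lambda>y::real^1. y $ 1)"
    by (auto simp: v_def linear_conv_bounded_linear[symmetric] linear_iff vec_eq_iff bounded_linear_vec_nth)
  have v1: "v r $ 1 = r" "c *\<^sub>R v r = v (c * r)" for r c by (auto simp: v_def vec_eq_iff)
  have vint: "integrable M (\<lambda>x. v (h x)) \<longleftrightarrow> integrable M h" for M :: "'z measure" and h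
    using integrable_bounded_linear[OF v(1), of M h] integrable_bounded_linear[OF v(2), of M "\<lambda>x. v (h x)"]
    by (auto simp: v1)
  have gS: "g ` S \<in> sets lebesgue"
    by (rule differentiable_image_in_sets_lebesgue[OF S])
      (use der in \<open>auto simp: differentiable_on_def differentiable_def\<close>)
  have *: "(\<lambda>x. v (h x)) absolutely_integrable_on X \<longleftrightarrow> integrable (lebesgue_on X) h"
    if "X \<in> sets lebesgue" for X h
    using that vint[of "lebesgue_on X" h] by (simp add: set_integrable_def integrable_restrict_space)
  have **: "integral X (\<lambda>x. v (h x)) = v (\<integral>x. h x \<partial>lebesgue_on X)"
    if "X \<in> sets lebesgue" "integrable (lebesgue_on X) h" for X :: "(real^'m::_) set" and h
    using that vint[of "lebesgue_on X" h] lebesgue_integral_eq_integral[of X "\<lambda>x. v (h x)"]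
      integral_bounded_linear[OF v(1) that(2)] by simp
  have cov: "(\<lambda>x. v (\<bar>det (matrix (g' x))\<bar> * f (g x))) absolutely_integrable_on S \<and>
      integral S (\<lambda>x. v (\<bar>det (matrix (g' x))\<bar> * f (g x))) = b \<longleftrightarrow>
      (\<lambda>x. v (f x)) absolutely_integrable_on (g ` S) \<and> integral (g ` S) (\<lambda>x. v (f x)) = b" for b
    using has_absolute_integral_change_of_variables[OF S der inj, of "\<lambda>x. v (f x)" b] by (simp add: v1)
  show AB: "?A \<longleftrightarrow> ?B"
    unfolding *[OF S, symmetric] *[OF gS, symmetric]
    using cov[of "integral S (\<lambda>x. v (\<bar>det (matrix (g' x))\<bar> * f (g x)))"] cov[of "integral (g ` S) (\<lambda>x. v (f x))"]
    by blast
  show "(\<integral>x. \<bar>det (matrix (g' x))\<bar> * f (g x) \<partial>lebesgue_on S) = (\<integral>x. f x \<partial>lebesgue_on (g ` S))"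
  proof (cases ?A)
    case True
    then have "v (\<integral>x. \<bar>det (matrix (g' x))\<bar> * f (g x) \<partial>lebesgue_on S) = v (\<integral>x. f x \<partial>lebesgue_on (g ` S))"
      using cov[of "integral (g ` S) (\<lambda>x. v (f x))"] AB *[OF S, of "\<lambda>x. \<bar>det (matrix (g' x))\<bar> * f (g x)"]
        *[OF gS, of f] **[OF S True] **[OF gS, of f] by simp
    then show ?thesis by (metis v1(1))
  next
    case False
    then show ?thesis using AB by (simp add: not_integrable_integral_eq)
  qed
qed

text \<open>The map is conjugated with a relabelling of the coordinates, which preserves Lebesgue
  measure and, by \<open>det_relabel\<close>, the Jacobian determinant.\<close>

lemma change_of_variables:
  fixes f :: "real^'n \<Rightarrow> real" and g :: "real^'n \<Rightarrow> real^'n"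
  assumes S: "S \<in> sets lebesgue"
    and der: "\<And>x. x \<in> S \<Longrightarrow> (g has_derivative g' x) (at x within S)"
    and inj: "inj_on g S"
  shows "integrable (lebesgue_on S) (\<lambda>x. \<bar>det (matrix (g' x))\<bar> * f (g x)) \<longleftrightarrow>
           integrable (lebesgue_on (g ` S)) f" (is ?A)
    and "(\<integral>x. \<bar>det (matrix (g' x))\<bar> * f (g x) \<partial>lebesgue_on S) = (\<integral>x. f x \<partial>lebesgue_on (g ` S))" (is ?B)
proof -
  define e :: "'n ord_copy \<Rightarrow> 'n" where "e = Rep_ord_copy"
  have e: "bij e" unfolding e_def
    by (rule o_bij[of Abs_ord_copy]) (auto simp: Rep_ord_copy_inverse Abs_ord_copy_inverse fun_eq_iff)
  define R where "R = relabel e"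
  define L where "L = relabel (inv e)"
  have LR [simp]: "L (R x) = x" "R (L y) = y" for x y
    using relabel_inverse[OF e] by (auto simp: L_def R_def)
  have lin: "linear L" "linear R" by (auto simp: L_def R_def linear_relabel)
  have bl: "bounded_linear L" "bounded_linear R" using lin by (simp_all add: linear_conv_bounded_linear)
  have dL: "distr lebesgue lebesgue L = lebesgue" and mL: "L \<in> lebesgue \<rightarrow>\<^sub>M lebesgue" and mR: "R \<in> lebesgue \<rightarrow>\<^sub>M lebesgue"
    using lebesgue_distr_relabel e bij_imp_bij_inv unfolding L_def R_def by blast+
  have gS: "g ` S \<in> sets lebesgue"
    by (rule differentiable_image_in_sets_lebesgue[OF S])
      (use der in \<open>auto simp: differentiable_on_def differentiable_def\<close>)
  have RX: "R ` X = L -` X" for X using LR by (auto simp: image_iff) (metis LR)+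
  have RXs: "R ` X \<in> sets lebesgue" if "X \<in> sets lebesgue" for X
    using measurable_sets[OF mL that] by (simp add: RX)
  have tr: "integrable (lebesgue_on (R ` X)) (\<lambda>y. h (L y)) \<longleftrightarrow> integrable (lebesgue_on X) h"
     "(\<integral>y. h (L y) \<partial>lebesgue_on (R ` X)) = (\<integral>x. h x \<partial>lebesgue_on X)"
    if "X \<in> sets lebesgue" for X and h :: "real^'n \<Rightarrow> real"
  proof -
    define H where "H = (\<lambda>x. indicator X x *\<^sub>R h x)"
    have HL: "H (L y) = indicator (R ` X) y *\<^sub>R h (L y)" for y
      by (auto simp: H_def RX indicator_def)
    have HR: "(\<lambda>x. H (L (R x))) = H" by simp
    \<comment> \<open>\<open>L\<close> and \<open>R\<close> are measurable and mutually inverse, so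
      measurability passes in both directions; where it fails, both sides are non-integrable and
      both integrals are 0.\<close>
    have meas: "(\<lambda>y. H (L y)) \<in> borel_measurable lebesgue \<longleftrightarrow> H \<in> borel_measurable lebesgue"
    proof
      assume "(\<lambda>y. H (L y)) \<in> borel_measurable lebesgue"
      from measurable_compose[OF mR this] show "H \<in> borel_measurable lebesgue" unfolding HR .
    qed (rule measurable_compose[OF mL])
    have "integrable lebesgue (\<lambda>y. H (L y)) \<longleftrightarrow> integrable lebesgue H \<and> True"
    proof (cases "H \<in> borel_measurable lebesgue")
      case True
      then show ?thesis using integrable_distr_eq[OF mL, of H] dL by simp
    next
      case False
      then show ?thesis using meas by (auto dest: borel_measurable_integrable)
    qed
    moreover have "(\<integral>y. H (L y) \<partial>lebesgue) = (\<integral>x. H x \<partial>lebesgue)"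
    proof (cases "H \<in> borel_measurable lebesgue")
      case True
      then show ?thesis using integral_distr[OF mL, of H] dL by simp
    next
      case False
      then show ?thesis using meas by (metis borel_measurable_integrable not_integrable_integral_eq)
    qed
    ultimately show "integrable (lebesgue_on (R ` X)) (\<lambda>y. h (L y)) \<longleftrightarrow> integrable (lebesgue_on X) h"
     "(\<integral>y. h (L y) \<partial>lebesgue_on (R ` X)) = (\<integral>x. h x \<partial>lebesgue_on X)"
      using that RXs[OF that] unfolding HL
      by (simp_all add: integrable_restrict_space integral_restrict_space H_def)
  qed
  define gg where "gg = (\<lambda>y. R (g (L y)))"
  define gg' where "gg' = (\<lambda>y h. R (g' (L y) (L h)))"
  have "(g has_derivative g' (L y)) (at (L y) within L ` R ` S)" if "y \<in> R ` S" for y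
    using that der by (auto simp: image_image)
  then have der2: "(gg has_derivative gg' y) (at y within R ` S)" if "y \<in> R ` S" for y
    unfolding gg_def gg'_def
    using that bounded_linear_imp_has_derivative[OF bl(1)] bounded_linear.has_derivative[OF bl(2)]
       has_derivative_in_compose[of L L y "R ` S" g "g' (L y)"] by blast
  have inj2: "inj_on gg (R ` S)"
    using inj unfolding gg_def inj_on_def by (metis (no_types, lifting) LR(1) imageE)
  have "matrix (gg' y) = (\<chi> i j. matrix (g' (L y)) $ e i $ e j)" for y
  proof -
    have "inv e i = j \<longleftrightarrow> i = e j" for i j
      using e by (metis bij_inv_eq_iff)
    then have Lax: "L (axis j 1) = axis (e j) 1" for j
      unfolding L_def relabel_def vec_eq_iff axis_def by (simp add: eq_commute)
    show ?thesis by (simp add: gg'_def matrix_def R_def relabel_def Lax)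
  qed
  then have dd: "det (matrix (gg' y)) = det (matrix (g' (L y)))" for y
    by (simp add: det_relabel[OF e])
  have im: "gg ` R ` S = R ` g ` S" by (auto simp: gg_def image_image)
  have gL: "f (L (gg y)) = f (g (L y))" for y by (simp add: gg_def)
  show ?A
    using change_of_variables_wellorder(1)[OF RXs[OF S] der2 inj2, of "\<lambda>y. f (L y)"]
       tr(1)[OF S, of "\<lambda>x. \<bar>det (matrix (g' x))\<bar> * f (g x)"] tr(1)[OF gS, of f]
    by (simp add: im dd gL)
  show ?B
    using change_of_variables_wellorder(2)[OF RXs[OF S] der2 inj2, of "\<lambda>y. f (L y)"]
       tr(2)[OF S, of "\<lambda>x. \<bar>det (matrix (g' x))\<bar> * f (g x)"] tr(2)[OF gS, of f]
    by (simp add: im dd gL)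
qed

section \<open>Integrals of derivatives\<close>

definition outer :: "real^'n \<Rightarrow> real^'n \<Rightarrow> real^'n^'n" where
  "outer a b = (\<chi> i j. a $ i * b $ j)"

lemma outer_mult_vec: "outer a b *v x = (b \<bullet> x) *\<^sub>R a"
  by (simp add: outer_def matrix_vector_mult_def vec_eq_iff inner_vec_def sum_distrib_left sum_distrib_right mult_ac)

text \<open>The matrix determinant lemma. An orthogonal change of basis turns \<open>b\<close> into
  a multiple of one axis vector; the matrix then differs from the identity only in column
  \<open>k\<close>, and Cramer's lemma evaluates it. The maps along a facet normal used below have
  Jacobians of this form.\<close>

lemma det_add_outer:
  fixes a b :: "real^'n"
  shows "det (mat 1 + outer a b) = 1 + a \<bullet> b"
proof -
  obtain k :: 'n where True by simp
  obtain B :: "real^'n^'n" where B: "orthogonal_matrix B" and Bk: "b = norm b *\<^sub>R (B *v axis k 1)"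
  proof (cases "b = 0")
    case True
    then show ?thesis using that[of "mat 1"] by (simp add: orthogonal_matrix_id)
  next
    case False
    then obtain A where "orthogonal_matrix A" "A *v (axis k 1) = b /\<^sub>R norm b"
      using orthogonal_matrix_exists_basis[of "b /\<^sub>R norm b" k] by auto
    then show ?thesis using that[of A] False by simp
  qed
  have BB: "transpose B ** B = mat 1" "B ** transpose B = mat 1"
    using B by (simp_all add: orthogonal_matrix_def)
  define c where "c = norm b *\<^sub>R (transpose B *v a)"
  have ck: "c $ k = a \<bullet> b"
  proof -
    have "c $ k = c \<bullet> axis k 1" by (simp add: inner_axis)
    also have "\<dots> = a \<bullet> (norm b *\<^sub>R (B *v axis k 1))"
      unfolding c_def inner_scaleR_left inner_scaleR_right
      by (metis dot_lmul_matrix inner_commute transpose_matrix_vector)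
    finally show ?thesis using Bk by simp
  qed
  have "transpose B ** (mat 1 + outer a b) ** B =
      (\<chi> i j. if j = k then (mat 1 *v (axis k 1 + c)) $ i else mat 1 $ i $ j)" (is "?L = ?R")
  proof (rule matrix_eq[THEN iffD2], rule allI)
    fix x :: "real^'n"
    have bB: "b \<bullet> (B *v x) = norm b * x $ k"
    proof -
      have "b \<bullet> (B *v x) = norm b * ((B *v axis k 1) \<bullet> (B *v x))"
        by (subst Bk) simp
      also have "(B *v axis k 1) \<bullet> (B *v x) = axis k 1 \<bullet> x"
        by (metis BB(1) dot_lmul_matrix matrix_vector_mul_assoc matrix_vector_mul_lid transpose_matrix_vector)
      finally show ?thesis by (simp add: inner_axis')
    qed
    have "?L *v x = transpose B *v (B *v x) + transpose B *v ((b \<bullet> (B *v x)) *\<^sub>R a)"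
      by (simp add: matrix_vector_mul_assoc[symmetric] matrix_vector_mult_add_rdistrib outer_mult_vec matrix_vector_right_distrib)
    also have "\<dots> = x + x $ k *\<^sub>R c"
      by (simp add: matrix_vector_mul_assoc BB bB c_def matrix_vector_mult_scaleR)
    also have "\<dots> = ?R *v x"
    proof -
      have "(\<Sum>j\<in>UNIV. (if j = k then (axis k 1 + c) $ i else mat 1 $ i $ j) * x $ j) = x $ i + x $ k * c $ i" for i
      proof -
        have "(\<Sum>j\<in>UNIV. (if j = k then (axis k 1 + c) $ i else mat 1 $ i $ j) * x $ j) =
            (\<Sum>j\<in>UNIV. (if j = i then x $ j else 0) + (if j = k then c $ i * x $ j else 0))"
          by (rule sum.cong) (auto simp: axis_def mat_def algebra_simps)
        also have "\<dots> = x $ i + x $ k * c $ i" by (simp add: sum.distrib)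
        finally show ?thesis .
      qed
      then show ?thesis
        by (simp only: matrix_vector_mul_lid) (simp add: vec_eq_iff matrix_vector_mult_def)
    qed
    finally show "?L *v x = ?R *v x" .
  qed
  then have "det ?L = (axis k 1 + c) $ k * det (mat 1 :: real^'n^'n)"
    using cramer_lemma[of k "mat 1" "axis k 1 + c"] by simp
  moreover have "det ?L = det (mat 1 + outer a b)"
  proof -
    have "det (transpose B) * det B = 1" using BB(1) by (metis det_I det_mul)
    then show ?thesis by (simp add: det_mul mult.commute mult.left_commute)
  qed
  ultimately show ?thesis using ck by simp
qed

lemma integral_translation:
  fixes g :: "'a::euclidean_space \<Rightarrow> real"
  assumes "g \<in> borel_measurable borel"
  shows "(\<integral>x. g (x + c) \<partial>lborel) = (\<integral>x. g x \<partial>lborel)"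
    and "integrable lborel (\<lambda>x. g (x + c)) \<longleftrightarrow> integrable lborel g"
  using assms integral_distr[of "(+) c" lborel borel g] integrable_distr_eq[of "(+) c" lborel borel g]
  by (simp_all add: lborel_distr_plus add.commute)

lemma integrable_compact_support:
  fixes g :: "'a::euclidean_space \<Rightarrow> real"
  assumes "continuous_on UNIV g" "\<And>x. x \<notin> cball 0 R \<Longrightarrow> g x = 0"
  shows "integrable lborel g"
proof -
  have "integrable lborel (\<lambda>x. indicator (cball 0 R) x *\<^sub>R g x)"
    by (intro borel_integrable_compact) (use assms(1) continuous_on_subset in auto)
  moreover have "(\<lambda>x. indicator (cball 0 R) x *\<^sub>R g x) = g"
    using assms(2) by (fastforce simp: indicator_def)
  ultimately show ?thesis by simp
qed

text \<open>The difference quotients integrate to zero by translation invariance.\<close>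

lemma integral_directional_derivative_eq_0:
  fixes g :: "'a::euclidean_space \<Rightarrow> real"
  assumes der: "\<And>x. (g has_derivative g' x) (at x)"
    and cont: "continuous_on UNIV (\<lambda>x. g' x e)"
    and supp: "\<And>x. x \<notin> cball 0 R \<Longrightarrow> g x = 0"
  shows "(\<integral>x. g' x e \<partial>lborel) = 0"
proof -
  define h where "h = (\<lambda>k::nat. inverse (real (Suc k)))"
  have h: "0 < h k" "h k \<le> 1" for k by (auto simp: h_def field_simps)
  have h0: "h \<longlonglongrightarrow> 0" unfolding h_def by (rule LIMSEQ_inverse_real_of_nat)
  have gcont: "continuous_on UNIV g"
    using der has_derivative_continuous continuous_at_imp_continuous_on by blast
  have gm: "g \<in> borel_measurable borel" using gcont by (rule borel_measurable_continuous_onI)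
  have gi: "integrable lborel g" by (rule integrable_compact_support[OF gcont supp])
  define D where "D = (\<lambda>k x. (g (x + h k *\<^sub>R e) - g x) / h k)"
  have D0: "(\<integral>x. D k x \<partial>lborel) = 0" for k
    using integral_translation[OF gm, of "h k *\<^sub>R e"] gi by (simp add: D_def)
  \<comment> \<open>The quotient vanishes unless \<open>x\<close> lies within \<open>norm e\<close>
    of the support ball, since the steps are at most \<open>norm e\<close> long. The second
    \<open>norm e\<close> makes room for the intermediate point of the mean value theorem.\<close>
  define B where "B = cball (0::'a) (R + 2 * norm e)"
  obtain M where M: "\<And>x. x \<in> B \<Longrightarrow> \<bar>g' x e\<bar> \<le> M"
  proof -
    have "compact ((\<lambda>x. g' x e) ` B)"
      by (intro compact_continuous_image continuous_on_subset[OF cont]) (auto simp: B_def)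
    then have "bounded ((\<lambda>x. g' x e) ` B)" by (rule compact_imp_bounded)
    then show ?thesis using that unfolding bounded_iff by auto
  qed
  have bound: "norm (D k x) \<le> \<bar>M\<bar> * indicator B x" for k x
  proof (cases "x \<in> cball 0 (R + norm e)")
    case False
    then have n: "norm x > R + norm e" by simp
    have hk: "norm (h k *\<^sub>R e) \<le> norm e" using h[of k] by (simp add: mult_left_le_one_le)
    have "norm x \<le> norm (x + h k *\<^sub>R e) + norm (h k *\<^sub>R e)"
      using norm_triangle_ineq4[of "x + h k *\<^sub>R e" "h k *\<^sub>R e"] by simp
    then have "norm (x + h k *\<^sub>R e) > R" "norm x > R" using n hk norm_ge_zero[of e] by linarith+
    then show ?thesis using supp by (simp add: D_def)
  next
    case True
    have dt: "((\<lambda>t. g (x + t *\<^sub>R e)) has_derivative (\<lambda>s. g' (x + t *\<^sub>R e) (s *\<^sub>R e))) (at t within {0..h k})" for t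
      by (rule has_derivative_compose[OF _ der]) (auto intro!: derivative_eq_intros)
    obtain t where t: "t \<in> {0<..<h k}" "g (x + h k *\<^sub>R e) - g (x + 0 *\<^sub>R e) = g' (x + t *\<^sub>R e) ((h k - 0) *\<^sub>R e)"
      using mvt_simple[OF h(1)[of k] dt] by blast
    have "g' (x + t *\<^sub>R e) (h k *\<^sub>R e) = h k * g' (x + t *\<^sub>R e) e"
      using linear_scale[OF has_derivative_linear[OF der]] by simp
    then have De: "D k x = g' (x + t *\<^sub>R e) e" using t h(1)[of k] by (simp add: D_def)
    have "norm (t *\<^sub>R e) \<le> norm e" using t h(2)[of k] by (simp add: mult_left_le_one_le)
    then have "x + t *\<^sub>R e \<in> B" "x \<in> B"
      using True norm_triangle_ineq[of x "t *\<^sub>R e"] norm_ge_zero[of e]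
      unfolding B_def mem_cball_0 by linarith+
    then show ?thesis using M[of "x + t *\<^sub>R e"] De by simp
  qed
  have lim: "(\<lambda>k. D k x) \<longlonglongrightarrow> g' x e" for x
  proof -
    have "((\<lambda>t. g (x + t *\<^sub>R e)) has_derivative (\<lambda>s. g' (x + 0 *\<^sub>R e) (s *\<^sub>R e))) (at 0)"
      by (rule has_derivative_compose[OF _ der]) (auto intro!: derivative_eq_intros)
    moreover have "g' x (s *\<^sub>R e) = s * g' x e" for s
      using linear_scale[OF has_derivative_linear[OF der]] by simp
    moreover have "(\<lambda>s. s * g' x e) = (*) (g' x e)" by (simp add: fun_eq_iff)
    ultimately have "((\<lambda>t. g (x + t *\<^sub>R e)) has_field_derivative g' x e) (at 0)"
      unfolding has_field_derivative_def by simp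
    then have "((\<lambda>t. (g (x + t *\<^sub>R e) - g x) / t) \<longlongrightarrow> g' x e) (at 0)"
      by (simp add: DERIV_def)
    moreover have "filterlim h (at 0) sequentially"
      using h0 h(1) by (auto simp: filterlim_at intro!: always_eventually) (metis less_irrefl)
    ultimately show ?thesis unfolding D_def by (rule filterlim_compose)
  qed
  have "(\<lambda>k. \<integral>x. D k x \<partial>lborel) \<longlonglongrightarrow> (\<integral>x. g' x e \<partial>lborel)"
  proof (rule integral_dominated_convergence[where w = "\<lambda>x. \<bar>M\<bar> * indicator B x"])
    show "(\<lambda>x. g' x e) \<in> borel_measurable lborel"
      using borel_measurable_continuous_onI[OF cont] by simp
    show "D k \<in> borel_measurable lborel" for k
      unfolding D_def using gm by measurable
    show "integrable lborel (\<lambda>x. \<bar>M\<bar> * indicat_real B x)"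
      using emeasure_bounded_finite[of B] by (simp add: B_def)
  qed (use lim bound in auto)
  then show ?thesis unfolding D0 using LIMSEQ_unique tendsto_const by metis
qed

section \<open>Test functions and weak divergences\<close>

lemma grad_nth: "(f has_derivative f') (at x) \<Longrightarrow> grad f x $ i = f' (axis i 1)"
  by (simp add: grad_def frechet_derivative_at[symmetric])

lemma has_derivative_grad:
  fixes f :: "real^'n \<Rightarrow> real"
  assumes "f differentiable (at x)"
  shows "(f has_derivative (\<lambda>h. grad f x \<bullet> h)) (at x)"
proof -
  have d: "(f has_derivative frechet_derivative f (at x)) (at x)"
    using assms by (simp add: frechet_derivative_works)
  then have l: "linear (frechet_derivative f (at x))" by (rule has_derivative_linear)
  have "frechet_derivative f (at x) h = grad f x \<bullet> h" for h
  proof -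
    have "frechet_derivative f (at x) h = frechet_derivative f (at x) (\<Sum>i\<in>UNIV. h $ i *\<^sub>R axis i 1)"
      using basis_expansion[of h] by (simp add: scalar_mult_eq_scaleR)
    also have "\<dots> = grad f x \<bullet> h"
      by (simp add: linear_sum[OF l] linear_scale[OF l] grad_def inner_vec_def mult.commute)
    finally show ?thesis .
  qed
  then have "frechet_derivative f (at x) = (\<lambda>h. grad f x \<bullet> h)" by auto
  then show ?thesis using d by simp
qed

section \<open>Smooth functions and bumps supported in boxes\<close>

lemma Ck_Suc_imp: "Ck (Suc k) f \<Longrightarrow> Ck k f"
proof (induction k arbitrary: f)
  case 0
  then show ?case
    by (auto simp: continuous_on_eq_continuous_at differentiable_imp_continuous_within)
next
  case (Suc k)
  then show ?case by (metis Ck.simps(2))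
qed

lemma Ck_const: "Ck k (\<lambda>x::real^'n. c)"
proof (induction k arbitrary: c)
  case (Suc k)
  have "grad (\<lambda>x. c) x $ i = 0" for x :: "real^'n" and i
    by (subst grad_nth[OF has_derivative_const]) simp
  then have "(\<lambda>x::real^'n. grad (\<lambda>x. c) x $ i) = (\<lambda>x. 0)" for i by auto
  then show ?case using Suc by simp
qed simp

lemma Ck_add: "Ck k f \<Longrightarrow> Ck k g \<Longrightarrow> Ck k (\<lambda>x. f x + g x)"
proof (induction k arbitrary: f g)
  case (Suc k)
  have "grad (\<lambda>x. f x + g x) x $ i = grad f x $ i + grad g x $ i" for x i
    using Suc.prems grad_nth[OF has_derivative_add[OF has_derivative_grad has_derivative_grad], of f x g i]
    by (simp add: inner_axis)
  then show ?case using Suc by simp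
qed (auto intro: continuous_intros)

lemma Ck_mult: "Ck k f \<Longrightarrow> Ck k g \<Longrightarrow> Ck k (\<lambda>x. f x * g x)"
proof (induction k arbitrary: f g)
  case (Suc k)
  have "grad (\<lambda>x. f x * g x) x $ i = f x * grad g x $ i + grad f x $ i * g x" for x i
    using Suc.prems grad_nth[OF has_derivative_mult[OF has_derivative_grad has_derivative_grad], of f x g i]
    by (simp add: inner_axis)
  moreover have "Ck k (\<lambda>x. f x * grad g x $ i + grad f x $ i * g x)" for i
    using Suc Ck_Suc_imp[OF Suc.prems(1)] Ck_Suc_imp[OF Suc.prems(2)] by (intro Ck_add) auto
  ultimately show ?case using Suc.prems by (simp add: differentiable_mult)
qed (auto intro: continuous_intros)

lemma Ck_prod: "(\<And>i. i \<in> I \<Longrightarrow> Ck k (f i)) \<Longrightarrow> Ck k (\<lambda>x. \<Prod>i\<in>I. f i x)"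
  by (induction I rule: infinite_finite_induct) (auto intro: Ck_const Ck_mult)

text \<open>For \<open>m = 0\<close> this is the classical exp(-c/t), extended smoothly by zero.
  Differentiation produces powers of 1/t; with them included the family is closed under derivatives
  up to linear combinations, which lets \<open>Ck_flat_exp\<close> go by induction for all
  \<open>m\<close> at once.\<close>

definition flat_exp :: "real \<Rightarrow> nat \<Rightarrow> real \<Rightarrow> real" where
  "flat_exp c m t = (if t > 0 then (1 / t) ^ m * exp (- (c / t)) else 0)"

lemma flat_exp_deriv:
  assumes "c > 0"
  shows "(flat_exp c m has_real_derivative c * flat_exp c (m + 2) t - m * flat_exp c (m + 1) t) (at t)"
proof -
  consider "t > 0" | "t < 0" | "t = 0" by linarith
  then show ?thesis
  proof cases
    case 1
    have "((\<lambda>t. (1 / t) ^ m * exp (- (c / t))) has_real_derivative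
        c * flat_exp c (m + 2) t - m * flat_exp c (m + 1) t) (at t)"
    proof (cases m)
      case 0
      then show ?thesis
        using 1 by (auto intro!: derivative_eq_intros simp: flat_exp_def field_simps power2_eq_square)
    next
      case (Suc n)
      have "((\<lambda>t. (1 / t) ^ Suc n * exp (- (c / t))) has_real_derivative
         (1 / t) ^ Suc n * (exp (- (c / t)) * (c * (1 / t)\<^sup>2)) - (real (Suc n) * ((1 / t)\<^sup>2 * (1 / t) ^ n)) * exp (- (c / t))) (at t)"
      proof -
        have "((\<lambda>t. 1 / t) has_real_derivative - ((1 / t)\<^sup>2)) (at t)"
          using 1 by (auto intro!: derivative_eq_intros simp: power2_eq_square)
        from DERIV_power_Suc[OF this, of n]
        have "((\<lambda>t. (1 / t) ^ Suc n) has_real_derivative - (real (Suc n) * ((1 / t)\<^sup>2 * (1 / t) ^ n))) (at t)"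
          by simp
        moreover have "((\<lambda>t. exp (- (c / t))) has_real_derivative exp (- (c / t)) * (c * (1 / t)\<^sup>2)) (at t)"
          using 1 by (auto intro!: derivative_eq_intros simp: power2_eq_square)
        ultimately show ?thesis
          by (rule DERIV_mult[THEN DERIV_cong]) simp
      qed
      then show ?thesis
        using 1 Suc by (simp add: flat_exp_def power2_eq_square algebra_simps)
    qed
    moreover have ev: "\<forall>\<^sub>F s in nhds t. flat_exp c m s = (1 / s) ^ m * exp (- (c / s))"
      using eventually_nhds_in_open[of "{0<..}" t] 1 by (auto elim!: eventually_mono simp: flat_exp_def)
    ultimately show ?thesis by (subst DERIV_cong_ev[OF refl ev refl])
  next
    case 2
    have ev: "\<forall>\<^sub>F s in nhds t. flat_exp c m s = 0"
      using eventually_nhds_in_open[of "{..<0}" t] 2 by (auto elim!: eventually_mono simp: flat_exp_def)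
    moreover have "c * flat_exp c (m + 2) t - m * flat_exp c (m + 1) t = 0" using 2 by (simp add: flat_exp_def)
    ultimately show ?thesis by (subst DERIV_cong_ev[OF refl ev refl]) (simp only: DERIV_const)
  next
    \<comment> \<open>With s = c/t the right-hand difference quotient at 0 is a constant times
      s^(m+1) / exp s, and the exponential wins as s tends to infinity.\<close>
    case 3
    have "((\<lambda>h. flat_exp c m h / h) \<longlongrightarrow> 0) (at_right 0)"
    proof -
      have "((\<lambda>h. (1 / h) ^ m * exp (- (c / h)) / h) \<longlongrightarrow> 0) (at_right 0)"
      proof -
        have "filterlim (\<lambda>h. c * inverse h) at_top (at_right 0)"
          by (rule filterlim_tendsto_pos_mult_at_top[OF tendsto_const assms filterlim_inverse_at_top_right])
        from filterlim_compose[OF tendsto_power_div_exp_0[of "m + 1"] this]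
        have "((\<lambda>h. (1 / c) ^ (m + 1) * ((c * inverse h) ^ (m + 1) / exp (c * inverse h))) \<longlongrightarrow> (1 / c) ^ (m + 1) * 0) (at_right 0)"
          by (intro tendsto_mult tendsto_const)
        moreover have "(1 / c) ^ (m + 1) * ((c * inverse h) ^ (m + 1) / exp (c * inverse h)) =
            (1 / h) ^ m * exp (- (c / h)) / h" for h
          using assms by (simp add: exp_minus field_simps power_mult_distrib)
        ultimately show ?thesis by simp
      qed
      moreover have ev: "\<forall>\<^sub>F h in at_right 0. flat_exp c m h / h = (1 / h) ^ m * exp (- (c / h)) / h"
        by (auto simp: eventually_at_filter flat_exp_def)
      ultimately show ?thesis by (subst tendsto_cong[OF ev])
    qed
    moreover have "((\<lambda>h. flat_exp c m h / h) \<longlongrightarrow> 0) (at_left 0)"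
      by (rule tendsto_eventually) (auto simp: eventually_at_filter flat_exp_def)
    ultimately have "((\<lambda>h. flat_exp c m h / h) \<longlongrightarrow> 0) (at 0)"
      by (simp add: filterlim_split_at)
    then show ?thesis using 3 by (simp add: DERIV_def flat_exp_def)
  qed
qed

lemma Ck_flat_exp:
  assumes "c > 0"
  shows "Ck k (\<lambda>x::real^'n. flat_exp c m (s * x $ i + d))"
proof (induction k arbitrary: m)
  case 0
  have "continuous_on UNIV (flat_exp c m)"
    using flat_exp_deriv[OF assms] DERIV_isCont continuous_at_imp_continuous_on by blast
  then show ?case
    by (auto intro!: continuous_on_compose2[of UNIV "flat_exp c m"] continuous_intros)
next
  case (Suc k)
  let ?d = "\<lambda>x::real^'n. c * flat_exp c (m + 2) (s * x $ i + d) + (- real m) * flat_exp c (m + 1) (s * x $ i + d)"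
  have inner: "((\<lambda>x::real^'n. s * x $ i + d) has_derivative (\<lambda>h. s * h $ i)) (at x)" for x
    using bounded_linear_imp_has_derivative[OF bounded_linear_vec_nth[of i], of "at x"]
    by (auto intro!: derivative_eq_intros)
  have der: "((\<lambda>x. flat_exp c m (s * x $ i + d)) has_derivative (\<lambda>h. ?d x * (s * h $ i))) (at x)" for x
    using has_derivative_compose[OF inner flat_exp_deriv[OF assms, unfolded has_field_derivative_def]] by simp
  have "Ck k (\<lambda>x. ?d x * (s * axis j 1 $ i))" for j
    by (intro Ck_mult Ck_add Ck_const Suc)
  then show ?case
    using der by (auto simp: grad_nth[OF der] differentiable_def)
qed

text \<open>The parameter \<open>c\<close> sets the steepness: as \<open>c\<close> tends to 0 the
  bump tends to the indicator of the open box. The odd-looking coefficients bring both factors into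
  the shape of \<open>Ck_flat_exp\<close>.\<close>

definition box_bump :: "real^'n \<Rightarrow> real^'n \<Rightarrow> real \<Rightarrow> real^'n \<Rightarrow> real" where
  "box_bump a b c x = (\<Prod>i\<in>UNIV. flat_exp c 0 (1 * x $ i + (- a $ i)) * flat_exp c 0 ((- 1) * x $ i + b $ i))"

lemma box_bump:
  assumes "c > 0"
  shows "Ck k (box_bump a b c)" "x \<notin> box a b \<Longrightarrow> box_bump a b c x = 0" "\<bar>box_bump a b c x\<bar> \<le> 1"
proof -
  show "Ck k (box_bump a b c)"
    unfolding box_bump_def by (intro Ck_prod Ck_mult Ck_flat_exp assms)
  show "box_bump a b c x = 0" if "x \<notin> box a b"
    using that by (force simp: box_bump_def mem_box_cart flat_exp_def)
  have "0 \<le> flat_exp c 0 t \<and> flat_exp c 0 t \<le> 1" for t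
    using assms by (auto simp: flat_exp_def)
  then show "\<bar>box_bump a b c x\<bar> \<le> 1"
    unfolding box_bump_def abs_prod by (intro prod_le_1) (auto simp: abs_mult intro: mult_le_one)
qed

lemma box_bump_tendsto:
  fixes x :: "real^'n"
  assumes "x \<in> box a b"
  shows "(\<lambda>k. box_bump a b (inverse (Suc k)) x) \<longlonglongrightarrow> 1"
proof -
  have t: "(\<lambda>k. flat_exp (inverse (Suc k)) 0 t) \<longlonglongrightarrow> 1" if "t > 0" for t
  proof -
    have "(\<lambda>k. exp (- (inverse (real (Suc k)) / t))) \<longlonglongrightarrow> exp (- (0 / t))"
      using that by (intro tendsto_intros LIMSEQ_inverse_real_of_nat) auto
    then show ?thesis using that by (simp add: flat_exp_def)
  qed
  have "(\<lambda>k. box_bump a b (inverse (Suc k)) x) \<longlonglongrightarrow> (\<Prod>i\<in>(UNIV::'n set). 1 * 1)"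
    unfolding box_bump_def
  proof (rule tendsto_prod)
    fix i :: 'n
    have "1 * x $ i + - a $ i > 0" "- 1 * x $ i + b $ i > 0"
      using assms by (auto simp: mem_box_cart)
    then show "(\<lambda>k. flat_exp (inverse (Suc k)) 0 (1 * x $ i + - a $ i) * flat_exp (inverse (Suc k)) 0 (- 1 * x $ i + b $ i))
        \<longlonglongrightarrow> 1 * 1"
      by (intro tendsto_mult t)
  qed
  then show ?thesis by simp
qed

lemma box_bump_test_function:
  assumes "cbox a b \<subseteq> U" "c > 0"
  shows "box_bump a b c \<in> test_functions U"
proof -
  have "{x. box_bump a b c x \<noteq> 0} \<subseteq> cbox a b" using box_bump(2)[OF assms(2)] box_subset_cbox by blast
  then have "closure {x. box_bump a b c x \<noteq> 0} \<subseteq> cbox a b"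
    by (simp add: closure_minimal closed_cbox)
  moreover from this have "compact (closure {x. box_bump a b c x \<noteq> 0})"
    using bounded_subset[OF bounded_cbox] by (auto simp: compact_eq_bounded_closed)
  ultimately show ?thesis
    using assms box_bump(1)[OF assms(2)] unfolding test_functions_def by blast
qed

section \<open>The fundamental lemma of the calculus of variations and uniqueness of weak
  divergences\<close>

lemma square_integrable_imp_integrable_on:
  fixes g :: "real^'n \<Rightarrow> real"
  assumes "square_integrable (lebesgue_on U) g" "S \<subseteq> U" "U \<in> sets lebesgue" "S \<in> lmeasurable"
  shows "integrable (lebesgue_on S) g"
proof (rule Bochner_Integration.integrable_bound)
  have S: "S \<in> sets lebesgue" using assms(4) by auto
  have m: "g \<in> borel_measurable (lebesgue_on S)"
    by (rule measurable_restrict_mono[OF _ assms(2)]) (use assms(1) in \<open>simp add: square_integrable_def\<close>)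
  then show "g \<in> borel_measurable (lebesgue_on S)" .
  have "integrable (lebesgue_on U) (\<lambda>x. (norm (g x))\<^sup>2)" using assms(1) by (simp add: square_integrable_def)
  then have "set_integrable lebesgue U (\<lambda>x. (norm (g x))\<^sup>2)"
    using assms(3) by (simp add: set_integrable_def integrable_restrict_space)
  then have "set_integrable lebesgue S (\<lambda>x. (norm (g x))\<^sup>2)"
    by (rule set_integrable_subset[OF _ S assms(2)])
  then have "integrable (lebesgue_on S) (\<lambda>x. (norm (g x))\<^sup>2)"
    using S by (simp add: set_integrable_def integrable_restrict_space)
  moreover have "integrable (lebesgue_on S) (\<lambda>x. 1::real)"
    using assms(4) S by (simp add: integrable_restrict_space fmeasurableD2 fmeasurable_def)
  ultimately show "integrable (lebesgue_on S) (\<lambda>x. 1 + (norm (g x))\<^sup>2)" by simp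
  have "\<bar>r\<bar> \<le> 1 + r\<^sup>2" for r :: real
  proof -
    have "0 \<le> (\<bar>r\<bar> - 1)\<^sup>2" by simp
    then have "2 * \<bar>r\<bar> \<le> 1 + r\<^sup>2" by (simp add: power2_diff)
    then show ?thesis using zero_le_power2[of r] by linarith
  qed
  then show "AE x in lebesgue_on S. norm (g x) \<le> norm (1 + (norm (g x))\<^sup>2)" by simp
qed

text \<open>Box bumps are bounded by 1 and converge to the indicator of a box, so \<open>g\<close>
  has integral 0 over every box whose closed version lies in \<open>U\<close>; Lebesgue
  differentiation then gives the claim.\<close>

lemma fundamental_lemma:
  fixes g :: "real^'n \<Rightarrow> real"
  assumes U: "open U" and g: "square_integrable (lebesgue_on U) g"
    and zero: "\<And>\<phi>. \<phi> \<in> test_functions U \<Longrightarrow> (\<integral>x. g x * \<phi> x \<partial>lebesgue_on U) = 0"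
  shows "AE x in lebesgue_on U. g x = 0"
proof -
  have Us: "U \<in> sets lebesgue" using U by auto
  have box0: "(\<integral>x. g x \<partial>lebesgue_on (box a b)) = 0" if sub: "cbox a b \<subseteq> U" for a b
  proof -
    have gi: "integrable (lebesgue_on (cbox a b)) g"
      by (rule square_integrable_imp_integrable_on[OF g sub Us]) auto
    have gi': "integrable lebesgue (\<lambda>x. indicator (cbox a b) x * g x)"
      using gi by (simp add: integrable_restrict_space)
    define f where "f = (\<lambda>k x. indicator (cbox a b) x * g x * box_bump a b (inverse (Suc k)) x)"
    have fz: "(\<integral>x. f k x \<partial>lebesgue) = 0" for k
    proof -
      have "(\<integral>x. f k x \<partial>lebesgue) = (\<integral>x. indicator U x *\<^sub>R (g x * box_bump a b (inverse (Suc k)) x) \<partial>lebesgue)"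
        by (rule Bochner_Integration.integral_cong)
          (use sub box_bump(2)[of "inverse (real (Suc k))" _ a b] box_subset_cbox[of a b] in
            \<open>auto simp: f_def indicator_def subset_iff simp del: of_nat_Suc\<close>)
      also have "\<dots> = 0"
        using zero[OF box_bump_test_function[OF sub, of "inverse (real (Suc k))"]] Us
        by (simp add: integral_restrict_space)
      finally show ?thesis .
    qed
    have "(\<lambda>k. \<integral>x. f k x \<partial>lebesgue) \<longlonglongrightarrow> (\<integral>x. indicator (box a b) x *\<^sub>R g x \<partial>lebesgue)"
    proof (rule integral_dominated_convergence[where w = "\<lambda>x. norm (indicator (cbox a b) x * g x)"])
      have "box_bump a b (inverse (Suc k)) \<in> borel_measurable lebesgue" for k
        using box_bump(1)[of "inverse (real (Suc k))" 0 a b]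
        by (auto intro!: borel_measurable_continuous_onI measurable_completion)
      then show "f k \<in> borel_measurable lebesgue" for k
        unfolding f_def using borel_measurable_integrable[OF gi'] by measurable
      show "integrable lebesgue (\<lambda>x. norm (indicator (cbox a b) x * g x))" using gi' by (rule integrable_norm)
      have "integrable (lebesgue_on (box a b)) g"
        by (rule square_integrable_imp_integrable_on[OF g _ Us]) (use sub box_subset_cbox in auto)
      then show "(\<lambda>x. indicator (box a b) x *\<^sub>R g x) \<in> borel_measurable lebesgue"
        by (auto simp: integrable_restrict_space dest: borel_measurable_integrable)
      have "(\<lambda>k. f k x) \<longlonglongrightarrow> indicator (box a b) x *\<^sub>R g x" for x
      proof (cases "x \<in> box a b")
        case True
        then have "(\<lambda>k. f k x) \<longlonglongrightarrow> indicator (cbox a b) x * g x * 1"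
          unfolding f_def by (intro tendsto_mult tendsto_const box_bump_tendsto)
        then show ?thesis using True box_subset_cbox[of a b] by (auto simp: indicator_def)
      next
        case False
        then show ?thesis by (simp add: f_def box_bump(2))
      qed
      then show "AE x in lebesgue. (\<lambda>k. f k x) \<longlonglongrightarrow> indicator (box a b) x *\<^sub>R g x" by simp
      show "AE x in lebesgue. norm (f k x) \<le> norm (indicator (cbox a b) x * g x)" for k
        using box_bump(3)[of "inverse (real (Suc k))" a b]
        by (intro always_eventually allI) (auto simp: f_def abs_mult intro: mult_left_le)
    qed
    then have "(\<integral>x. indicator (box a b) x *\<^sub>R g x \<partial>lebesgue) = 0"
      unfolding fz using LIMSEQ_unique tendsto_const by metis
    then show ?thesis by (simp add: integral_restrict_space)
  qed
  have local: "negligible {x \<in> cbox p q. g x \<noteq> 0}" if pq: "cbox p q \<subseteq> U" for p q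
  proof -
    have gi: "integrable (lebesgue_on (cbox a b)) g" if "cbox a b \<subseteq> U" for a b
      by (rule square_integrable_imp_integrable_on[OF g that Us]) auto
    \<comment> \<open>The differentiation theorem wants integrability on every interval of the whole
      space. Truncation to \<open>cbox p q\<close> supplies it, as the intersection of two boxes is
      again a box.\<close>
    define h where "h = (\<lambda>x. if x \<in> cbox p q then g x else 0)"
    have eq: "h integrable_on cbox a b \<and> integral (cbox a b) h = 0" for a b
    proof -
      obtain c d where cd: "cbox a b \<inter> cbox p q = cbox c d"
        unfolding Int_interval by blast
      then have sub: "cbox c d \<subseteq> U" using pq by blast
      have "g integrable_on cbox c d"
        using integrable_on_lebesgue_on[OF gi[OF sub]] by simp
      moreover have "integral (cbox c d) g = 0"
      proof -
        have "integral (cbox c d) g = integral (box c d) g"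
          by (rule integral_spike_set) (auto intro!: negligible_subset[OF negligible_frontier_interval[of c d]] dest: subsetD[OF box_subset_cbox])
        also have "\<dots> = (\<integral>x. g x \<partial>lebesgue_on (box c d))"
          by (rule lebesgue_integral_eq_integral[symmetric])
            (use square_integrable_imp_integrable_on[OF g _ Us, of "box c d"] sub box_subset_cbox in auto)
        finally show ?thesis using box0[OF sub] by simp
      qed
      ultimately show ?thesis
        unfolding h_def integral_restrict_Int integrable_restrict_Int by (simp add: cd Int_commute)
    qed
    obtain N where N: "negligible N" "\<And>x e. \<lbrakk>x \<notin> N; 0 < e\<rbrakk> \<Longrightarrow> \<exists>d>0. \<forall>r. 0 < r \<and> r < d \<longrightarrow>
        norm (integral (cbox x (x + r *\<^sub>R One)) h /\<^sub>R r ^ DIM(real^'n) - h x) < e"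
      using integrable_ccontinuous_explicit[of h] eq by blast
    \<comment> \<open>All averages over shrinking cubes are 0, so taking |h x| as the tolerance
      would give |h x| < |h x|.\<close>
    have "h x = 0" if xN: "x \<notin> N" for x
    proof (rule ccontr)
      assume "h x \<noteq> 0"
      then obtain d where d: "d > 0" "\<forall>r. 0 < r \<and> r < d \<longrightarrow>
          norm (integral (cbox x (x + r *\<^sub>R One)) h /\<^sub>R r ^ DIM(real^'n) - h x) < norm (h x)"
        using N(2)[OF xN, of "norm (h x)"] by auto
      moreover have "0 < d / 2" "d / 2 < d" using d(1) by auto
      ultimately have "norm (- h x) < norm (h x)" using eq by (metis diff_0 scaleR_zero_right)
      then show False by simp
    qed
    then have "{x \<in> cbox p q. g x \<noteq> 0} \<subseteq> N" unfolding h_def by (smt (verit) mem_Collect_eq subsetI)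
    then show ?thesis using N(1) negligible_subset by blast
  qed
  obtain D where D: "countable D" "D \<subseteq> Pow U" "\<And>X. X \<in> D \<Longrightarrow> \<exists>a b. X = cbox a b" "\<Union>D = U"
    using open_countable_Union_open_cbox[OF U] by metis
  have "negligible {x \<in> X. g x \<noteq> 0}" if "X \<in> D" for X
    using D(2,3) that local by (metis Pow_iff subsetD)
  then have "negligible (\<Union>X\<in>D. {x \<in> X. g x \<noteq> 0})"
    using D(1) by (intro negligible_countable_Union) auto
  moreover have "(\<Union>X\<in>D. {x \<in> X. g x \<noteq> 0}) = {x \<in> U. g x \<noteq> 0}" using D(4) by auto
  ultimately have "negligible {x \<in> U. g x \<noteq> 0}" by simp
  then have "{x \<in> U. g x \<noteq> 0} \<in> null_sets (lebesgue_on U)"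
    using Us by (simp add: negligible_iff_null_sets null_sets_restrict_space)
  then show ?thesis by (rule AE_I') simp
qed

lemma test_function_C1:
  assumes "\<phi> \<in> test_functions U"
  shows "(\<phi> has_derivative (\<lambda>h. grad \<phi> x \<bullet> h)) (at x)" and "continuous_on UNIV (grad \<phi>)"
    and "continuous_on UNIV \<phi>"
proof -
  have *: "Ck (Suc 0) \<phi>" "Ck 0 \<phi>" using assms unfolding test_functions_def by blast+
  then show "(\<phi> has_derivative (\<lambda>h. grad \<phi> x \<bullet> h)) (at x)"
    by (intro has_derivative_grad) simp
  have "continuous_on UNIV (\<lambda>x. \<chi> i. grad \<phi> x $ i)"
    using * by (intro continuous_on_vec_lambda) simp
  then show "continuous_on UNIV (grad \<phi>)" by simp
  show "continuous_on UNIV \<phi>" using *(2) by simp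
qed

lemma bounded_test_function:
  assumes "\<phi> \<in> test_functions U"
  obtains M where "\<And>x. \<bar>\<phi> x\<bar> \<le> M" "M \<ge> 0"
proof -
  let ?S = "closure {x. \<phi> x \<noteq> 0}"
  have "compact (\<phi> ` ?S)"
    by (intro compact_continuous_image continuous_on_subset[OF test_function_C1(3)[OF assms]])
      (use assms in \<open>auto simp: test_functions_def\<close>)
  then obtain M where M: "\<And>x. x \<in> ?S \<Longrightarrow> \<bar>\<phi> x\<bar> \<le> M"
    using compact_imp_bounded[of "\<phi> ` ?S"] by (auto simp: bounded_iff)
  have "\<bar>\<phi> x\<bar> \<le> max M 0" for x
  proof (cases "\<phi> x = 0")
    case False
    then have "x \<in> ?S" by (intro subsetD[OF closure_subset]) simp
    from M[OF this] show ?thesis by linarith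
  qed simp
  then show ?thesis using that[of "max M 0"] by simp
qed

text \<open>Only the compact support of \<open>\<phi>\<close> matters; it has finite measure, so
  square integrability gives integrability there, and \<open>\<phi>\<close> is bounded.\<close>

lemma integrable_mult_test_function:
  fixes g :: "real^'n \<Rightarrow> real"
  assumes U: "open U" and g: "square_integrable (lebesgue_on U) g" and \<phi>: "\<phi> \<in> test_functions U"
  shows "integrable (lebesgue_on U) (\<lambda>x. g x * \<phi> x)"
proof -
  have Us: "U \<in> sets lebesgue" using U by auto
  let ?S = "closure {x. \<phi> x \<noteq> 0}"
  have S: "compact ?S" "?S \<subseteq> U" using \<phi> by (auto simp: test_functions_def)
  have Sm: "?S \<in> lmeasurable" using S(1) by (rule lmeasurable_compact)
  have "integrable (lebesgue_on ?S) g"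
    by (rule square_integrable_imp_integrable_on[OF g S(2) Us Sm])
  then have i: "integrable lebesgue (\<lambda>x. indicator ?S x *\<^sub>R g x)"
    by (subst (asm) integrable_restrict_space) (use Sm in auto)
  obtain M where M: "\<And>x. \<bar>\<phi> x\<bar> \<le> M" "M \<ge> 0" using bounded_test_function[OF \<phi>] by blast
  have "integrable lebesgue (\<lambda>x. (indicator ?S x *\<^sub>R g x) * \<phi> x)"
  proof (rule Bochner_Integration.integrable_bound)
    show "integrable lebesgue (\<lambda>x. M * (indicator ?S x *\<^sub>R g x))" using i by (rule integrable_mult_right)
    have "\<phi> \<in> borel_measurable lebesgue"
      using test_function_C1(3)[OF \<phi>] by (intro measurable_completion) (auto intro: borel_measurable_continuous_onI)
    then show "(\<lambda>x. (indicator ?S x *\<^sub>R g x) * \<phi> x) \<in> borel_measurable lebesgue"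
      using borel_measurable_integrable[OF i] by measurable
    have "\<bar>a * \<phi> x\<bar> \<le> \<bar>M * a\<bar>" for a x
      using mult_right_mono[OF M(1)[of x], of "\<bar>a\<bar>"] M(2) by (simp add: abs_mult mult.commute)
    then show "AE x in lebesgue. norm ((indicator ?S x *\<^sub>R g x) * \<phi> x) \<le> norm (M * (indicator ?S x *\<^sub>R g x))"
      by simp
  qed
  moreover have "(indicator ?S x *\<^sub>R g x) * \<phi> x = indicator U x *\<^sub>R (g x * \<phi> x)" for x
    using S(2) closure_subset[of "{x. \<phi> x \<noteq> 0}"] by (auto simp: indicator_def)
  ultimately have "integrable lebesgue (\<lambda>x. indicator U x *\<^sub>R (g x * \<phi> x))" by (simp only:)
  then show ?thesis using Us by (simp add: integrable_restrict_space)
qed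

lemma square_integrable_diff:
  fixes f g :: "'a \<Rightarrow> real"
  assumes "square_integrable M f" "square_integrable M g"
  shows "square_integrable M (\<lambda>x. f x - g x)"
  unfolding square_integrable_def
proof
  show m: "(\<lambda>x. f x - g x) \<in> borel_measurable M"
    using assms unfolding square_integrable_def by auto
  show "integrable M (\<lambda>x. (norm (f x - g x))\<^sup>2)"
  proof (rule Bochner_Integration.integrable_bound)
    show "integrable M (\<lambda>x. 2 * (norm (f x))\<^sup>2 + 2 * (norm (g x))\<^sup>2)"
      using assms unfolding square_integrable_def by auto
    show "(\<lambda>x. (norm (f x - g x))\<^sup>2) \<in> borel_measurable M" using m by measurable
    have "(a - b)\<^sup>2 \<le> 2 * a\<^sup>2 + 2 * b\<^sup>2" for a b :: real
      using zero_le_power2[of "a + b"] by (simp add: power2_sum power2_diff)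
    then show "AE x in M. norm ((norm (f x - g x))\<^sup>2) \<le> norm (2 * (norm (f x))\<^sup>2 + 2 * (norm (g x))\<^sup>2)"
      by simp
  qed
qed

text \<open>This makes the choice in \<open>weak_div\<close> harmless: any weak divergence that can
  be computed agrees with the chosen one almost everywhere.\<close>

lemma has_weak_div_unique:
  assumes U: "open U" and "has_weak_div U v g" "has_weak_div U v h"
  shows "AE x in lebesgue_on U. g x = h x"
proof -
  have gh: "square_integrable (lebesgue_on U) g" "square_integrable (lebesgue_on U) h"
    using assms by (auto simp: has_weak_div_def)
  have "AE x in lebesgue_on U. g x - h x = 0"
  proof (rule fundamental_lemma[OF U square_integrable_diff[OF gh]])
    fix \<phi> assume \<phi>: "\<phi> \<in> test_functions U"
    have "(\<integral>x. g x * \<phi> x \<partial>lebesgue_on U) = (\<integral>x. h x * \<phi> x \<partial>lebesgue_on U)"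
      using assms(2,3) \<phi> unfolding has_weak_div_def by fastforce
    then show "(\<integral>x. (g x - h x) * \<phi> x \<partial>lebesgue_on U) = 0"
      using gh[THEN integrable_mult_test_function[OF U _ \<phi>]] by (simp add: left_diff_distrib)
  qed
  then show ?thesis by simp
qed

section \<open>Full-dimensional polytopes and their facets\<close>

text \<open>The common ground of simplices and boxes: facets, outward normals and measures are
  developed for both from these two properties.\<close>

locale solid_polytope =
  fixes P :: "(real^'n) set"
  assumes polytope: "polytope P" and interior_nonempty: "interior P \<noteq> {}"
begin

lemma polyhedron: "polyhedron P" using polytope polytope_imp_polyhedron by blast
lemma compact: "compact P" using polytope polytope_imp_compact by blast
lemma convex: "convex P" using polytope polytope_imp_convex by blast
lemma closed: "closed P" using compact compact_imp_closed by blast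

lemma finite_facets: "finite {F. F facet_of P}"
  using finite_polytope_facets[OF polytope] .

lemma frontier_eq: "frontier P = \<Union>{F. F facet_of P}"
  using rel_frontier_of_polyhedron[OF polyhedron] rel_interior_nonempty_interior[OF interior_nonempty]
  by (simp add: rel_frontier_def frontier_def)

lemma aff_dim_eq: "aff_dim P = int CARD('n)"
  using aff_dim_nonempty_interior[OF interior_nonempty] by simp

text \<open>Chosen as one pair, so that \<open>nrm\<close> and \<open>off\<close> belong to the same
  supporting halfspace. The normal is outward because \<open>P\<close> lies where
  \<open>n \<bullet> x \<le> b\<close>.\<close>

definition facet_rep :: "(real^'n) set \<Rightarrow> (real^'n) \<times> real" where
  "facet_rep F = (SOME (n, b). norm n = 1 \<and> P \<subseteq> {x. n \<bullet> x \<le> b} \<and> F = P \<inter> {x. n \<bullet> x = b})"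

definition nrm :: "(real^'n) set \<Rightarrow> real^'n" where "nrm F = fst (facet_rep F)"
definition off :: "(real^'n) set \<Rightarrow> real" where "off F = snd (facet_rep F)"

lemma facet_rep:
  assumes "F facet_of P"
  shows "norm (nrm F) = 1" "\<And>x. x \<in> P \<Longrightarrow> nrm F \<bullet> x \<le> off F" "F = P \<inter> {x. nrm F \<bullet> x = off F}"
proof -
  obtain a b where ab: "a \<noteq> 0" "P \<subseteq> {x. a \<bullet> x \<le> b}" "F = P \<inter> {x. a \<bullet> x = b}"
    using facet_of_polyhedron[OF polyhedron assms] by metis
  have "case (a /\<^sub>R norm a, b / norm a) of (n, b) \<Rightarrow> norm n = 1 \<and> P \<subseteq> {x. n \<bullet> x \<le> b} \<and> F = P \<inter> {x. n \<bullet> x = b}"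
    using ab by (auto simp: field_simps)
  then have "case facet_rep F of (n, b) \<Rightarrow> norm n = 1 \<and> P \<subseteq> {x. n \<bullet> x \<le> b} \<and> F = P \<inter> {x. n \<bullet> x = b}"
    unfolding facet_rep_def by (rule someI[where P = "\<lambda>p. case p of (n, b) \<Rightarrow> norm n = 1 \<and> P \<subseteq> {x. n \<bullet> x \<le> b} \<and> F = P \<inter> {x. n \<bullet> x = b}"])
  then show "norm (nrm F) = 1" "\<And>x. x \<in> P \<Longrightarrow> nrm F \<bullet> x \<le> off F" "F = P \<inter> {x. nrm F \<bullet> x = off F}"
    by (auto simp: nrm_def off_def split: prod.splits)
qed

lemma facet_props:
  assumes "F facet_of P"
  shows "F face_of P" "F \<subseteq> P" "F \<noteq> {}" "convex F" "compact F" "rel_interior F \<noteq> {}"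
proof -
  show f: "F face_of P" and sub: "F \<subseteq> P" and ne: "F \<noteq> {}"
    using facet_of_imp_face_of[OF assms] facet_of_imp_subset[OF assms] assms unfolding facet_of_def by blast+
  show c: "convex F" using f face_of_imp_convex by blast
  show "compact F" using f compact convex face_of_imp_compact by blast
  show "rel_interior F \<noteq> {}" using c ne rel_interior_eq_empty by blast
qed

lemma nrm_nonzero: "F facet_of P \<Longrightarrow> nrm F \<noteq> 0"
  using facet_rep(1) by fastforce

lemma mem_facet_iff:
  assumes "F facet_of P" "x \<in> P"
  shows "x \<in> F \<longleftrightarrow> nrm F \<bullet> x = off F"
  by (subst facet_rep(3)[OF assms(1)]) (use assms(2) in simp)

lemma nrm_facet:
  assumes "F facet_of P" "x \<in> F"
  shows "nrm F \<bullet> x = off F"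
  using mem_facet_iff[OF assms(1)] facet_props(2)[OF assms(1)] assms(2) by blast

text \<open>One affine set contains the other and both have dimension d - 1.\<close>

lemma affine_hull_facet:
  assumes "F facet_of P"
  shows "affine hull F = {x. nrm F \<bullet> x = off F}"
proof -
  have "aff_dim F = aff_dim {x. nrm F \<bullet> x = off F}"
    using assms nrm_nonzero[OF assms] aff_dim_eq by (simp add: facet_of_def aff_dim_hyperplane)
  moreover have "F \<subseteq> {x. nrm F \<bullet> x = off F}" using nrm_facet[OF assms] by auto
  ultimately have "affine hull F = affine hull {x. nrm F \<bullet> x = off F}"
    by (subst (asm) aff_dim_eq_full_gen) auto
  then show ?thesis by (simp add: affine_hyperplane hull_same)
qed

lemma facet_eq_if_subset:
  assumes "F facet_of P" "F' facet_of P" "F \<subseteq> F'"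
  shows "F = F'"
proof -
  have "aff_dim F = aff_dim F'" using assms by (simp add: facet_of_def)
  then have "affine hull F = affine hull F'" using aff_dim_eq_full_gen[OF assms(3)] by simp
  then show ?thesis
    using facet_rep(3)[OF assms(1)] facet_rep(3)[OF assms(2)] affine_hull_facet assms by metis
qed

lemma interior_strict: "F facet_of P \<Longrightarrow> x \<in> interior P \<Longrightarrow> nrm F \<bullet> x < off F"
  using interior_mono[of P "{x. nrm F \<bullet> x \<le> off F}"] facet_rep(2)[of F] nrm_nonzero[of F]
  by (auto simp: interior_halfspace_le)

text \<open>The segment from an interior point to a point outside \<open>P\<close> crosses the
  frontier in some facet. That facet's inequality is strict at the interior point, so if it also
  held at the far end it would be strict at the crossing.\<close>

lemma mem_iff: "x \<in> P \<longleftrightarrow> (\<forall>F. F facet_of P \<longrightarrow> nrm F \<bullet> x \<le> off F)"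
proof
  assume x: "\<forall>F. F facet_of P \<longrightarrow> nrm F \<bullet> x \<le> off F"
  show "x \<in> P"
  proof (rule ccontr)
    assume nx: "x \<notin> P"
    obtain z where z: "z \<in> interior P" using interior_nonempty by blast
    then have "z \<in> P" using interior_subset by blast
    then have "closed_segment z x \<inter> P \<noteq> {}" "closed_segment z x - P \<noteq> {}" using nx by auto
    then have "closed_segment z x \<inter> frontier P \<noteq> {}"
      by (intro connected_Int_frontier) auto
    then obtain y F where y: "y \<in> closed_segment z x" "F facet_of P" "y \<in> F" by (auto simp: frontier_eq)
    obtain u where u: "0 \<le> u" "u \<le> 1" "y = (1 - u) *\<^sub>R z + u *\<^sub>R x" using y(1) by (auto simp: in_segment)
    have "y \<noteq> x" using y facet_props(2) nx by blast
    then have "u \<noteq> 1" using u by auto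
    then have "u < 1" using u by auto
    moreover have "nrm F \<bullet> z < off F" using interior_strict[OF y(2) z] .
    ultimately have "(1 - u) * (nrm F \<bullet> z) < (1 - u) * off F" by simp
    moreover have "u * (nrm F \<bullet> x) \<le> u * off F" using x y u by (simp add: mult_left_mono)
    moreover have "(1 - u) * off F + u * off F = off F" by (simp add: algebra_simps)
    moreover have "nrm F \<bullet> y = (1 - u) * (nrm F \<bullet> z) + u * (nrm F \<bullet> x)" unfolding u(3) by (simp add: inner_add_right)
    ultimately have "nrm F \<bullet> y < off F" by linarith
    then show False using nrm_facet[OF y(2,3)] by simp
  qed
qed (use facet_rep(2) in blast)

text \<open>A face that meets the relative interior of \<open>F\<close> contains all of
  \<open>F\<close>, and a facet cannot contain a different one.\<close>

lemma rel_interior_strict: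
  assumes "F facet_of P" "F' facet_of P" "F \<noteq> F'" "x \<in> rel_interior F"
  shows "nrm F' \<bullet> x < off F'"
proof (rule ccontr)
  have xP: "x \<in> P" using assms facet_props(2) rel_interior_subset by blast
  assume "\<not> nrm F' \<bullet> x < off F'"
  then have "x \<in> F'" using mem_facet_iff[OF assms(2) xP] facet_rep(2)[OF assms(2) xP] by auto
  then have "F \<subseteq> F'"
    using subset_of_face_of[OF facet_props(1)[OF assms(2)] facet_props(2)[OF assms(1)]] assms(4) by blast
  then show False using facet_eq_if_subset assms by blast
qed

section \<open>Normals, prisms and the flat measure of a facet\<close>

lemma unit_normal_facet:
  assumes F: "F facet_of P"
  obtains \<sigma> where "\<sigma> = 1 \<or> \<sigma> = - 1" "unit_normal F = \<sigma> *\<^sub>R nrm F"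
proof -
  define m where "m = unit_normal F"
  let ?n = "nrm F"
  have n1: "?n \<bullet> ?n = 1" using facet_rep(1)[OF F] by (simp add: norm_eq_1)
  have "\<exists>n. norm n = 1 \<and> (\<forall>x\<in>F. \<forall>y\<in>F. n \<bullet> (x - y) = 0)"
    using facet_rep(1)[OF F] nrm_facet[OF F] by (intro exI[of _ ?n]) (auto simp: inner_diff_right)
  then have m: "norm m = 1 \<and> (\<forall>x\<in>F. \<forall>y\<in>F. m \<bullet> (x - y) = 0)"
    unfolding m_def unit_normal_def by (rule someI_ex)
  obtain y where y: "y \<in> F" using facet_props(3)[OF F] by blast
  have "affine hull F \<subseteq> {x. m \<bullet> x = m \<bullet> y}"
  proof (intro hull_minimal affine_hyperplane subsetI CollectI)
    fix x assume "x \<in> F"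
    then have "m \<bullet> (x - y) = 0" using m y by blast
    then show "m \<bullet> x = m \<bullet> y" by (simp add: inner_diff_right)
  qed
  \<comment> \<open>The part of \<open>m\<close> tangential to the hyperplane. Moving from
    \<open>y\<close> by \<open>d\<close> stays in the affine hull, on which \<open>m\<close> is
    constant; so \<open>m\<close> is orthogonal to \<open>d\<close>, and \<open>d\<close>
    vanishes.\<close>
  moreover define d where "d = m - (m \<bullet> ?n) *\<^sub>R ?n"
  have nd: "?n \<bullet> d = 0" using n1 by (simp add: d_def inner_diff_right inner_commute)
  then have "y + d \<in> affine hull F"
    using nrm_facet[OF F y] by (simp add: affine_hull_facet[OF F] inner_add_right)
  ultimately have md: "m \<bullet> d = 0" by (auto simp: inner_add_right)
  have "d \<bullet> d = m \<bullet> d - (m \<bullet> ?n) * (?n \<bullet> d)" unfolding d_def by (simp add: inner_diff_left)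
  then have "d = 0" using md nd by simp
  then have mn: "m = (m \<bullet> ?n) *\<^sub>R ?n" by (simp add: d_def)
  then have "\<bar>m \<bullet> ?n\<bar> = 1" using m facet_rep(1)[OF F] by (metis mult.right_neutral norm_scaleR)
  then have "m \<bullet> ?n = 1 \<or> m \<bullet> ?n = - 1" by linarith
  then show ?thesis using that mn m_def by blast
qed

text \<open>A signed coordinate along \<open>unit_normal F\<close> that vanishes on the hyperplane
  of \<open>F\<close>. The factor \<open>unit_normal F \<bullet> nrm F\<close> is \<plusminus>1 and
  corrects \<open>off F\<close>, which refers to the outward normal.\<close>

definition height :: "(real^'n) set \<Rightarrow> real^'n \<Rightarrow> real" where
  "height F z = unit_normal F \<bullet> z - (unit_normal F \<bullet> nrm F) * off F"

definition proj :: "(real^'n) set \<Rightarrow> real^'n \<Rightarrow> real^'n" where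
  "proj F z = z - height F z *\<^sub>R unit_normal F"

definition prism :: "(real^'n) set \<Rightarrow> (real^'n) set" where
  "prism F = {x + t *\<^sub>R unit_normal F | x t. x \<in> F \<and> 0 \<le> t \<and> t \<le> 1}"

lemma norm_unit_normal:
  assumes "F facet_of P"
  shows "unit_normal F \<bullet> unit_normal F = 1"
proof -
  obtain \<sigma> where "\<sigma> = 1 \<or> \<sigma> = - 1" "unit_normal F = \<sigma> *\<^sub>R nrm F" using unit_normal_facet[OF assms] .
  then show ?thesis using facet_rep(1)[OF assms] by (auto simp: norm_eq_1)
qed

lemma height_affine_hull:
  assumes "F facet_of P"
  shows "z \<in> affine hull F \<longleftrightarrow> height F z = 0"
proof -
  obtain \<sigma> where s: "\<sigma> = 1 \<or> \<sigma> = - 1" "unit_normal F = \<sigma> *\<^sub>R nrm F" using unit_normal_facet[OF assms] .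
  have "nrm F \<bullet> nrm F = 1" using facet_rep(1)[OF assms] by (simp add: norm_eq_1)
  then show ?thesis using s by (auto simp: height_def affine_hull_facet[OF assms])
qed

lemma height_add: "F facet_of P \<Longrightarrow> height F (z + t *\<^sub>R unit_normal F) = height F z + t"
  using norm_unit_normal[of F] by (simp add: height_def inner_add_right)

lemma proj_add: "F facet_of P \<Longrightarrow> proj F (z + t *\<^sub>R unit_normal F) = proj F z"
  by (simp add: proj_def height_add algebra_simps)

lemma height_proj: "F facet_of P \<Longrightarrow> height F (proj F z) = 0"
  using height_add[of F z "- height F z"] by (simp add: proj_def)

lemma proj_height: "z = proj F z + height F z *\<^sub>R unit_normal F"
  by (simp add: proj_def)

lemma proj_in_facet: "F facet_of P \<Longrightarrow> x \<in> F \<Longrightarrow> proj F x = x"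
  using height_affine_hull[of F x] hull_inc[of x F affine] by (simp add: proj_def)

lemma proj_hyperplane: "F facet_of P \<Longrightarrow> nrm F \<bullet> proj F z = off F"
  using height_proj[of F z] height_affine_hull[of F "proj F z"] affine_hull_facet[of F] by simp

lemma mem_prism_iff:
  assumes "F facet_of P"
  shows "z \<in> prism F \<longleftrightarrow> proj F z \<in> F \<and> 0 \<le> height F z \<and> height F z \<le> 1"
proof
  assume "z \<in> prism F"
  then obtain x t where xt: "z = x + t *\<^sub>R unit_normal F" "x \<in> F" "0 \<le> t" "t \<le> 1" by (auto simp: prism_def)
  have "height F x = 0" using hull_inc[OF xt(2)] height_affine_hull[OF assms] by blast
  then show "proj F z \<in> F \<and> 0 \<le> height F z \<and> height F z \<le> 1"
    using xt proj_in_facet[OF assms xt(2)] by (simp add: height_add proj_add assms)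
next
  assume "proj F z \<in> F \<and> 0 \<le> height F z \<and> height F z \<le> 1"
  then show "z \<in> prism F" unfolding prism_def using proj_height[of z F] by blast
qed

lemma closest_point_proj:
  assumes "F facet_of P"
  shows "closest_point (affine hull F) z = proj F z"
proof (rule closest_point_unique[symmetric])
  show "proj F z \<in> affine hull F" using height_proj height_affine_hull assms by blast
  show "\<forall>y\<in>affine hull F. dist z (proj F z) \<le> dist z y"
  proof
    fix y assume y: "y \<in> affine hull F"
    have u: "norm (unit_normal F) = 1" using norm_unit_normal[OF assms] by (simp add: norm_eq_1)
    have "height F z = unit_normal F \<bullet> (z - y)"
      using y height_affine_hull[OF assms, of y] by (simp add: height_def inner_diff_right)
    then have "\<bar>height F z\<bar> \<le> norm (z - y)"
      using Cauchy_Schwarz_ineq2[of "unit_normal F" "z - y"] u by simp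
    then show "dist z (proj F z) \<le> dist z y" using u by (simp add: proj_def dist_norm)
  qed
qed (auto simp: affine_imp_convex)

lemma prism_sums: "prism F = {x + y | x y. x \<in> F \<and> y \<in> closed_segment 0 (unit_normal F)}"
  unfolding prism_def closed_segment_def by force

lemma compact_prism: "F facet_of P \<Longrightarrow> compact (prism F)"
  unfolding prism_sums using facet_props(5)[of F] by (intro compact_sums) auto

lemma convex_prism:
  assumes "F facet_of P"
  shows "convex (prism F)"
proof -
  have "prism F = (\<Union>x\<in>F. \<Union>y\<in>closed_segment 0 (unit_normal F). {x + y})"
    unfolding prism_sums by blast
  then show ?thesis
    using convex_sums[OF facet_props(4)[OF assms] convex_closed_segment] by simp
qed

text \<open>A ball about \<open>z\<close> inside the prism, cut at the height of \<open>z\<close>,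
  projects to a relatively open disc about \<open>proj F z\<close> that lies in
  \<open>F\<close>.\<close>

lemma interior_prism:
  assumes F: "F facet_of P" and z: "z \<in> interior (prism F)"
  shows "proj F z \<in> rel_interior F"
proof -
  obtain e where e: "e > 0" "ball z e \<subseteq> prism F" using z by (auto simp: mem_interior)
  have zp: "z \<in> prism F" using z interior_subset by blast
  have "y \<in> F" if y: "y \<in> ball (proj F z) e" "y \<in> affine hull F" for y
  proof -
    have "y + height F z *\<^sub>R unit_normal F \<in> ball z e"
      using y(1) by (simp add: proj_def dist_norm algebra_simps)
    then have "proj F (y + height F z *\<^sub>R unit_normal F) \<in> F" using e mem_prism_iff[OF F] by blast
    moreover have "proj F y = y" using y(2) height_affine_hull[OF F] by (simp add: proj_def)
    ultimately show ?thesis by (simp add: proj_add F)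
  qed
  then show ?thesis
    unfolding mem_rel_interior_ball using e(1) zp mem_prism_iff[OF F, of z] by blast
qed

lemma continuous_height: "continuous_on S (height F)"
proof -
  have "height F = (\<lambda>z. unit_normal F \<bullet> z - (unit_normal F \<bullet> nrm F) * off F)"
    by (simp add: fun_eq_iff height_def)
  then show ?thesis by (simp only:) (intro continuous_on_diff continuous_on_inner continuous_on_const continuous_on_id)
qed

lemma continuous_proj: "continuous_on S (proj F)"
proof -
  have "proj F = (\<lambda>z. z - height F z *\<^sub>R unit_normal F)"
    by (simp add: fun_eq_iff proj_def)
  then show ?thesis
    by (simp only:) (intro continuous_on_diff continuous_on_scaleR continuous_height continuous_on_const continuous_on_id)
qed

lemma measurable_proj:
  assumes F: "F facet_of P"
  shows "proj F \<in> restrict_space lborel (prism F) \<rightarrow>\<^sub>M restrict_space borel F"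
proof (rule measurable_restrict_space2)
  show "proj F \<in> space (restrict_space lborel (prism F)) \<rightarrow> F"
    using mem_prism_iff[OF F] by (auto simp: space_restrict_space)
  show "proj F \<in> restrict_space lborel (prism F) \<rightarrow>\<^sub>M borel"
    by (intro measurable_restrict_space1) (simp add: borel_measurable_continuous_onI continuous_proj)
qed

lemma flat_measure_eq:
  assumes F: "F facet_of P"
  shows "flat_measure F = distr (restrict_space lborel (prism F)) (restrict_space borel F) (proj F)"
  unfolding flat_measure_def prism_def[symmetric] closest_point_proj[OF F, abs_def] ..

lemma integral_flat_measure:
  fixes h :: "real^'n \<Rightarrow> real"
  assumes F: "F facet_of P" and h: "h \<in> borel_measurable (restrict_space borel F)"
  shows "(\<integral>x. h x \<partial>flat_measure F) = (\<integral>z. h (proj F z) \<partial>lebesgue_on (prism F))"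
proof -
  have ps: "prism F \<in> sets borel" using compact_prism[OF F] by (simp add: borel_compact)
  note m = measurable_proj[OF F]
  note flat_measure_eq[OF F]
  then have "(\<integral>x. h x \<partial>flat_measure F) = (\<integral>z. h (proj F z) \<partial>restrict_space lborel (prism F))"
    using integral_distr[OF m h] by simp
  also have "\<dots> = (\<integral>z. indicator (prism F) z *\<^sub>R h (proj F z) \<partial>lborel)"
    using ps by (intro integral_restrict_space) simp
  also have "\<dots> = (\<integral>z. indicator (prism F) z *\<^sub>R h (proj F z) \<partial>lebesgue)"
  proof (rule integral_completion[symmetric])
    have "(\<lambda>z. h (proj F z)) \<in> borel_measurable (restrict_space lborel (prism F))"
      using m h by (rule measurable_compose)
    then show "(\<lambda>z. indicator (prism F) z *\<^sub>R h (proj F z)) \<in> borel_measurable lborel"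
      using ps by (subst (asm) borel_measurable_restrict_space_iff) auto
  qed
  also have "\<dots> = (\<integral>z. h (proj F z) \<partial>lebesgue_on (prism F))"
    using ps by (intro integral_restrict_space[symmetric]) auto
  finally show ?thesis .
qed

text \<open>The prism is convex, hence its frontier is a Lebesgue null set, and by
  \<open>interior_prism\<close> the points of the prism above the relative boundary of
  \<open>F\<close> lie in it.\<close>

lemma AE_flat_measure_rel_interior:
  assumes F: "F facet_of P"
  shows "AE x in flat_measure F. x \<in> rel_interior F"
proof -
  have ps: "prism F \<in> sets borel" using compact_prism[OF F] by (simp add: borel_compact)
  note m = measurable_proj[OF F]
  note fm = flat_measure_eq[OF F]
  have "negligible (frontier (prism F))" using convex_prism[OF F] by (rule negligible_convex_frontier)
  then have "frontier (prism F) \<in> null_sets lborel"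
    by (simp add: negligible_iff_null_sets null_sets_completion_iff)
  then have "AE z in lborel. z \<notin> frontier (prism F)" by (rule AE_not_in)
  then have "AE z in restrict_space lborel (prism F). proj F z \<in> rel_interior F"
    using ps by (subst AE_restrict_space_iff)
      (auto elim!: eventually_mono intro: interior_prism[OF F] simp: frontier_def subsetD[OF closure_subset])
  moreover have "rel_interior F \<in> sets borel"
    using openin_rel_interior[of F] by (auto simp: openin_open borel_open borel_closed)
  ultimately show ?thesis
    unfolding fm using facet_props(5)[OF F] rel_interior_subset[of F]
    by (subst AE_distr_iff[OF m]) (auto simp: space_restrict_space sets_restrict_space borel_compact intro!: image_eqI[of _ _ "rel_interior F"])
qed

end

section \<open>The divergence theorem on a polytope\<close>

text \<open>A \<open>C\<^sup>1\<close> step from 0 to 1, with a tent of integral one as its derivative.\<close>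

definition ramp :: "real \<Rightarrow> real" where
  "ramp s = 2 * (max 0 s)\<^sup>2 - 4 * (max 0 (s - 1/2))\<^sup>2 + 2 * (max 0 (s - 1))\<^sup>2"

definition hat :: "real \<Rightarrow> real" where
  "hat s = 4 * max 0 s - 8 * max 0 (s - 1/2) + 4 * max 0 (s - 1)"

text \<open>A squared positive part is \<open>C1\<close>, its one-sided derivatives at the kink both
  being 0. \<open>ramp\<close> combines three of them so that its derivative \<open>hat\<close>
  climbs to 2 at 1/2 and falls back to 0 at 1.\<close>

lemma sq_pos_deriv: "((\<lambda>s. (max 0 (s - a))\<^sup>2) has_real_derivative 2 * max 0 (s - a)) (at (s::real))"
proof -
  consider "s > a" | "s < a" | "s = a" by linarith
  then show ?thesis
  proof cases
    case 1
    have ev: "\<forall>\<^sub>F x in nhds s. (max 0 (x - a))\<^sup>2 = (x - a)\<^sup>2"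
      using eventually_nhds_in_open[of "{a<..}" s] 1 by (auto elim!: eventually_mono)
    show ?thesis
      by (subst DERIV_cong_ev[OF refl ev refl]) (use 1 in \<open>auto intro!: derivative_eq_intros\<close>)
  next
    case 2
    have ev: "\<forall>\<^sub>F x in nhds s. (max 0 (x - a))\<^sup>2 = 0"
      using eventually_nhds_in_open[of "{..<a}" s] 2 by (auto elim!: eventually_mono)
    show ?thesis
      by (subst DERIV_cong_ev[OF refl ev refl]) (use 2 in \<open>simp add: max_def\<close>)
  next
    case 3
    have "((\<lambda>h. (max 0 h)\<^sup>2 / h) \<longlongrightarrow> 0) (at (0::real))"
    proof (rule Lim_null_comparison)
      show "\<forall>\<^sub>F h in at 0. norm ((max 0 h)\<^sup>2 / h) \<le> \<bar>h\<bar>"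
        by (intro always_eventually allI) (auto simp: max_def power2_eq_square)
      show "((\<lambda>h::real. \<bar>h\<bar>) \<longlongrightarrow> 0) (at 0)" by (intro tendsto_eq_intros) auto
    qed
    then show ?thesis using 3 by (simp add: DERIV_def)
  qed
qed

lemma ramp_deriv: "(ramp has_real_derivative hat s) (at s)"
proof -
  note d = sq_pos_deriv[of 0, simplified] sq_pos_deriv
  show ?thesis unfolding ramp_def[abs_def] hat_def
    by (rule derivative_eq_intros d refl)+ (simp add: algebra_simps)
qed

lemma continuous_hat: "continuous_on S hat"
  unfolding hat_def[abs_def] by (intro continuous_intros)

lemma continuous_ramp: "continuous_on S ramp"
  unfolding ramp_def[abs_def] by (intro continuous_intros)

lemma hat_eq_0: "s \<le> 0 \<Longrightarrow> hat s = 0" "s \<ge> 1 \<Longrightarrow> hat s = 0"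
  by (simp_all add: hat_def max_def)

lemma hat_bounds: "0 \<le> hat s" "hat s \<le> 2"
  by (simp_all add: hat_def max_def)

lemma hat_pos: "0 < s \<Longrightarrow> s < 1 \<Longrightarrow> 0 < hat s"
  by (simp add: hat_def max_def)

lemma ramp_low: "s \<le> 0 \<Longrightarrow> ramp s = 0"
  by (simp add: ramp_def max_def)

lemma ramp_high: "s \<ge> 1 \<Longrightarrow> ramp s = 1"
  by (simp add: ramp_def max_def power2_eq_square algebra_simps)

lemma ramp_strict_mono: "0 \<le> s \<Longrightarrow> s < t \<Longrightarrow> t \<le> 1 \<Longrightarrow> ramp s < ramp t"
  by (rule DERIV_pos_imp_increasing_open[of s t ramp])
    (use ramp_deriv hat_pos in \<open>force intro: continuous_ramp\<close>)+

lemma ramp_bounds: "0 \<le> ramp s" "ramp s \<le> 1"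
  using ramp_strict_mono[of 0 s] ramp_strict_mono[of s 1] ramp_low[of s] ramp_low[of 0] ramp_high[of s] ramp_high[of 1]
  by linarith+

lemma ramp_surj:
  assumes "0 \<le> y" "y \<le> 1"
  obtains s where "0 \<le> s" "s \<le> 1" "ramp s = y"
  using IVT'[of ramp 0 y 1] assms ramp_low[of 0] ramp_high[of 1] continuous_ramp by auto

lemma ramp_inj: "0 \<le> s \<Longrightarrow> s \<le> 1 \<Longrightarrow> 0 \<le> t \<Longrightarrow> t \<le> 1 \<Longrightarrow> ramp s = ramp t \<Longrightarrow> s = t"
  using ramp_strict_mono[of s t] ramp_strict_mono[of t s] by linarith

lemma matrix_add_outer: "matrix (\<lambda>h. h + (b \<bullet> h) *\<^sub>R a) = mat 1 + outer a b"
proof -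
  have "(\<lambda>h. h + (b \<bullet> h) *\<^sub>R a) = (*v) (mat 1 + outer a b)"
    by (simp add: fun_eq_iff matrix_vector_mult_add_rdistrib outer_mult_vec)
  then show ?thesis by simp
qed

context solid_polytope
begin

lemma height_has_derivative: "(height F has_derivative (\<lambda>h. unit_normal F \<bullet> h)) (at x within S)"
  unfolding height_def[abs_def] by (auto intro!: derivative_eq_intros)

text \<open>Moving the points of the prism along the normal redistributes the mass of a profile of
  integral one.\<close>

lemma integral_prism_hat:
  assumes F: "F facet_of P"
  shows "(\<integral>z. hat (height F z) * g (proj F z) \<partial>lebesgue_on (prism F)) = (\<integral>z. g (proj F z) \<partial>lebesgue_on (prism F))"
proof -
  let ?m = "unit_normal F"
  \<comment> \<open>This keeps the projection and replaces the height by its \<open>ramp\<close>. By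
    \<open>det_add_outer\<close> the Jacobian determinant is \<open>1 + (hat - 1) = hat\<close>, so
    the change of variables absorbs the profile.\<close>
  define \<Theta> where "\<Theta> = (\<lambda>z. z + (ramp (height F z) - height F z) *\<^sub>R ?m)"
  define \<Theta>' where "\<Theta>' = (\<lambda>z h. h + (?m \<bullet> h) *\<^sub>R ((hat (height F z) - 1) *\<^sub>R ?m))"
  have mm: "?m \<bullet> ?m = 1" using norm_unit_normal[OF F] .
  have hT: "height F (\<Theta> z) = ramp (height F z)" and pT: "proj F (\<Theta> z) = proj F z" for z
    by (simp_all add: \<Theta>_def height_add[OF F] proj_add[OF F])
  have der: "(\<Theta> has_derivative \<Theta>' z) (at z within S)" for z S
  proof -
    have "((\<lambda>z. ramp (height F z)) has_derivative (\<lambda>h. hat (height F z) * (?m \<bullet> h))) (at z within S)"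
      using has_derivative_compose[OF height_has_derivative ramp_deriv[unfolded has_field_derivative_def]] by simp
    then show ?thesis unfolding \<Theta>_def \<Theta>'_def
      by (auto intro!: derivative_eq_intros height_has_derivative simp: algebra_simps)
  qed
  have det: "det (matrix (\<Theta>' z)) = hat (height F z)" for z
    unfolding \<Theta>'_def matrix_add_outer det_add_outer by (simp add: mm)
  have inj: "inj_on \<Theta> (prism F)"
  proof (rule inj_onI)
    fix z w assume zw: "z \<in> prism F" "w \<in> prism F" "\<Theta> z = \<Theta> w"
    then have "ramp (height F z) = ramp (height F w)" "proj F z = proj F w" using hT pT by metis+
    moreover from this have "height F z = height F w"
      using zw ramp_inj mem_prism_iff[OF F] by blast
    ultimately show "z = w" using proj_height by metis
  qed
  have img: "\<Theta> ` prism F = prism F"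
  proof (intro equalityI subsetI)
    fix w assume w: "w \<in> prism F"
    obtain s where s: "0 \<le> s" "s \<le> 1" "ramp s = height F w"
      using ramp_surj[of "height F w"] w mem_prism_iff[OF F] by metis
    define z where "z = w + (s - height F w) *\<^sub>R ?m"
    have hz: "height F z = s" "proj F z = proj F w" by (simp_all add: z_def height_add[OF F] proj_add[OF F])
    then have "z \<in> prism F" using w s by (simp add: mem_prism_iff[OF F])
    moreover have "\<Theta> z = w"
      using hz s by (metis hT pT proj_height)
    ultimately show "w \<in> \<Theta> ` prism F" by blast
  qed (use mem_prism_iff[OF F] hT pT ramp_bounds in auto)
  have "(\<integral>z. \<bar>det (matrix (\<Theta>' z))\<bar> * g (proj F (\<Theta> z)) \<partial>lebesgue_on (prism F)) =
      (\<integral>z. g (proj F z) \<partial>lebesgue_on (\<Theta> ` prism F))"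
    by (rule change_of_variables(2)[where f = "\<lambda>z. g (proj F z)"])
      (use compact_prism[OF F] lmeasurable_compact inj der in auto)
  then show ?thesis by (simp add: det pT img hat_bounds(1))
qed

text \<open>The derivative of the compactly supported product of \<open>f\<close> with a cut-off
  integrates to zero. Where it falls on \<open>f\<close>, the limit is the volume integral; where it
  falls on the cut-off, it lives in a thin layer along a facet, and rescaling that layer to the
  prism produces the flat measure.\<close>

lemma divergence_theorem_directional:
  fixes f :: "real^'n \<Rightarrow> real"
  assumes der: "\<And>x. (f has_derivative f' x) (at x)" and cont: "continuous_on UNIV (\<lambda>x. f' x e)"
  shows "(\<integral>x. f' x e \<partial>lebesgue_on P) = (\<Sum>F | F facet_of P. (nrm F \<bullet> e) * (\<integral>x. f x \<partial>flat_measure F))"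
proof -
  define \<F> where "\<F> = {F. F facet_of P}"
  have fin: "finite \<F>" using finite_facets by (simp add: \<F>_def)
  have fcont: "continuous_on UNIV f"
    using der has_derivative_continuous continuous_at_imp_continuous_on by blast
  define \<epsilon> where "\<epsilon> = (\<lambda>k::nat. inverse (real (Suc k)))"
  have e: "0 < \<epsilon> k" "\<epsilon> k \<le> 1" for k by (auto simp: \<epsilon>_def field_simps)
  have e0: "\<epsilon> \<longlonglongrightarrow> 0" unfolding \<epsilon>_def by (rule LIMSEQ_inverse_real_of_nat)
  \<comment> \<open>As \<open>nrm F\<close> is a unit vector, this is the signed distance to the
    hyperplane of \<open>F\<close>, positive on the side of \<open>P\<close>, in units of the layer
    width.\<close>
  define s where "s = (\<lambda>k F x. (off F - nrm F \<bullet> x) / \<epsilon> k)"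
  define cu where "cu = (\<lambda>k x. \<Prod>F\<in>\<F>. ramp (s k F x))"
  \<comment> \<open>The term of the product rule in which the cut-off factor of \<open>F\<close> is
    differentiated, without its coefficient \<open>- (nrm F \<bullet> e)\<close>.\<close>
  define G where "G = (\<lambda>k F x. (1 / \<epsilon> k) * hat (s k F x) * (\<Prod>F'\<in>\<F> - {F}. ramp (s k F' x)) * f x)"
  obtain B where "\<forall>x\<in>P. norm x \<le> B"
    using compact_imp_bounded[OF compact] unfolding bounded_iff by blast
  then have R: "P \<subseteq> cball 0 (max B 0)" by fastforce
  define R where "R = max B 0"
  then have R: "P \<subseteq> cball 0 R" "R \<ge> 0" using R by auto
  have prod_bd: "0 \<le> (\<Prod>F\<in>A. ramp (g F))" "(\<Prod>F\<in>A. ramp (g F)) \<le> 1" for g and A :: "(real^'n) set set"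
    by (auto intro: prod_nonneg prod_le_1 simp: ramp_bounds)
  have prod0: "(\<Prod>F\<in>A. ramp (s k F x)) = 0" if "F \<in> A" "finite A" "nrm F \<bullet> x \<ge> off F" for A F k x
    using that e(1)[of k] by (auto simp: prod_zero_iff s_def divide_nonpos_pos intro!: bexI[of _ F] ramp_low)
  have cu0: "cu k x = 0" if "x \<notin> P" for k x
    using that mem_iff[of x] prod0[OF _ fin] by (force simp: cu_def \<F>_def)
  have scont: "continuous_on S (s k F)" for S k F
    unfolding s_def using e(1)[of k] by (intro continuous_intros) auto
  have ramps: "continuous_on S (\<lambda>x. ramp (s k F x))" "continuous_on S (\<lambda>x. hat (s k F x))" for S k F
    using continuous_on_compose2[OF continuous_ramp[of UNIV] scont] continuous_on_compose2[OF continuous_hat[of UNIV] scont]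
    by auto
  have cucont: "continuous_on S (cu k)" for S k
    unfolding cu_def by (intro continuous_on_prod ramps)
  have Gcont: "continuous_on UNIV (G k F)" for k F
    unfolding G_def by (intro continuous_intros continuous_on_prod ramps fcont)
  define g' where "g' = (\<lambda>k x h. cu k x * f' x h + (\<Sum>F\<in>\<F>. (hat (s k F x) * (- (nrm F \<bullet> h) / \<epsilon> k)) * (\<Prod>F'\<in>\<F> - {F}. ramp (s k F' x))) * f x)"
  have gder: "((\<lambda>x. cu k x * f x) has_derivative g' k x) (at x)" for k x
  proof -
    have "(s k F has_derivative (\<lambda>h. - (nrm F \<bullet> h) / \<epsilon> k)) (at x)" for F
      unfolding s_def using e(1)[of k] by (auto intro!: derivative_eq_intros)
    from has_derivative_compose[OF this ramp_deriv[unfolded has_field_derivative_def]]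
    have "((\<lambda>x. ramp (s k F x)) has_derivative (\<lambda>h. hat (s k F x) * (- (nrm F \<bullet> h) / \<epsilon> k))) (at x)" for F .
    from has_derivative_prod[OF this]
    have "(cu k has_derivative (\<lambda>h. \<Sum>F\<in>\<F>. (hat (s k F x) * (- (nrm F \<bullet> h) / \<epsilon> k)) * (\<Prod>F'\<in>\<F> - {F}. ramp (s k F' x)))) (at x)"
      unfolding cu_def .
    from has_derivative_mult[OF this der] show ?thesis unfolding g'_def .
  qed
  have g'e: "g' k x e = cu k x * f' x e - (\<Sum>F\<in>\<F>. (nrm F \<bullet> e) * G k F x)" for k x
    unfolding g'_def G_def sum_distrib_right diff_conv_add_uminus sum_negf[symmetric]
    by (intro arg_cong2[where f = "(+)"] sum.cong) simp_all
  \<comment> \<open>Outside \<open>P\<close> some facet inequality fails: if that of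
    \<open>F\<close>, then \<open>hat\<close> vanishes; if that of another facet, then the product
    has a zero factor. So each layer term is supported in \<open>P\<close>.\<close>
  have hat0: "hat (s k F x) * (\<Prod>F'\<in>\<F> - {F}. ramp (s k F' x)) = 0" if xP: "x \<notin> P" and "F \<in> \<F>" for k F x
  proof -
    obtain F' where F': "F' \<in> \<F>" "nrm F' \<bullet> x > off F'" using xP mem_iff[of x] by (force simp: \<F>_def)
    show ?thesis
    proof (cases "F' = F")
      case True
      then have "s k F x \<le> 0" using F' e(1)[of k] by (simp add: s_def divide_nonpos_pos)
      then show ?thesis by (simp add: hat_eq_0)
    next
      case False
      then have "(\<Prod>F'\<in>\<F> - {F}. ramp (s k F' x)) = 0" using F' fin by (intro prod0[of F']) auto
      then show ?thesis by simp
    qed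
  qed
  then have G0: "G k F x = 0" if "x \<notin> P" "F \<in> \<F>" for k F x
    using that by (simp add: G_def)
  have Gint: "integrable lborel (G k F)" if "F \<in> \<F>" for k F
    by (rule integrable_compact_support[OF Gcont, of R]) (use G0[OF _ that] R in blast)
  have cuf: "continuous_on UNIV (\<lambda>x. cu k x * f' x e)" for k by (intro continuous_intros cucont cont)
  have cufint: "integrable lborel (\<lambda>x. cu k x * f' x e)" for k
    by (rule integrable_compact_support[OF cuf, of R]) (use cu0 R in \<open>metis mult_zero_left subsetD\<close>)
  have key: "(\<integral>x. cu k x * f' x e \<partial>lborel) = (\<Sum>F\<in>\<F>. (nrm F \<bullet> e) * (\<integral>x. G k F x \<partial>lborel))" for k
  proof -
    have "continuous_on UNIV (\<lambda>x. g' k x e)" unfolding g'e by (intro continuous_intros cuf Gcont)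
    then have "(\<integral>x. g' k x e \<partial>lborel) = 0"
      by (rule integral_directional_derivative_eq_0[OF gder, where R = R]) (use cu0 R in \<open>metis mult_zero_left subsetD\<close>)
    then show ?thesis unfolding g'e using Gint cufint by simp
  qed
  have lhs: "(\<lambda>k. \<integral>x. cu k x * f' x e \<partial>lborel) \<longlonglongrightarrow> (\<integral>x. f' x e \<partial>lebesgue_on P)"
  proof -
    have Ps: "P \<in> sets borel" using compact by (rule borel_compact)
    have im: "(\<lambda>x. indicator P x *\<^sub>R f' x e) \<in> borel_measurable lborel"
      using Ps borel_measurable_continuous_onI[OF cont] by simp
    have "(\<lambda>k. \<integral>x. cu k x * f' x e \<partial>lborel) \<longlonglongrightarrow> (\<integral>x. indicator P x *\<^sub>R f' x e \<partial>lborel)"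
    proof (rule integral_dominated_convergence[where w = "\<lambda>x. norm (indicator P x *\<^sub>R f' x e)"])
      show "integrable lborel (\<lambda>x. norm (indicator P x *\<^sub>R f' x e))"
        by (intro integrable_norm borel_integrable_compact compact continuous_on_subset[OF cont]) auto
      show "(\<lambda>x. cu k x * f' x e) \<in> borel_measurable lborel" for k
        using cufint by (rule borel_measurable_integrable)
      have "norm (cu k x * f' x e) \<le> norm (indicator P x *\<^sub>R f' x e)" for k x
      proof (cases "x \<in> P")
        case True
        then show ?thesis using prod_bd[of "\<lambda>F. s k F x" \<F>] by (simp add: cu_def abs_mult mult_left_le_one_le)
      qed (simp add: cu0)
      then show "AE x in lborel. norm (cu k x * f' x e) \<le> norm (indicator P x *\<^sub>R f' x e)" for k by simp
      have "negligible (frontier P)" using convex by (rule negligible_convex_frontier)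
      then have "frontier P \<in> null_sets lborel"
        by (simp add: negligible_iff_null_sets null_sets_completion_iff)
      then have "AE x in lborel. x \<notin> frontier P" by (rule AE_not_in)
      moreover have "(\<lambda>k. cu k x * f' x e) \<longlonglongrightarrow> indicator P x *\<^sub>R f' x e" if "x \<notin> frontier P" for x
      proof (cases "x \<in> P")
        case True
        then have int: "x \<in> interior P" using that closure_subset[of P] by (auto simp: frontier_def)
        have "(\<lambda>k. ramp (s k F x)) \<longlonglongrightarrow> 1" if "F \<in> \<F>" for F
        proof -
          define d where "d = off F - nrm F \<bullet> x"
          have "d > 0" using interior_strict[OF _ int] that by (simp add: d_def \<F>_def)
          with e0 have "\<forall>\<^sub>F k in sequentially. \<epsilon> k < d" by (rule order_tendstoD(2))
          then have "\<forall>\<^sub>F k in sequentially. ramp (s k F x) = 1"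
            by eventually_elim (use e(1) in \<open>auto intro!: ramp_high simp: s_def d_def[symmetric] field_simps\<close>)
          then show ?thesis by (rule tendsto_eventually)
        qed
        then have "(\<lambda>k. cu k x) \<longlonglongrightarrow> (\<Prod>F\<in>\<F>. 1)" unfolding cu_def by (rule tendsto_prod)
        then have "(\<lambda>k. cu k x * f' x e) \<longlonglongrightarrow> 1 * f' x e" by (intro tendsto_mult tendsto_const) simp
        then show ?thesis using True by simp
      qed (simp add: cu0)
      ultimately show "AE x in lborel. (\<lambda>k. cu k x * f' x e) \<longlonglongrightarrow> indicator P x *\<^sub>R f' x e"
        by (auto elim: eventually_mono)
    qed (rule im)
    also have "(\<integral>x. indicator P x *\<^sub>R f' x e \<partial>lborel) = (\<integral>x. indicator P x *\<^sub>R f' x e \<partial>lebesgue)"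
      using im by (rule integral_completion[symmetric])
    also have "\<dots> = (\<integral>x. f' x e \<partial>lebesgue_on P)"
      using Ps by (intro integral_restrict_space[symmetric]) auto
    finally show ?thesis .
  qed
  have rhs: "(\<lambda>k. \<integral>x. G k F x \<partial>lborel) \<longlonglongrightarrow> (\<integral>x. f x \<partial>flat_measure F)" if F: "F facet_of P" for F
  proof -
    have F': "F \<in> \<F>" using F by (simp add: \<F>_def)
    let ?m = "unit_normal F"
    obtain \<sigma> where sg: "\<sigma> = 1 \<or> \<sigma> = - 1" and m: "?m = \<sigma> *\<^sub>R nrm F" using unit_normal_facet[OF F] .
    have mm: "?m \<bullet> ?m = 1" using norm_unit_normal[OF F] .
    have nm: "nrm F \<bullet> ?m = \<sigma>" using facet_rep(1)[OF F] by (simp add: m norm_eq_1)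
    \<comment> \<open>Chosen so that \<open>S k\<close> multiplies the height by
      \<open>1 + c k = - (\<epsilon> k * \<sigma>)\<close>: the prism is squeezed to thickness
      \<open>\<epsilon> k\<close> and put on the side of \<open>P\<close>, whichever way
      \<open>unit_normal F\<close> points. The Jacobian determinant has absolute value
      \<open>\<epsilon> k\<close>.\<close>
    define c where "c = (\<lambda>k. - (1 + \<epsilon> k * \<sigma>))"
    define S where "S = (\<lambda>k z. z + (c k * height F z) *\<^sub>R ?m)"
    have hS: "height F (S k z) = - (\<epsilon> k * \<sigma> * height F z)" and pS: "proj F (S k z) = proj F z" for k z
      unfolding S_def height_add[OF F] proj_add[OF F] by (simp_all add: c_def algebra_simps)
    have S_eq: "S k z = proj F z + (- (\<epsilon> k * \<sigma> * height F z)) *\<^sub>R ?m" for k z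
      using proj_height[of "S k z" F] hS pS by simp
    have "nrm F \<bullet> S k z = off F - \<epsilon> k * height F z" for k z
      using sg nm proj_hyperplane[OF F, of z] by (auto simp: S_eq inner_add_right inner_diff_right)
    then have sS: "s k F (S k z) = height F z" for k z
      using e(1)[of k] by (simp add: s_def)
    have derS: "(S k has_derivative (\<lambda>h. h + (?m \<bullet> h) *\<^sub>R (c k *\<^sub>R ?m))) (at z within A)" for k z A
      unfolding S_def by (auto intro!: derivative_eq_intros height_has_derivative simp: algebra_simps)
    have detS: "\<bar>det (matrix (\<lambda>h. h + (?m \<bullet> h) *\<^sub>R (c k *\<^sub>R ?m)))\<bar> = \<epsilon> k" for k
      unfolding matrix_add_outer det_add_outer using sg e(1)[of k] by (auto simp: mm c_def)
    have injS: "inj (S k)" for k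
    proof (rule injI)
      fix z w assume zw: "S k z = S k w"
      then have "height F z = height F w" using hS[of k z] hS[of k w] e(1)[of k] sg by auto
      moreover have "proj F z = proj F w" using zw pS by metis
      ultimately show "z = w" using proj_height by metis
    qed
    have surjS: "range (S k) = UNIV" for k
    proof (rule surjI)
      fix w
      let ?z = "proj F w + (- (height F w / (\<epsilon> k * \<sigma>))) *\<^sub>R ?m"
      have "proj F ?z = proj F w" "height F ?z = - (height F w / (\<epsilon> k * \<sigma>))"
        by (simp_all only: height_add[OF F] proj_add[OF F] height_proj[OF F])
          (simp_all add: proj_def[of F "proj F w"] height_proj[OF F])
      then have "S k ?z = proj F w + height F w *\<^sub>R ?m" using e(1)[of k] sg by (auto simp: S_eq)
      then show "S k ?z = w" using proj_height by metis
    qed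
    \<comment> \<open>The layer integrand in prism coordinates. The Jacobian factor
      \<open>\<epsilon> k\<close> cancels the \<open>1 / \<epsilon> k\<close> in \<open>G\<close>,
      which leaves a family bounded uniformly in \<open>k\<close>.\<close>
    define H where "H = (\<lambda>k z. hat (height F z) * (\<Prod>F'\<in>\<F> - {F}. ramp (s k F' (S k z))) * f (S k z))"
    have HG: "H k z = \<epsilon> k * G k F (S k z)" for k z
      using e(1)[of k] by (simp add: H_def G_def sS)
    have cov: "(\<integral>x. G k F x \<partial>lborel) = (\<integral>z. H k z \<partial>lebesgue)" for k
    proof -
      have "(\<integral>x. G k F x \<partial>lborel) = (\<integral>x. G k F x \<partial>lebesgue)"
        by (rule integral_completion[symmetric]) (simp add: borel_measurable_continuous_onI[OF Gcont])
      also have "\<dots> = (\<integral>z. \<epsilon> k * G k F (S k z) \<partial>lebesgue)"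
        using change_of_variables(2)[of UNIV "S k" "\<lambda>z h. h + (?m \<bullet> h) *\<^sub>R (c k *\<^sub>R ?m)" "G k F"]
          derS injS surjS detS by (simp add: lebesgue_on_UNIV_eq)
      finally show ?thesis by (simp add: HG)
    qed
    have Scont: "continuous_on UNIV (S k)" for k
      by (rule has_derivative_continuous_on[OF derS])
    have "continuous_on UNIV (H k)" for k
      unfolding HG[abs_def]
      by (intro continuous_on_mult continuous_on_const continuous_on_compose2[OF Gcont Scont] subset_UNIV)
    then have Hm: "H k \<in> borel_measurable lebesgue" for k
      by (intro measurable_completion) (simp add: borel_measurable_continuous_onI)
    have ps: "prism F \<in> sets lebesgue" using lmeasurable_compact[OF compact_prism[OF F]] by (rule fmeasurableD)
    define L where "L = (\<lambda>z. indicator (prism F) z *\<^sub>R (hat (height F z) * f (proj F z)))"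
    have "continuous_on UNIV (\<lambda>z. hat (height F z) * f (proj F z))"
      by (intro continuous_intros continuous_on_compose2[OF continuous_hat[of UNIV] continuous_height]
          continuous_on_compose2[OF fcont continuous_proj]) auto
    then have "(\<lambda>z. hat (height F z) * f (proj F z)) \<in> borel_measurable lebesgue"
      by (intro measurable_completion) (simp add: borel_measurable_continuous_onI)
    then have Lm: "L \<in> borel_measurable lebesgue"
      unfolding L_def using ps by measurable
    obtain C where C: "\<And>x. x \<in> P \<Longrightarrow> \<bar>f x\<bar> \<le> C" "C \<ge> 0"
    proof -
      have "compact (f ` P)" by (intro compact_continuous_image compact continuous_on_subset[OF fcont]) simp
      then obtain B where "\<And>x. x \<in> P \<Longrightarrow> \<bar>f x\<bar> \<le> B"
        using compact_imp_bounded[of "f ` P"] by (auto simp: bounded_iff)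
      then show ?thesis using that[of "max B 0"] by (meson max.coboundedI1 max.cobounded2)
    qed
    \<comment> \<open>A nonzero value forces \<open>S k z \<in> P\<close> and height at most 1 in
      modulus. As \<open>\<bar>c k\<bar> \<le> 2\<close>, the point \<open>z\<close> is within 2 of
      the ball of radius \<open>R\<close>; the factor 2 in front of \<open>C\<close> is the maximum
      of \<open>hat\<close>.\<close>
    have bound: "norm (H k z) \<le> 2 * C * indicator (cball 0 (R + 2)) z" for k z
    proof (cases "H k z = 0")
      case True
      then show ?thesis using C(2) by simp
    next
      case False
      then have SP: "S k z \<in> P" using G0[OF _ F'] HG by force
      have h1: "\<bar>height F z\<bar> \<le> 1" using False hat_eq_0[of "height F z"] unfolding H_def by force
      have "z = S k z + (- (c k * height F z)) *\<^sub>R ?m" by (simp add: S_def)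
      then have "norm z \<le> norm (S k z) + norm ((- (c k * height F z)) *\<^sub>R ?m)"
        using norm_triangle_ineq by metis
      moreover have "norm ?m = 1" using mm by (simp add: norm_eq_1)
      moreover have "\<bar>c k\<bar> \<le> 2" using sg e[of k] by (auto simp: c_def)
      then have "\<bar>c k * height F z\<bar> \<le> 2 * 1" unfolding abs_mult using h1 by (intro mult_mono) auto
      moreover have "norm (S k z) \<le> R" using SP R by auto
      ultimately have "z \<in> cball 0 (R + 2)" by simp
      moreover have "\<bar>H k z\<bar> \<le> 2 * 1 * C"
        unfolding H_def abs_mult using C SP hat_bounds prod_bd by (intro mult_mono) auto
      ultimately show ?thesis by simp
    qed
    have nae: "AE z in lebesgue. z \<notin> frontier (prism F)"
    proof -
      have "negligible (frontier (prism F))" using convex_prism[OF F] by (rule negligible_convex_frontier)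
      then show ?thesis by (auto simp: negligible_iff_null_sets intro: AE_not_in)
    qed
    have lim: "(\<lambda>k. H k z) \<longlonglongrightarrow> L z" if z: "z \<notin> frontier (prism F)" for z
    proof (cases "0 < height F z \<and> height F z < 1")
      case False
      then have "hat (height F z) = 0" using hat_eq_0[of "height F z"] by linarith
      then show ?thesis by (simp add: H_def L_def)
    next
      case True
      have Sp: "(\<lambda>k. S k z) \<longlonglongrightarrow> proj F z"
      proof -
        have "(\<lambda>k. proj F z + (- (\<epsilon> k * \<sigma> * height F z)) *\<^sub>R ?m) \<longlonglongrightarrow> proj F z + (- (0 * \<sigma> * height F z)) *\<^sub>R ?m"
          by (intro tendsto_intros e0)
        then show ?thesis by (simp add: S_eq)
      qed
      have nS: "(\<lambda>k. off F' - nrm F' \<bullet> S k z) \<longlonglongrightarrow> off F' - nrm F' \<bullet> proj F z" for F'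
        by (intro tendsto_intros Sp)
      show ?thesis
      proof (cases "z \<in> prism F")
        case True
        then have "z \<in> interior (prism F)" using z closure_subset[of "prism F"] by (auto simp: frontier_def)
        then have ri: "proj F z \<in> rel_interior F" by (rule interior_prism[OF F])
        have "(\<lambda>k. ramp (s k F' (S k z))) \<longlonglongrightarrow> 1" if "F' \<in> \<F> - {F}" for F'
        proof -
          define d where "d = off F' - nrm F' \<bullet> proj F z"
          have "d > 0" using rel_interior_strict[OF F _ _ ri, of F'] that by (auto simp: d_def \<F>_def)
          then have "\<forall>\<^sub>F k in sequentially. \<epsilon> k < d / 2" "\<forall>\<^sub>F k in sequentially. off F' - nrm F' \<bullet> S k z > d / 2"
            using order_tendstoD(2)[OF e0, of "d / 2"] order_tendstoD(1)[OF nS, of "d / 2" F'] by (simp_all add: d_def)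
          then have "\<forall>\<^sub>F k in sequentially. ramp (s k F' (S k z)) = 1"
          proof eventually_elim
            case (elim k)
            then show ?case using e(1)[of k] by (intro ramp_high) (simp add: s_def field_simps)
          qed
          then show ?thesis by (rule tendsto_eventually)
        qed
        then have "(\<lambda>k. (\<Prod>F'\<in>\<F> - {F}. ramp (s k F' (S k z)))) \<longlonglongrightarrow> (\<Prod>F'\<in>\<F> - {F}. 1)" by (rule tendsto_prod)
        moreover have "(\<lambda>k. f (S k z)) \<longlonglongrightarrow> f (proj F z)"
          using continuous_on_tendsto_compose[OF fcont Sp] by simp
        ultimately have "(\<lambda>k. H k z) \<longlonglongrightarrow> hat (height F z) * (\<Prod>F'\<in>\<F> - {F}. 1) * f (proj F z)"
          unfolding H_def by (intro tendsto_mult tendsto_const)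
        then show ?thesis using True by (simp add: L_def)
      next
        case npr: False
        then have "proj F z \<notin> F" using True mem_prism_iff[OF F] by auto
        then have "proj F z \<notin> P" using mem_facet_iff[OF F] proj_hyperplane[OF F] by blast
        then obtain F' where F'': "F' facet_of P" "nrm F' \<bullet> proj F z > off F'" using mem_iff[of "proj F z"] by force
        then have ne: "F' \<in> \<F> - {F}" using proj_hyperplane[OF F, of z] by (auto simp: \<F>_def)
        \<comment> \<open>The projection of \<open>z\<close> violates the inequality of another
          facet strictly. The points \<open>S k z\<close> converge to it, so they violate it as well
          from some \<open>k\<close> on, which kills the product.\<close>
        have "\<forall>\<^sub>F k in sequentially. off F' - nrm F' \<bullet> S k z < 0"
          using order_tendstoD(2)[OF nS, of F' 0] F''(2) by simp
        then have "\<forall>\<^sub>F k in sequentially. H k z = 0"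
        proof eventually_elim
          case (elim k)
          then have "(\<Prod>F'\<in>\<F> - {F}. ramp (s k F' (S k z))) = 0"
            using prod0[OF ne] fin by simp
          then show ?case by (simp add: H_def)
        qed
        then show ?thesis using npr by (simp add: L_def tendsto_eventually)
      qed
    qed
    have "(\<lambda>k. \<integral>z. H k z \<partial>lebesgue) \<longlonglongrightarrow> (\<integral>z. L z \<partial>lebesgue)"
    proof (rule integral_dominated_convergence[where w = "\<lambda>z. 2 * C * indicator (cball 0 (R + 2)) z"])
      show "integrable lebesgue (\<lambda>z. 2 * C * indicator (cball (0::real^'n) (R + 2)) z)"
        using emeasure_bounded_finite[of "cball (0::real^'n) (R + 2)"]
        by (intro integrable_mult_right integrable_real_indicator) simp_all
      show "AE z in lebesgue. (\<lambda>k. H k z) \<longlonglongrightarrow> L z" using nae lim by (auto elim: eventually_mono)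
    qed (use Hm Lm bound in auto)
    also have "(\<integral>z. L z \<partial>lebesgue) = (\<integral>z. hat (height F z) * f (proj F z) \<partial>lebesgue_on (prism F))"
      unfolding L_def using ps by (intro integral_restrict_space[symmetric]) simp
    also have "\<dots> = (\<integral>z. f (proj F z) \<partial>lebesgue_on (prism F))" by (rule integral_prism_hat[OF F])
    also have "\<dots> = (\<integral>x. f x \<partial>flat_measure F)"
      by (rule integral_flat_measure[OF F, symmetric])
        (intro measurable_restrict_space1 borel_measurable_continuous_onI fcont)
    finally show ?thesis unfolding cov .
  qed
  have "(\<lambda>k. \<Sum>F\<in>\<F>. (nrm F \<bullet> e) * (\<integral>x. G k F x \<partial>lborel)) \<longlonglongrightarrow>
      (\<Sum>F\<in>\<F>. (nrm F \<bullet> e) * (\<integral>x. f x \<partial>flat_measure F))"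
    by (intro tendsto_sum tendsto_mult tendsto_const rhs) (simp add: \<F>_def)
  with lhs show ?thesis unfolding key \<F>_def by (rule LIMSEQ_unique)
qed

end

section \<open>Lebesgue integrals up to null sets, and continuously differentiable fields\<close>

lemma (in complete_measure) measurable_cong_AE_complete:
  assumes "AE x in M. f x = g x" "g \<in> measurable M N" "f \<in> space M \<rightarrow> space N"
  shows "f \<in> measurable M N"
proof (rule measurableI)
  fix A assume A: "A \<in> sets N"
  have "AE x in M. x \<in> g -` A \<inter> space M \<longleftrightarrow> x \<in> f -` A \<inter> space M"
    using assms(1) by eventually_elim auto
  then show "f -` A \<inter> space M \<in> sets M"
    using measurable_sets[OF assms(2) A] in_sets_AE by blast
qed (use assms(3) in auto)

text \<open>By completeness both functions are measurable or neither is, and in the latter case both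
  integrals are 0 by convention. This allows integrands such as \<open>weak_div\<close>, of which
  only the values almost everywhere are known.\<close>

lemma integral_cong_AE_lebesgue:
  fixes f g :: "'a::euclidean_space \<Rightarrow> real"
  assumes ae: "AE x in lebesgue. f x = g x"
  shows "(\<integral>x. f x \<partial>lebesgue) = (\<integral>x. g x \<partial>lebesgue)"
proof (cases "f \<in> borel_measurable lebesgue")
  case True
  have ae': "AE x in lebesgue. g x = f x" using ae by eventually_elim simp
  have "g \<in> borel_measurable lebesgue"
    by (rule completion.measurable_cong_AE_complete[OF ae' True]) simp
  with True ae show ?thesis by (intro integral_cong_AE)
next
  case False
  then have "g \<notin> borel_measurable lebesgue"
    using completion.measurable_cong_AE_complete[OF ae] by auto
  then show ?thesis
    using False by (metis borel_measurable_integrable not_integrable_integral_eq)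
qed

lemma integral_lebesgue_on_cong:
  fixes f g :: "'a::euclidean_space \<Rightarrow> real"
  assumes S: "S \<in> sets lebesgue" and T: "T \<in> sets lebesgue" and ST: "negligible (S - T \<union> (T - S))"
    and ae: "AE x in lebesgue_on (S \<inter> T). f x = g x"
  shows "(\<integral>x. f x \<partial>lebesgue_on S) = (\<integral>x. g x \<partial>lebesgue_on T)"
proof -
  have "AE x in lebesgue. x \<in> S \<inter> T \<longrightarrow> f x = g x"
    using ae S T by (subst (asm) AE_restrict_space_iff) auto
  moreover have "AE x in lebesgue. x \<notin> S - T \<union> (T - S)"
    using ST by (intro AE_not_in) (simp add: negligible_iff_null_sets)
  ultimately have "AE x in lebesgue. indicator S x *\<^sub>R f x = indicator T x *\<^sub>R g x"
    by eventually_elim (auto simp: indicator_def)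
  then show ?thesis
    using S T integral_cong_AE_lebesgue[of "\<lambda>x. indicator S x *\<^sub>R f x" "\<lambda>x. indicator T x *\<^sub>R g x"]
    by (simp add: integral_restrict_space)
qed

lemma integrable_continuous_compact:
  fixes f :: "'a::euclidean_space \<Rightarrow> real"
  assumes "compact S" "continuous_on S f"
  shows "integrable (lebesgue_on S) f"
proof -
  have "integrable lebesgue (\<lambda>x. indicator S x *\<^sub>R f x)"
    using borel_integrable_compact[OF assms]
    by (subst integrable_completion) (auto dest: borel_measurable_integrable)
  then show ?thesis
    using lmeasurable_compact[OF assms(1)] by (simp add: integrable_restrict_space)
qed

text \<open>The Jacobian matrix is carried along explicitly, so that the divergence is simply
  \<open>trace (D x)\<close>.\<close>

definition C1_field :: "(real^'n \<Rightarrow> real^'n) \<Rightarrow> (real^'n \<Rightarrow> real^'n^'n) \<Rightarrow> bool" where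
  "C1_field u D \<longleftrightarrow> (\<forall>x. (u has_derivative (*v) (D x)) (at x)) \<and> continuous_on UNIV D"

lemma real_polynomial_function_C1:
  assumes "real_polynomial_function (f :: 'a::real_normed_vector \<Rightarrow> real)"
  shows "\<exists>f'. (\<forall>x. (f has_derivative f' x) (at x)) \<and> (\<forall>h. continuous_on UNIV (\<lambda>x. f' x h))"
  using assms
proof induction
  case (linear f)
  then show ?case
    by (intro exI[of _ "\<lambda>x. f"]) (simp add: bounded_linear_imp_has_derivative)
next
  case (const c)
  show ?case by (intro exI[of _ "\<lambda>x h. 0"]) auto
next
  case (add f g)
  then obtain f' g' where
    "\<And>x. (f has_derivative f' x) (at x)" "\<And>h. continuous_on UNIV (\<lambda>x. f' x h)"
    "\<And>x. (g has_derivative g' x) (at x)" "\<And>h. continuous_on UNIV (\<lambda>x. g' x h)" by blast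
  then show ?case
    by (intro exI[of _ "\<lambda>x h. f' x h + g' x h"]) (auto intro!: has_derivative_add continuous_intros)
next
  case (mult f g)
  then obtain f' g' where
    d: "\<And>x. (f has_derivative f' x) (at x)" "\<And>h. continuous_on UNIV (\<lambda>x. f' x h)"
    "\<And>x. (g has_derivative g' x) (at x)" "\<And>h. continuous_on UNIV (\<lambda>x. g' x h)" by blast
  moreover have "continuous_on UNIV f" "continuous_on UNIV g"
    by (rule has_derivative_continuous_on, rule d(1), rule has_derivative_continuous_on, rule d(3))
  ultimately show ?case
    by (intro exI[of _ "\<lambda>x h. f x * g' x h + f' x h * g x"]) (auto intro!: has_derivative_mult continuous_intros)
qed

lemma C1_field_if_components:
  fixes u :: "real^'n \<Rightarrow> real^'n"
  assumes "\<And>i. real_polynomial_function (\<lambda>x. u x $ i)"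
  shows "\<exists>D. C1_field u D"
proof -
  have "\<forall>i. \<exists>f'. (\<forall>x. ((\<lambda>x. u x $ i) has_derivative f' x) (at x)) \<and> (\<forall>h. continuous_on UNIV (\<lambda>x. f' x h))"
    using real_polynomial_function_C1[OF assms] by blast
  then obtain f' where f': "\<And>i x. ((\<lambda>x. u x $ i) has_derivative f' i x) (at x)"
    "\<And>i h. continuous_on UNIV (\<lambda>x. f' i x h)" by metis
  define D where "D = (\<lambda>x. \<chi> i j. f' i x (axis j 1))"
  have "(u has_derivative (*v) (D x)) (at x)" for x
  proof -
    have "(u has_derivative (\<lambda>h. \<chi> i. f' i x h)) (at x)"
    proof (subst has_derivative_componentwise_within, rule ballI)
      fix b :: "real^'n" assume "b \<in> Basis"
      then obtain i where "b = axis i 1" by (auto simp: Basis_vec_def)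
      then show "((\<lambda>x. u x \<bullet> b) has_derivative (\<lambda>h. (\<chi> i. f' i x h) \<bullet> b)) (at x)"
        using f'(1)[of i x] by (simp add: inner_axis)
    qed
    moreover have "(\<lambda>h. \<chi> i. f' i x h) = (*v) (matrix (\<lambda>h. \<chi> i. f' i x h))"
      by (rule matrix_vector_mul(2)[OF has_derivative_linear[OF calculation], symmetric])
    moreover have "matrix (\<lambda>h. \<chi> i. f' i x h) = D x" by (simp add: matrix_def D_def)
    ultimately show ?thesis by simp
  qed
  moreover have "continuous_on UNIV D"
    unfolding D_def by (intro continuous_on_vec_lambda f')
  ultimately show ?thesis by (auto simp: C1_field_def)
qed

lemma C1_field_polynomial_function:
  fixes u :: "real^'n \<Rightarrow> real^'n"
  assumes "polynomial_function u"
  shows "\<exists>D. C1_field u D"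
proof (rule C1_field_if_components)
  fix i
  show "real_polynomial_function (\<lambda>x. u x $ i)"
    using assms[unfolded polynomial_function_def, rule_format, OF bounded_linear_vec_nth[of i]]
    by (simp add: comp_def)
qed

context solid_polytope
begin

lemma space_flat_measure [simp]: "space (flat_measure F) = F"
  by (simp add: flat_measure_def space_restrict_space)

lemma sets_flat_measure [measurable_cong]: "sets (flat_measure F) = sets (restrict_space borel F)"
  by (simp add: flat_measure_def)

lemma finite_measure_flat:
  assumes F: "F facet_of P"
  shows "finite_measure (flat_measure F)"
proof -
  have "emeasure lborel (prism F) < \<infinity>"
    using compact_prism[OF F] by (intro emeasure_bounded_finite compact_imp_bounded)
  then have "finite_measure (restrict_space lborel (prism F))"
    using compact_prism[OF F]
    by (intro finite_measureI) (simp add: space_restrict_space emeasure_restrict_space borel_compact)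
  then show ?thesis
    unfolding flat_measure_eq[OF F] by (intro finite_measure.finite_measure_distr measurable_proj[OF F])
qed

lemma integrable_flat_measure:
  fixes h :: "real^'n \<Rightarrow> real"
  assumes F: "F facet_of P" and h: "continuous_on F h"
  shows "integrable (flat_measure F) h"
proof -
  interpret finite_measure "flat_measure F" by (rule finite_measure_flat[OF F])
  have "compact (h ` F)" by (intro compact_continuous_image h facet_props F)
  then obtain B where B: "\<And>x. x \<in> F \<Longrightarrow> norm (h x) \<le> B"
    using compact_imp_bounded[of "h ` F"] by (auto simp: bounded_iff)
  show ?thesis
  proof (rule integrable_const_bound)
    show "AE x in flat_measure F. norm (h x) \<le> B" using B by (auto intro: AE_I2)
    show "h \<in> borel_measurable (flat_measure F)"
      unfolding measurable_cong_sets[OF sets_flat_measure refl]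
      by (rule borel_measurable_continuous_on_restrict[OF h])
  qed
qed

text \<open>The directional version is applied to each \<open>u x $ i * \<phi> x\<close> in the
  coordinate direction \<open>i\<close>, and the results are summed over \<open>i\<close>.\<close>

lemma divergence_theorem:
  fixes u :: "real^'n \<Rightarrow> real^'n" and \<phi> :: "real^'n \<Rightarrow> real"
  assumes u: "C1_field u D" and \<phi>: "\<And>x. (\<phi> has_derivative (\<lambda>h. g x \<bullet> h)) (at x)" "continuous_on UNIV g"
  shows "(\<integral>x. trace (D x) * \<phi> x + u x \<bullet> g x \<partial>lebesgue_on P) =
         (\<Sum>F | F facet_of P. \<integral>x. (u x \<bullet> nrm F) * \<phi> x \<partial>flat_measure F)"
proof -
  have ud: "(u has_derivative (*v) (D x)) (at x)" for x using u by (simp add: C1_field_def)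
  have Dc: "continuous_on UNIV D" using u by (simp add: C1_field_def)
  have uc: "continuous_on UNIV u" "continuous_on UNIV \<phi>"
    by (rule has_derivative_continuous_on, rule ud, rule has_derivative_continuous_on, rule \<phi>(1))
  define f' where "f' = (\<lambda>i x h. u x $ i * (g x \<bullet> h) + (D x *v h) $ i * \<phi> x)"
  have der: "((\<lambda>x. u x $ i * \<phi> x) has_derivative f' i x) (at x)" for i x
    unfolding f'_def
    by (rule has_derivative_mult[OF bounded_linear.has_derivative[OF bounded_linear_vec_nth ud] \<phi>(1)])
  have fe: "f' i x (axis i 1) = D x $ i $ i * \<phi> x + u x $ i * g x $ i" for i x
  proof -
    have "(D x *v axis i 1) $ i = D x $ i $ i"
      by (simp add: matrix_vector_mul_component inner_axis)
    then show ?thesis by (simp add: f'_def inner_axis)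
  qed
  have cont: "continuous_on UNIV (\<lambda>x. f' i x (axis i 1))" for i
    unfolding fe by (intro continuous_intros uc Dc \<phi>(2))
  have int: "integrable (lebesgue_on P) (\<lambda>x. f' i x (axis i 1))" for i
    using compact continuous_on_subset[OF cont] by (intro integrable_continuous_compact) auto
  have "(\<integral>x. trace (D x) * \<phi> x + u x \<bullet> g x \<partial>lebesgue_on P) = (\<integral>x. (\<Sum>i\<in>UNIV. f' i x (axis i 1)) \<partial>lebesgue_on P)"
    by (simp add: fe trace_def inner_vec_def sum.distrib sum_distrib_right)
  also have "\<dots> = (\<Sum>i\<in>UNIV. \<integral>x. f' i x (axis i 1) \<partial>lebesgue_on P)"
    using int by (rule Bochner_Integration.integral_sum)
  also have "\<dots> = (\<Sum>i\<in>UNIV. \<Sum>F | F facet_of P. (nrm F \<bullet> axis i 1) * (\<integral>x. u x $ i * \<phi> x \<partial>flat_measure F))"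
    by (intro sum.cong refl divergence_theorem_directional der cont)
  also have "\<dots> = (\<Sum>F | F facet_of P. \<Sum>i\<in>UNIV. (nrm F \<bullet> axis i 1) * (\<integral>x. u x $ i * \<phi> x \<partial>flat_measure F))"
    by (rule sum.swap)
  also have "\<dots> = (\<Sum>F | F facet_of P. \<integral>x. (u x \<bullet> nrm F) * \<phi> x \<partial>flat_measure F)"
  proof (rule sum.cong[OF refl], clarify)
    fix F assume F: "F facet_of P"
    have "integrable (flat_measure F) (\<lambda>x. u x $ i * \<phi> x)" for i
      by (intro integrable_flat_measure F continuous_intros continuous_on_subset[OF uc(1)] continuous_on_subset[OF uc(2)]) auto
    then have "(\<Sum>i\<in>UNIV. (nrm F \<bullet> axis i 1) * (\<integral>x. u x $ i * \<phi> x \<partial>flat_measure F)) =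
        (\<integral>x. (\<Sum>i\<in>UNIV. (nrm F \<bullet> axis i 1) * (u x $ i * \<phi> x)) \<partial>flat_measure F)"
      by (simp add: Bochner_Integration.integral_sum)
    also have "\<dots> = (\<integral>x. (u x \<bullet> nrm F) * \<phi> x \<partial>flat_measure F)"
    proof (rule Bochner_Integration.integral_cong[OF refl])
      fix x
      have "(\<Sum>i\<in>UNIV. (nrm F \<bullet> axis i 1) * (u x $ i * \<phi> x)) = (\<Sum>i\<in>UNIV. nrm F $ i * u x $ i) * \<phi> x"
        by (simp add: inner_axis sum_distrib_right mult.assoc)
      then show "(\<Sum>i\<in>UNIV. (nrm F \<bullet> axis i 1) * (u x $ i * \<phi> x)) = (u x \<bullet> nrm F) * \<phi> x"
        by (simp add: inner_vec_def mult.commute)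
    qed
    finally show "(\<Sum>i\<in>UNIV. (nrm F \<bullet> axis i 1) * (\<integral>x. u x $ i * \<phi> x \<partial>flat_measure F)) =
        (\<integral>x. (u x \<bullet> nrm F) * \<phi> x \<partial>flat_measure F)" .
  qed
  finally show ?thesis .
qed

text \<open>Every affine map between facets extends to one between the prisms above them.\<close>

lemma integral_flat_measure_affine:
  assumes F: "F facet_of P" and F': "F' facet_of P" and A: "linear A"
    and img: "(\<lambda>x. A x + c) ` F' = F" and inj: "inj_on (\<lambda>x. A x + c) F'"
  shows "\<exists>\<delta>. \<forall>h :: real^'n \<Rightarrow> real. h \<in> borel_measurable (restrict_space borel F) \<longrightarrow>
      (\<integral>x. h x \<partial>flat_measure F) = \<delta> * (\<integral>x. h (A x + c) \<partial>flat_measure F')"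
proof -
  let ?m = "unit_normal F" and ?m' = "unit_normal F'"
  define a where "a = (\<lambda>x. A x + c)"
  have aA: "a (x + d) = a x + A d" for x d by (simp add: a_def linear_add[OF A])
  have mm: "?m \<bullet> ?m = 1" "?m' \<bullet> ?m' = 1" using norm_unit_normal F F' by auto
  have hyp: "height F (a (proj F' z)) = 0" for z
  proof -
    have "proj F' z \<in> affine hull F'" using height_proj height_affine_hull F' by blast
    moreover have "a ` (affine hull F') \<subseteq> affine hull F"
    proof -
      have "affine {x. a x \<in> affine hull F}"
      proof (subst affine_def, intro ballI allI impI CollectI)
        fix x y u v assume xy: "x \<in> {x. a x \<in> affine hull F}" "y \<in> {x. a x \<in> affine hull F}" "u + v = (1::real)"
        have "a (u *\<^sub>R x + v *\<^sub>R y) = u *\<^sub>R a x + v *\<^sub>R a y"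
          using xy(3) scaleR_add_left[of u v c]
          by (simp add: a_def linear_add[OF A] linear_scale[OF A] scaleR_add_right)
        then show "a (u *\<^sub>R x + v *\<^sub>R y) \<in> affine hull F"
          using xy mem_affine[OF affine_affine_hull] by auto
      qed
      then have "affine hull F' \<subseteq> {x. a x \<in> affine hull F}"
        using img by (intro hull_minimal) (auto simp: a_def intro: hull_inc)
      then show ?thesis by blast
    qed
    ultimately show ?thesis using height_affine_hull[OF F] by blast
  qed
  \<comment> \<open>The extension to the prisms: it acts as the given affine map on projections and
    preserves heights. Being affine, it has a constant Jacobian determinant, whose modulus is
    \<delta>.\<close>
  define S where "S = (\<lambda>z. a (proj F' z) + height F' z *\<^sub>R ?m)"
  have hS: "height F (S z) = height F' z" and pS: "proj F (S z) = a (proj F' z)" for z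
    using hyp[of z] by (simp_all add: S_def height_add[OF F] proj_add[OF F] proj_def)
  define B where "B = (\<lambda>h. A (h - (?m' \<bullet> h) *\<^sub>R ?m') + (?m' \<bullet> h) *\<^sub>R ?m)"
  have "bounded_linear A" using A by (simp add: linear_conv_bounded_linear)
  then have der: "(S has_derivative B) (at z within X)" for z X
    unfolding S_def B_def a_def proj_def[abs_def]
    by (intro has_derivative_add has_derivative_diff has_derivative_scaleR_left height_has_derivative
        bounded_linear.has_derivative[OF \<open>bounded_linear A\<close>] has_derivative_ident has_derivative_add_const)
  have injS: "inj_on S (prism F')"
  proof (rule inj_onI)
    fix z w assume zw: "z \<in> prism F'" "w \<in> prism F'" "S z = S w"
    then have "height F' z = height F' w" "a (proj F' z) = a (proj F' w)" using hS pS by metis+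
    moreover from this have "proj F' z = proj F' w"
      using zw inj mem_prism_iff[OF F'] unfolding inj_on_def a_def by blast
    ultimately show "z = w" using proj_height by metis
  qed
  have imgS: "S ` prism F' = prism F"
  proof (intro equalityI subsetI)
    fix w assume "w \<in> S ` prism F'"
    then show "w \<in> prism F" using mem_prism_iff[OF F] mem_prism_iff[OF F'] hS pS img by (auto simp: a_def)
  next
    fix w assume w: "w \<in> prism F"
    then obtain x where x: "x \<in> F'" "a x = proj F w" using img mem_prism_iff[OF F] by (auto simp: a_def)
    define z where "z = x + height F w *\<^sub>R ?m'"
    have hx: "height F' x = 0" using height_affine_hull[OF F'] hull_inc[OF x(1)] by blast
    have hz: "height F' z = height F w" "proj F' z = x"
      using hx proj_in_facet[OF F' x(1)] by (simp_all add: z_def height_add[OF F'] proj_add[OF F'])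
    then have "z \<in> prism F'" using w x by (simp add: mem_prism_iff[OF F] mem_prism_iff[OF F'])
    moreover have "S z = w" using hz x(2) proj_height[of w F] by (simp add: S_def)
    ultimately show "w \<in> S ` prism F'" by blast
  qed
  have ps: "prism F' \<in> sets lebesgue" using lmeasurable_compact[OF compact_prism[OF F']] by (rule fmeasurableD)
  define \<delta> where "\<delta> = \<bar>det (matrix B)\<bar>"
  have am: "a \<in> restrict_space borel F' \<rightarrow>\<^sub>M restrict_space borel F"
  proof (rule measurable_restrict_space3)
    have "continuous_on UNIV a" unfolding a_def
      using \<open>bounded_linear A\<close> by (intro continuous_intros linear_continuous_on)
    then show "a \<in> borel \<rightarrow>\<^sub>M borel" by (rule borel_measurable_continuous_onI)
  qed (use img a_def in auto)
  have "(\<integral>x. h x \<partial>flat_measure F) = \<delta> * (\<integral>x. h (a x) \<partial>flat_measure F')"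
    if h: "h \<in> borel_measurable (restrict_space borel F)" for h :: "real^'n \<Rightarrow> real"
  proof -
    have "(\<integral>z. h (proj F z) \<partial>lebesgue_on (prism F)) = (\<integral>z. \<delta> * h (proj F (S z)) \<partial>lebesgue_on (prism F'))"
      using change_of_variables(2)[OF ps der injS, of "\<lambda>z. h (proj F z)"] by (simp add: imgS \<delta>_def)
    then show ?thesis
      using integral_flat_measure[OF F h] integral_flat_measure[OF F' measurable_compose[OF am h]]
      by (simp add: pS)
  qed
  then show ?thesis unfolding a_def by blast
qed

end

section \<open>Parametrized cells\<close>

lemma matrix_inv_mult:
  fixes A :: "real^'n^'n"
  assumes "det A \<noteq> 0"
  shows "A ** matrix_inv A = mat 1" "matrix_inv A ** A = mat 1"
proof -
  have "\<exists>B. A ** B = mat 1 \<and> B ** A = mat 1"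
    using assms by (simp add: invertible_det_nz[symmetric] invertible_def)
  then have "A ** matrix_inv A = mat 1 \<and> matrix_inv A ** A = mat 1"
    unfolding matrix_inv_def by (rule someI_ex)
  then show "A ** matrix_inv A = mat 1" "matrix_inv A ** A = mat 1" by auto
qed

lemma inner_matrix_transpose: "(a::real^'n) \<bullet> (A *v b) = (transpose A *v a) \<bullet> b"
  by (simp add: dot_lmul_matrix[symmetric])

lemma integrable_lebesgue_on_subset:
  fixes f :: "'a::euclidean_space \<Rightarrow> real"
  assumes "integrable (lebesgue_on T) f" "S \<subseteq> T" "S \<in> sets lebesgue" "T \<in> sets lebesgue"
  shows "integrable (lebesgue_on S) f"
proof -
  have "set_integrable lebesgue T f"
    using assms by (simp add: set_integrable_def integrable_restrict_space)
  then have "set_integrable lebesgue S f" by (rule set_integrable_subset) (use assms in auto)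
  then show ?thesis using assms by (simp add: set_integrable_def integrable_restrict_space)
qed

lemma AE_lebesgue_on_subset:
  assumes "AE x in lebesgue_on T. Q x" "S \<subseteq> T" "S \<in> sets lebesgue" "T \<in> sets lebesgue"
  shows "AE x in lebesgue_on S. Q x"
proof -
  have "AE x in lebesgue. x \<in> T \<longrightarrow> Q x"
    using assms(1,4) by (subst (asm) AE_restrict_space_iff) auto
  then have "AE x in lebesgue. x \<in> S \<longrightarrow> Q x"
    by eventually_elim (use assms(2) in auto)
  then show ?thesis using assms(3) by (subst AE_restrict_space_iff) auto
qed

lemma continuous_on_det:
  fixes A :: "'a::topological_space \<Rightarrow> real^'n^'n"
  assumes "continuous_on S A"
  shows "continuous_on S (\<lambda>x. det (A x))"
  unfolding det_def by (intro continuous_intros continuous_on_component assms)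

lemma continuous_on_matrix_vector_mult:
  fixes A :: "'a::topological_space \<Rightarrow> real^'n^'m"
  assumes "continuous_on S A" "continuous_on S v"
  shows "continuous_on S (\<lambda>x. A x *v v x)"
  unfolding matrix_vector_mult_def
  by (intro continuous_on_vec_lambda continuous_on_sum continuous_on_mult continuous_on_component assms)

context solid_polytope
begin

text \<open>Nanson's formula for the surface element, with \<open>\<nu>\<close> = J^-T n. The matrix
  under the root in \<open>area_factor\<close> is written as \<open>transpose M ** M\<close>, where
  \<open>M\<close> maps tangent vectors by \<open>J\<close> and the normal \<open>nrm F\<close> to
  the unit normal \<open>u\<close> of the image hyperplane.\<close>

lemma area_factor_eq:
  assumes F: "F facet_of P" and J: "det J \<noteq> 0" and \<nu>: "transpose J *v \<nu> = nrm F"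
  shows "area_factor F J = \<bar>det J\<bar> * norm \<nu>"
proof -
  note [simp del] = transpose_matrix_vector
  let ?n = "nrm F"
  have nn: "?n \<bullet> ?n = 1" using facet_rep(1)[OF F] by (simp add: norm_eq_1)
  obtain \<sigma> where sg: "\<sigma> = 1 \<or> \<sigma> = - 1" "unit_normal F = \<sigma> *\<^sub>R ?n" using unit_normal_facet[OF F] .
  have N: "(\<chi> i j. unit_normal F $ i * unit_normal F $ j) = outer ?n ?n"
    using sg by (auto simp: outer_def vec_eq_iff)
  have \<nu>0: "\<nu> \<noteq> 0" using \<nu> nn by auto
  define u where "u = \<nu> /\<^sub>R norm \<nu>"
  have "norm u = 1" using \<nu>0 by (simp add: u_def)
  then have uu: "u \<bullet> u = 1" by (simp only: norm_eq_1)
  have Ju: "transpose J *v u = ?n /\<^sub>R norm \<nu>" using \<nu> by (simp add: u_def matrix_vector_mult_scaleR)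
  define Q where "Q = mat 1 - outer ?n ?n"
  have Qh: "Q *v h = h - (?n \<bullet> h) *\<^sub>R ?n" for h
    by (simp add: Q_def matrix_vector_mult_diff_rdistrib outer_mult_vec)
  have Qn: "Q *v ?n = 0" by (simp add: Qh nn)
  \<comment> \<open>The mixed terms in \<open>M' ** M\<close> drop out, because \<open>u\<close> is
    orthogonal to the image under \<open>J\<close> of the directions parallel to
    \<open>F\<close>.\<close>
  define M where "M = J ** Q + outer u ?n"
  define M' where "M' = Q ** transpose J + outer ?n u"
  have "transpose Q = Q" by (simp add: Q_def transpose_def outer_def vec_eq_iff mat_def mult.commute)
  moreover have "transpose (outer u ?n) = outer ?n u" by (simp add: transpose_def outer_def vec_eq_iff)
  moreover have "transpose (A + B) = transpose A + transpose B" for A B :: "real^'n^'n"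
    by (simp add: transpose_def vec_eq_iff)
  ultimately have tM: "transpose M = M'" by (simp add: M_def M'_def matrix_transpose_mul)
  have Mh: "M *v h = J *v (Q *v h) + (?n \<bullet> h) *\<^sub>R u" for h
    by (simp add: M_def matrix_vector_mult_add_rdistrib outer_mult_vec matrix_vector_mul_assoc)
  have M'h: "M' *v h = Q *v (transpose J *v h) + (u \<bullet> h) *\<^sub>R ?n" for h
    by (simp add: M'_def matrix_vector_mult_add_rdistrib outer_mult_vec matrix_vector_mul_assoc)
  have MM: "M' ** M = Q ** transpose J ** J ** Q + outer ?n ?n"
  proof (rule matrix_eq[THEN iffD2], rule allI)
    fix h
    have "u \<bullet> (J *v (Q *v h)) = 0"
      unfolding inner_matrix_transpose[of u J] Ju by (simp add: Qh inner_diff_right nn)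
    then have 1: "u \<bullet> (M *v h) = ?n \<bullet> h" unfolding Mh by (simp add: inner_add_right uu)
    have 2: "Q *v (transpose J *v (M *v h)) = Q *v (transpose J *v (J *v (Q *v h)))"
      unfolding Mh by (simp add: matrix_vector_right_distrib matrix_vector_mult_scaleR Ju Qn del: scaleR_scaleR)
    have "(M' ** M) *v h = M' *v (M *v h)" by (simp add: matrix_vector_mul_assoc)
    also have "\<dots> = (Q ** transpose J ** J ** Q + outer ?n ?n) *v h"
      unfolding M'h 1 2 by (simp add: matrix_vector_mult_add_rdistrib outer_mult_vec matrix_vector_mul_assoc matrix_mul_assoc)
    finally show "(M' ** M) *v h = (Q ** transpose J ** J ** Q + outer ?n ?n) *v h" .
  qed
  \<comment> \<open>With \<open>J *v c = u\<close>, the matrix \<open>M\<close> becomes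
    \<open>J\<close> times a rank-one perturbation of the identity, and \<open>det_add_outer\<close>
    gives its determinant.\<close>
  define c where "c = matrix_inv J *v u"
  have Jc: "J *v c = u" by (simp add: c_def matrix_vector_mul_assoc matrix_inv_mult[OF J])
  have cn: "c \<bullet> ?n = norm \<nu>"
  proof -
    have "c \<bullet> ?n = \<nu> \<bullet> (J *v c)" unfolding inner_matrix_transpose \<nu> by (rule inner_commute)
    also have "\<dots> = norm \<nu>" unfolding Jc u_def using \<nu>0 by (simp add: dot_square_norm power2_eq_square)
    finally show ?thesis .
  qed
  have "M = J ** (mat 1 + outer (c - ?n) ?n)"
  proof (rule matrix_eq[THEN iffD2], rule allI)
    fix h
    have "(J ** (mat 1 + outer (c - ?n) ?n)) *v h = J *v (h + (?n \<bullet> h) *\<^sub>R (c - ?n))"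
      by (simp add: matrix_vector_mul_assoc[symmetric] matrix_vector_mult_add_rdistrib outer_mult_vec)
    also have "h + (?n \<bullet> h) *\<^sub>R (c - ?n) = Q *v h + (?n \<bullet> h) *\<^sub>R c" by (simp add: Qh algebra_simps)
    also have "J *v \<dots> = M *v h" by (simp add: matrix_vector_right_distrib matrix_vector_mult_scaleR Jc Mh)
    finally show "M *v h = (J ** (mat 1 + outer (c - ?n) ?n)) *v h" ..
  qed
  then have "det M = det J * norm \<nu>"
    by (simp add: det_mul det_add_outer inner_diff_left nn cn)
  moreover have "det M' = det M" using det_transpose[of M] tM by simp
  ultimately have "det (Q ** transpose J ** J ** Q + outer ?n ?n) = (det J * norm \<nu>)\<^sup>2"
    unfolding MM[symmetric] det_mul by (simp add: power2_eq_square)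
  then show ?thesis
    unfolding area_factor_def Let_def N Q_def[symmetric] by (simp add: abs_mult)
qed

end

text \<open>The values of \<open>T\<close> outside \<open>P\<close> are arbitrary. \<open>p\<close>
  is a \<open>C1\<close> field on the whole space that agrees with \<open>T\<close> on the cell, and
  derivatives up to the boundary are read off from its Jacobian \<open>Dp\<close>.\<close>

locale param_cell = solid_polytope P for P :: "(real^'n) set" +
  fixes T p :: "real^'n \<Rightarrow> real^'n" and Dp :: "real^'n \<Rightarrow> real^'n^'n"
  assumes p: "C1_field p Dp" and Tp: "\<And>x. x \<in> P \<Longrightarrow> T x = p x" and diffeo: "C1_diffeo_on P T"
begin

abbreviation K where "K \<equiv> T ` P"
abbreviation Ti where "Ti \<equiv> inv_into P T"

lemma inj: "inj_on T P" using diffeo by (simp add: C1_diffeo_on_def)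

lemma Ti [simp]: "x \<in> P \<Longrightarrow> Ti (T x) = x" using inj by simp

lemma T_Ti: "y \<in> K \<Longrightarrow> Ti y \<in> P" "y \<in> K \<Longrightarrow> T (Ti y) = y"
  by (fact inv_into_into, fact f_inv_into_f)

lemma Dp_cont: "continuous_on S Dp"
  using p continuous_on_subset[of UNIV Dp S] by (simp add: C1_field_def)

lemma T_has_derivative:
  assumes "x \<in> P"
  shows "(T has_derivative (*v) (Dp x)) (at x within P)"
proof -
  have "(p has_derivative (*v) (Dp x)) (at x)" using p by (simp add: C1_field_def)
  then have "(p has_derivative (*v) (Dp x)) (at x within P)" by (rule has_derivative_at_withinI)
  then show ?thesis by (rule has_derivative_transform[OF assms Tp, rotated]) simp
qed

text \<open>In the interior the derivative is unambiguous. Both sides are continuous on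
  \<open>P\<close>, which is the closure of its interior, so equality extends to the
  boundary.\<close>

lemma jac_eq:
  assumes "x \<in> P"
  shows "jac P T x = Dp x"
proof -
  have cl: "closure (interior P) = P"
    using convex_closure_interior[OF convex interior_nonempty] closed by simp
  have int: "jac P T y - Dp y = 0" if y: "y \<in> interior P" for y
  proof -
    have at: "at y within P = at y" using y by (rule at_within_interior)
    have "y \<in> P" using y interior_subset by blast
    from T_has_derivative[OF this] have "(T has_derivative (*v) (Dp y)) (at y)" by (simp add: at)
    then have "frechet_derivative T (at y) = (*v) (Dp y)" by (rule frechet_derivative_at[symmetric])
    then show ?thesis by (simp add: jac_def at)
  qed
  have "continuous_on P (jac P T)" using diffeo unfolding C1_diffeo_on_def by blast
  then have cont: "continuous_on (closure (interior P)) (\<lambda>y. jac P T y - Dp y)"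
    unfolding cl by (intro continuous_on_diff Dp_cont)
  have "x \<in> closure (interior P)" using assms cl by simp
  from continuous_constant_on_closure[OF cont int this] have "jac P T x - Dp x = 0" .
  then show ?thesis by simp
qed

lemma det_nonzero: "x \<in> P \<Longrightarrow> det (Dp x) \<noteq> 0"
proof -
  assume x: "x \<in> P"
  then have "det (jac P T x) \<noteq> 0" using diffeo unfolding C1_diffeo_on_def by blast
  then show ?thesis using jac_eq[OF x] by simp
qed

definition orient :: real where "orient = sgn (det (Dp (SOME x. x \<in> P)))"

lemma P_nonempty: "P \<noteq> {}" using interior_nonempty interior_subset by fastforce

text \<open>The determinant is continuous and never zero on the connected set \<open>P\<close>; a
  change of sign would contradict the intermediate value property.\<close>

lemma orient:
  shows "x \<in> P \<Longrightarrow> \<bar>det (Dp x)\<bar> = orient * det (Dp x)" and "orient * orient = 1"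
proof -
  define x0 where "x0 = (SOME x. x \<in> P)"
  have x0: "x0 \<in> P" unfolding x0_def using P_nonempty by (simp add: some_in_eq)
  show "orient * orient = 1"
    unfolding orient_def x0_def[symmetric] using det_nonzero[OF x0] by (simp add: sgn_if)
  show "\<bar>det (Dp x)\<bar> = orient * det (Dp x)" if x: "x \<in> P"
  proof -
    have con: "connected ((\<lambda>x. det (Dp x)) ` P)"
      by (intro connected_continuous_image continuous_on_det Dp_cont convex_connected convex)
    have "sgn (det (Dp x)) = sgn (det (Dp x0))"
    proof (rule ccontr)
      assume "\<not> ?thesis"
      then have "det (Dp x) < 0 \<and> 0 < det (Dp x0) \<or> det (Dp x0) < 0 \<and> 0 < det (Dp x)"
        using det_nonzero[OF x] det_nonzero[OF x0] by (auto simp: sgn_if split: if_splits)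
      then have "0 \<in> (\<lambda>x. det (Dp x)) ` P"
        using connectedD_interval[OF con, of "det (Dp x)" "det (Dp x0)" 0]
          connectedD_interval[OF con, of "det (Dp x0)" "det (Dp x)" 0] x x0 by force
      then show False using det_nonzero by auto
    qed
    then show ?thesis unfolding orient_def x0_def[symmetric] by (simp add: abs_sgn mult.commute)
  qed
qed

lemma T_cont: "continuous_on P T"
  by (rule has_derivative_continuous_on[OF T_has_derivative])

lemma compact_K: "compact K" using T_cont compact by (rule compact_continuous_image)

lemma K_sets: "K \<in> sets lebesgue" using compact_K lmeasurable_compact by (blast intro: fmeasurableD)

lemma P_sets: "P \<in> sets lebesgue" using compact lmeasurable_compact by (blast intro: fmeasurableD)

lemma Ti_cont: "continuous_on K Ti"
  by (rule continuous_on_inv[OF T_cont compact]) simp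

text \<open>Invariance of domain, applied to \<open>T\<close> on the interior of \<open>P\<close>
  and to its inverse on the interior of \<open>K\<close>.\<close>

lemma interior_K: "interior K = T ` interior P"
proof
  have "open (T ` interior P)"
    by (rule invariance_of_domain) (use continuous_on_subset[OF T_cont] inj_on_subset[OF inj] interior_subset in auto)
  then show "T ` interior P \<subseteq> interior K" by (intro interior_maximal image_mono interior_subset)
  have "inj_on Ti (interior K)" using inj_on_inv_into[of "interior K" T P] interior_subset by blast
  then have "open (Ti ` interior K)"
    by (intro invariance_of_domain) (use continuous_on_subset[OF Ti_cont] interior_subset in auto)
  moreover have "Ti ` interior K \<subseteq> P" using T_Ti(1) interior_subset[of K] by blast
  ultimately have sub: "Ti ` interior K \<subseteq> interior P" by (intro interior_maximal)
  show "interior K \<subseteq> T ` interior P"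
  proof
    fix y assume "y \<in> interior K"
    then have "Ti y \<in> interior P" "T (Ti y) = y" using sub T_Ti(2)[of y] interior_subset[of K] by blast+
    then show "y \<in> T ` interior P" by force
  qed
qed

lemma interior_K_nonempty: "interior K \<noteq> {}"
  using interior_nonempty by (simp add: interior_K)

lemma negligible_boundary: "negligible (K - interior K)"
proof -
  have "negligible (frontier P)" using convex by (rule negligible_convex_frontier)
  moreover have "frontier P \<subseteq> P" using closed by (simp add: frontier_subset_closed)
  moreover have "T differentiable_on P" using diffeo by (simp add: C1_diffeo_on_def)
  ultimately have "negligible (T ` frontier P)"
    by (intro negligible_differentiable_image_negligible) (auto intro: differentiable_on_subset)
  moreover have "K - interior K \<subseteq> T ` frontier P"
    unfolding interior_K frontier_def using closure_subset[of P] by blast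
  ultimately show ?thesis by (rule negligible_subset)
qed

lemma closure_interior_K: "K \<subseteq> closure (interior K)"
proof -
  have "closure (interior P) = P"
    using convex_closure_interior[OF convex interior_nonempty] closed by simp
  then have "T ` closure (interior P) \<subseteq> closure (T ` interior P)"
    using T_cont by (intro image_closure_subset closed_closure closure_subset) auto
  then show ?thesis using \<open>closure (interior P) = P\<close> by (simp add: interior_K)
qed

lemma integral_K: "(\<integral>y. f y \<partial>lebesgue_on K) = (\<integral>x. \<bar>det (Dp x)\<bar> * f (T x) \<partial>lebesgue_on P)"
  using change_of_variables(2)[OF P_sets T_has_derivative inj, of f] by simp

lemma piola_inverse:
  assumes w: "\<forall>x\<in>P. piola P T w x = u x" and x: "x \<in> P"
  shows "w (T x) = (1 / det (Dp x)) *\<^sub>R (Dp x *v u x)"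
proof -
  have "Dp x *v u x = Dp x *v (det (Dp x) *\<^sub>R (matrix_inv (Dp x) *v w (T x)))"
    using w x by (simp add: piola_def jac_eq)
  also have "\<dots> = det (Dp x) *\<^sub>R w (T x)"
    by (simp add: matrix_vector_mult_scaleR matrix_vector_mul_assoc matrix_inv_mult[OF det_nonzero[OF x]])
  finally show ?thesis using det_nonzero[OF x] by simp
qed

lemma piola_continuous:
  assumes w: "\<forall>x\<in>P. piola P T w x = u x" and u: "continuous_on UNIV u"
  shows "continuous_on K w"
proof -
  have c: "continuous_on K (\<lambda>y. det (Dp (Ti y)))" "continuous_on K (\<lambda>y. Dp (Ti y) *v u (Ti y))"
    using continuous_on_compose2[OF Dp_cont[of UNIV] Ti_cont] continuous_on_compose2[OF u Ti_cont]
    by (auto intro: continuous_on_det continuous_on_matrix_vector_mult)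
  have "continuous_on K (\<lambda>y. (1 / det (Dp (Ti y))) *\<^sub>R (Dp (Ti y) *v u (Ti y)))"
    using T_Ti(1) det_nonzero by (intro continuous_intros c) blast
  then show ?thesis
    by (rule continuous_on_eq) (auto simp: piola_inverse[OF w])
qed

text \<open>The gradient of the pulled-back \<open>\<psi>\<close> is
  \<open>transpose (Dp x) *v g (p x)\<close>. In the product with \<open>w\<close> the Jacobian
  cancels and only |det| / det = \<open>orient\<close> is left; the rest is the divergence theorem
  on the reference cell.\<close>

lemma green_formula:
  assumes u: "C1_field u Du" and w: "\<forall>x\<in>P. piola P T w x = u x"
    and \<psi>: "\<And>x. (\<psi> has_derivative (\<lambda>h. g x \<bullet> h)) (at x)" "continuous_on UNIV g"
  shows "(\<integral>y. w y \<bullet> g y \<partial>lebesgue_on K) =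
    orient * ((\<Sum>F | F facet_of P. \<integral>x. (u x \<bullet> nrm F) * \<psi> (T x) \<partial>flat_measure F) -
       (\<integral>x. trace (Du x) * \<psi> (T x) \<partial>lebesgue_on P))"
proof -
  define g2 where "g2 = (\<lambda>x. transpose (Dp x) *v g (p x))"
  have pd: "(p has_derivative (*v) (Dp x)) (at x)" for x using p by (simp add: C1_field_def)
  have pc: "continuous_on UNIV p" by (rule has_derivative_continuous_on, rule pd)
  have ud: "(u has_derivative (*v) (Du x)) (at x)" for x using u by (simp add: C1_field_def)
  have uc: "continuous_on UNIV u" by (rule has_derivative_continuous_on, rule ud)
  have Duc: "continuous_on UNIV Du" using u by (simp add: C1_field_def)
  have \<psi>c: "continuous_on UNIV \<psi>" by (rule has_derivative_continuous_on, rule \<psi>(1))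
  have d2: "((\<lambda>x. \<psi> (p x)) has_derivative (\<lambda>h. g2 x \<bullet> h)) (at x)" for x
    using has_derivative_compose[OF pd \<psi>(1)[of "p x"]] by (simp add: inner_matrix_transpose g2_def)
  have "continuous_on UNIV (\<lambda>x. transpose (Dp x))"
    unfolding transpose_def by (intro continuous_on_vec_lambda continuous_on_component Dp_cont)
  then have g2c: "continuous_on UNIV g2"
    unfolding g2_def by (intro continuous_on_matrix_vector_mult continuous_on_compose2[OF \<psi>(2) pc]) auto
  have i1: "integrable (lebesgue_on P) (\<lambda>x. trace (Du x) * \<psi> (p x))"
    unfolding trace_def
    by (intro integrable_continuous_compact compact continuous_intros continuous_on_subset[OF Duc]
        continuous_on_compose2[OF \<psi>c] continuous_on_subset[OF pc]) auto
  have i2: "integrable (lebesgue_on P) (\<lambda>x. u x \<bullet> g2 x)"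
    by (intro integrable_continuous_compact compact continuous_intros continuous_on_subset[OF uc] continuous_on_subset[OF g2c]) auto
  have pt: "\<bar>det (Dp x)\<bar> * (w (T x) \<bullet> g (T x)) = orient * (u x \<bullet> g2 x)" if x: "x \<in> P" for x
  proof -
    have "w (T x) \<bullet> g (T x) = (1 / det (Dp x)) * (g (p x) \<bullet> (Dp x *v u x))"
      by (simp add: piola_inverse[OF w x] Tp[OF x, symmetric] inner_commute[of "g (T x)"])
    also have "g (p x) \<bullet> (Dp x *v u x) = u x \<bullet> g2 x"
      by (subst inner_matrix_transpose) (simp only: g2_def inner_commute)
    finally show ?thesis using det_nonzero[OF x] orient(1)[OF x] by simp
  qed
  have "(\<integral>y. w y \<bullet> g y \<partial>lebesgue_on K) = (\<integral>x. orient * (u x \<bullet> g2 x) \<partial>lebesgue_on P)"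
    unfolding integral_K by (rule Bochner_Integration.integral_cong) (auto simp: pt)
  also have "\<dots> = orient * (\<integral>x. u x \<bullet> g2 x \<partial>lebesgue_on P)" by simp
  also have "(\<integral>x. u x \<bullet> g2 x \<partial>lebesgue_on P) =
      (\<integral>x. trace (Du x) * \<psi> (p x) + u x \<bullet> g2 x \<partial>lebesgue_on P) - (\<integral>x. trace (Du x) * \<psi> (p x) \<partial>lebesgue_on P)"
    using i1 i2 by simp
  also have "(\<integral>x. trace (Du x) * \<psi> (p x) + u x \<bullet> g2 x \<partial>lebesgue_on P) =
      (\<Sum>F | F facet_of P. \<integral>x. (u x \<bullet> nrm F) * \<psi> (p x) \<partial>flat_measure F)"
    by (rule divergence_theorem[OF u d2 g2c])
  also have "\<dots> = (\<Sum>F | F facet_of P. \<integral>x. (u x \<bullet> nrm F) * \<psi> (T x) \<partial>flat_measure F)"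
  proof (intro sum.cong refl Bochner_Integration.integral_cong, clarify)
    fix F x assume "F facet_of P" "x \<in> space (flat_measure F)"
    then have "x \<in> P" using facet_props(2) by auto
    then show "(u x \<bullet> nrm F) * \<psi> (p x) = (u x \<bullet> nrm F) * \<psi> (T x)" by (simp add: Tp)
  qed
  also have "(\<integral>x. trace (Du x) * \<psi> (p x) \<partial>lebesgue_on P) = (\<integral>x. trace (Du x) * \<psi> (T x) \<partial>lebesgue_on P)"
    by (intro Bochner_Integration.integral_cong) (auto simp: Tp)
  finally show ?thesis .
qed

end

section \<open>Weak divergence and continuous representative of a Piola-transformed field\<close>

lemma test_function_outside:
  assumes "\<phi> \<in> test_functions U" "x \<notin> U"
  shows "\<phi> x = 0"
  using assms closure_subset[of "{x. \<phi> x \<noteq> 0}"] unfolding test_functions_def by blast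

lemma square_integrable_continuous_compact:
  fixes g :: "real^'n \<Rightarrow> real"
  assumes "compact C" "continuous_on C g" "S \<subseteq> C" "S \<in> sets lebesgue"
  shows "square_integrable (lebesgue_on S) g"
  unfolding square_integrable_def
proof
  have Cs: "C \<in> sets lebesgue" using lmeasurable_compact[OF assms(1)] by (rule fmeasurableD)
  show "g \<in> borel_measurable (lebesgue_on S)"
    using continuous_on_subset[OF assms(2,3)] assms(4) by (rule continuous_imp_measurable_on_sets_lebesgue)
  have "integrable (lebesgue_on C) (\<lambda>x. (norm (g x))\<^sup>2)"
    by (intro integrable_continuous_compact assms continuous_intros)
  then show "integrable (lebesgue_on S) (\<lambda>x. (norm (g x))\<^sup>2)"
    by (rule integrable_lebesgue_on_subset) (fact assms Cs)+
qed

text \<open>Inside \<open>S\<close> the set of disagreement is open and null, hence empty;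
  continuity carries the equality to points in the closure of the interior.\<close>

lemma continuous_AE_eq:
  fixes f g :: "'a::euclidean_space \<Rightarrow> 'b::euclidean_space"
  assumes f: "continuous_on S f" and g: "continuous_on S g" and S: "S \<subseteq> closure (interior S)" "S \<in> sets lebesgue"
    and ae: "AE x in lebesgue_on S. f x = g x" and x: "x \<in> S"
  shows "f x = g x"
proof -
  define D where "D = {x \<in> interior S. f x - g x \<in> - {0}}"
  have c: "continuous_on S (\<lambda>x. f x - g x)" using f g by (rule continuous_on_diff)
  have "open D"
    unfolding D_def using continuous_open_preimage[of "interior S" "\<lambda>x. f x - g x" "- {0}"]
      continuous_on_subset[OF c interior_subset] by (simp add: vimage_def Int_def open_Compl)
  moreover have "negligible D"
  proof -
    have "AE x in lebesgue. x \<in> S \<longrightarrow> f x = g x"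
      using ae S(2) by (subst (asm) AE_restrict_space_iff) auto
    then have "AE x in lebesgue. x \<notin> D"
      by eventually_elim (use interior_subset D_def in auto)
    then have "D \<in> null_sets lebesgue"
      using \<open>open D\<close> by (subst completion.null_sets_iff_AE) auto
    then show ?thesis by (simp add: negligible_iff_null_sets)
  qed
  ultimately have "D = {}" using open_not_negligible by blast
  then have eq: "f y - g y = 0" if "y \<in> interior S" for y using that by (auto simp: D_def)
  have "continuous_on (S \<inter> closure (interior S)) (\<lambda>x. f x - g x)" using c continuous_on_subset by blast
  show ?thesis
  proof (rule ccontr)
    assume ne: "f x \<noteq> g x"
    have "openin (top_of_set S) {y \<in> S. f y - g y \<in> - {0}}"
      using continuous_openin_preimage_gen[OF c, of "- {0}"] by (simp add: vimage_def Int_def open_Compl)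
    then obtain U where U: "open U" "{y \<in> S. f y - g y \<in> - {0}} = S \<inter> U" by (auto simp: openin_open)
    have "x \<in> U" using ne x U(2) by auto
    then have "U \<inter> interior S \<noteq> {}" using U(1) S(1) x by (metis IntI closure_iff_nhds_not_empty subsetD order_refl inf_commute)
    then obtain y where "y \<in> U" "y \<in> interior S" by blast
    then show False using U(2) eq[of y] interior_subset[of S] by auto
  qed
qed

context solid_polytope
begin

text \<open>Test functions of the interior vanish on all facets, so only the volume terms of the
  divergence theorem survive. Together with uniqueness this identifies the reference divergence in
  the pressure space with \<open>trace (Du x)\<close>.\<close>

lemma has_weak_div_C1_field:
  assumes u: "C1_field u Du"
  shows "has_weak_div (interior P) u (\<lambda>x. trace (Du x))"
  unfolding has_weak_div_def
proof (intro conjI ballI)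
  have Duc: "continuous_on UNIV Du" using u by (simp add: C1_field_def)
  have uc: "continuous_on UNIV u"
    by (rule has_derivative_continuous_on[of UNIV u "\<lambda>x. (*v) (Du x)"]) (use u in \<open>simp add: C1_field_def\<close>)
  have tr: "continuous_on S (\<lambda>x. trace (Du x))" for S
    unfolding trace_def by (intro continuous_intros continuous_on_subset[OF Duc]) auto
  have Ps: "P \<in> sets lebesgue" using lmeasurable_compact[OF compact] by (rule fmeasurableD)
  show "square_integrable (lebesgue_on (interior P)) (\<lambda>x. trace (Du x))"
    by (rule square_integrable_continuous_compact[OF compact tr interior_subset]) simp
  fix \<phi> assume \<phi>: "\<phi> \<in> test_functions (interior P)"
  have \<phi>0: "\<phi> x = 0" if "F facet_of P" "x \<in> F" for F x
    by (rule test_function_outside[OF \<phi>]) (use that frontier_eq in \<open>auto simp: frontier_def\<close>)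
  have neg: "negligible (P - interior P \<union> (interior P - P))"
    using negligible_convex_frontier[OF convex] interior_subset[of P] closed
    by (simp add: frontier_def Diff_eq_empty_iff[THEN iffD2])
  have i1: "integrable (lebesgue_on P) (\<lambda>x. trace (Du x) * \<phi> x)"
    by (intro integrable_continuous_compact compact continuous_intros tr continuous_on_subset[OF test_function_C1(3)[OF \<phi>]]) auto
  have i2: "integrable (lebesgue_on P) (\<lambda>x. u x \<bullet> grad \<phi> x)"
    by (intro integrable_continuous_compact compact continuous_intros continuous_on_subset[OF uc]
        continuous_on_subset[OF test_function_C1(2)[OF \<phi>]]) auto
  have "(\<integral>x. trace (Du x) * \<phi> x + u x \<bullet> grad \<phi> x \<partial>lebesgue_on P) =
      (\<Sum>F | F facet_of P. \<integral>x. (u x \<bullet> nrm F) * \<phi> x \<partial>flat_measure F)"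
    by (rule divergence_theorem[OF u test_function_C1(1)[OF \<phi>] test_function_C1(2)[OF \<phi>]])
  also have "\<dots> = (\<Sum>F | F facet_of P. \<integral>x. 0 \<partial>flat_measure F)"
    by (intro sum.cong refl Bochner_Integration.integral_cong) (use \<phi>0 in simp)
  finally have "(\<integral>x. u x \<bullet> grad \<phi> x \<partial>lebesgue_on P) = - (\<integral>x. trace (Du x) * \<phi> x \<partial>lebesgue_on P)"
    using i1 i2 by simp
  moreover have "(\<integral>x. f x \<partial>lebesgue_on P) = (\<integral>x. f x \<partial>lebesgue_on (interior P))" for f :: "real^'n \<Rightarrow> real"
    by (rule integral_lebesgue_on_cong[OF Ps _ neg]) simp_all
  ultimately show "(\<integral>x. u x \<bullet> grad \<phi> x \<partial>lebesgue_on (interior P)) = - (\<integral>x. trace (Du x) * \<phi> x \<partial>lebesgue_on (interior P))"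
    by metis
qed

end

context param_cell
begin

lemma integral_interior_K:
  fixes f :: "real^'n \<Rightarrow> real"
  assumes "AE x in lebesgue_on K. f x = g x"
  shows "(\<integral>x. f x \<partial>lebesgue_on (interior K)) = (\<integral>x. g x \<partial>lebesgue_on K)"
proof (rule integral_lebesgue_on_cong)
  have "interior K - K \<union> (K - interior K) = K - interior K" using interior_subset by blast
  then show "negligible (interior K - K \<union> (K - interior K))" using negligible_boundary by simp
  show "AE x in lebesgue_on (interior K \<inter> K). f x = g x"
    by (rule AE_lebesgue_on_subset[OF assms]) (use K_sets in auto)
qed (use K_sets in auto)

text \<open>The Piola identity that div w is (div u) / det, read off from
  \<open>green_formula\<close> with the facet terms gone. Arguing weakly avoids differentiating the
  Jacobian of \<open>T\<close>.\<close>

lemma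
  assumes u: "C1_field u Du" and w: "\<forall>x\<in>P. piola P T w x = u x" and v: "AE x in lebesgue_on K. v x = w x"
  shows has_weak_div_piola: "has_weak_div (interior K) v (\<lambda>y. trace (Du (Ti y)) / det (Dp (Ti y)))"
    and continuous_div_piola: "continuous_on K (\<lambda>y. trace (Du (Ti y)) / det (Dp (Ti y)))"
proof -
  have Duc: "continuous_on UNIV Du" using u by (simp add: C1_field_def)
  have "continuous_on P (\<lambda>x. trace (Du x) / det (Dp x))"
    unfolding trace_def using det_nonzero
    by (intro continuous_intros continuous_on_subset[OF Duc] continuous_on_det Dp_cont) auto
  from continuous_on_compose2[OF this Ti_cont] show c: "continuous_on K (\<lambda>y. trace (Du (Ti y)) / det (Dp (Ti y)))"
    using T_Ti(1) by blast
  show "has_weak_div (interior K) v (\<lambda>y. trace (Du (Ti y)) / det (Dp (Ti y)))"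
    unfolding has_weak_div_def
  proof (intro conjI ballI)
    show "square_integrable (lebesgue_on (interior K)) (\<lambda>y. trace (Du (Ti y)) / det (Dp (Ti y)))"
      by (rule square_integrable_continuous_compact[OF compact_K c interior_subset]) simp
    fix \<phi> assume \<phi>: "\<phi> \<in> test_functions (interior K)"
    have \<phi>0: "\<phi> (T x) = 0" if "F facet_of P" "x \<in> F" for F x
    proof (rule test_function_outside[OF \<phi>])
      have "x \<in> P" "x \<notin> interior P" using that frontier_eq facet_props(2) by (auto simp: frontier_def)
      then show "T x \<notin> interior K" unfolding interior_K using inj interior_subset[of P] by (auto dest: inj_onD)
    qed
    have "(\<integral>x. v x \<bullet> grad \<phi> x \<partial>lebesgue_on (interior K)) = (\<integral>x. w x \<bullet> grad \<phi> x \<partial>lebesgue_on K)"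
      by (rule integral_interior_K) (use v in \<open>auto elim: eventually_mono\<close>)
    also have "\<dots> = orient * ((\<Sum>F | F facet_of P. \<integral>x. (u x \<bullet> nrm F) * \<phi> (T x) \<partial>flat_measure F) -
       (\<integral>x. trace (Du x) * \<phi> (T x) \<partial>lebesgue_on P))"
      by (rule green_formula[OF u w test_function_C1(1)[OF \<phi>] test_function_C1(2)[OF \<phi>]])
    also have "(\<Sum>F | F facet_of P. \<integral>x. (u x \<bullet> nrm F) * \<phi> (T x) \<partial>flat_measure F) = (\<Sum>F | F facet_of P. \<integral>x. 0 \<partial>flat_measure F)"
      by (intro sum.cong refl Bochner_Integration.integral_cong) (use \<phi>0 in simp)
    also have "orient * (\<dots> - (\<integral>x. trace (Du x) * \<phi> (T x) \<partial>lebesgue_on P)) =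
        - (\<integral>x. orient * (trace (Du x) * \<phi> (T x)) \<partial>lebesgue_on P)" by simp
    also have "(\<integral>x. orient * (trace (Du x) * \<phi> (T x)) \<partial>lebesgue_on P) =
        (\<integral>x. trace (Du (Ti x)) / det (Dp (Ti x)) * \<phi> x \<partial>lebesgue_on K)"
      unfolding integral_K by (rule Bochner_Integration.integral_cong) (use det_nonzero orient in auto)
    also have "\<dots> = (\<integral>x. trace (Du (Ti x)) / det (Dp (Ti x)) * \<phi> x \<partial>lebesgue_on (interior K))"
      by (rule integral_interior_K[symmetric]) simp
    finally show "(\<integral>x. v x \<bullet> grad \<phi> x \<partial>lebesgue_on (interior K)) =
        - (\<integral>x. trace (Du (Ti x)) / det (Dp (Ti x)) * \<phi> x \<partial>lebesgue_on (interior K))" .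
  qed
qed

text \<open>The chosen \<open>weak_div\<close> may be replaced by the computed one off a null set
  that contains the boundary of \<open>K\<close>. The volume factor then cancels det up to its
  sign.\<close>

lemma integral_weak_div_piola:
  assumes u: "C1_field u Du" and w: "\<forall>x\<in>P. piola P T w x = u x" and v: "AE x in lebesgue_on K. v x = w x"
  shows "(\<integral>y. q y * weak_div (interior K) v y \<partial>lebesgue_on K) = orient * (\<integral>x. q (T x) * trace (Du x) \<partial>lebesgue_on P)"
proof -
  note hw = has_weak_div_piola[OF u w v]
  have "has_weak_div (interior K) v (weak_div (interior K) v)"
    unfolding weak_div_def using hw by (rule someI[of "has_weak_div (interior K) v"])
  from has_weak_div_unique[OF open_interior this hw]
  have ae: "AE y in lebesgue_on (interior K). weak_div (interior K) v y = trace (Du (Ti y)) / det (Dp (Ti y))" .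
  have 1: "K - interior K \<union> (interior K - K) = K - interior K" "K \<inter> interior K = interior K" using interior_subset by blast+
  have "(\<integral>y. q y * weak_div (interior K) v y \<partial>lebesgue_on K) =
      (\<integral>y. q y * (trace (Du (Ti y)) / det (Dp (Ti y))) \<partial>lebesgue_on (interior K))"
  proof (rule integral_lebesgue_on_cong)
    show "AE y in lebesgue_on (K \<inter> interior K). q y * weak_div (interior K) v y = q y * (trace (Du (Ti y)) / det (Dp (Ti y)))"
      unfolding 1 using ae by eventually_elim simp
  qed (use K_sets 1 negligible_boundary in auto)
  also have "\<dots> = (\<integral>y. q y * (trace (Du (Ti y)) / det (Dp (Ti y))) \<partial>lebesgue_on K)"
    by (rule integral_interior_K) simp
  also have "\<dots> = (\<integral>x. orient * (q (T x) * trace (Du x)) \<partial>lebesgue_on P)"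
    unfolding integral_K by (rule Bochner_Integration.integral_cong) (use det_nonzero orient in auto)
  finally show ?thesis by simp
qed

text \<open>\<open>w\<close> is continuous on the closed cell and so is a candidate for the choice;
  by \<open>continuous_AE_eq\<close> all candidates agree at every point of the cell, including the
  boundary.\<close>

lemma cell_rep_piola:
  assumes w: "\<forall>x\<in>P. piola P T w x = u x" and u: "continuous_on UNIV u"
    and v: "AE x in lebesgue_on K. v x = w x" and y: "y \<in> K"
  shows "cell_rep K v y = w y"
proof -
  have wc: "continuous_on K w" using piola_continuous[OF w u] .
  have "continuous_on K w \<and> (AE x in lebesgue_on K. w x = v x)" using wc v by (auto elim: eventually_mono)
  then have c: "continuous_on K (cell_rep K v) \<and> (AE x in lebesgue_on K. cell_rep K v x = v x)"
    unfolding cell_rep_def by (rule someI[of "\<lambda>w. continuous_on K w \<and> (AE x in lebesgue_on K. w x = v x)"])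
  then have "AE x in lebesgue_on K. cell_rep K v x = v x" by blast
  with v have "AE x in lebesgue_on K. cell_rep K v x = w x" by eventually_elim simp
  then show ?thesis
    using continuous_AE_eq[OF _ wc closure_interior_K K_sets _ y] c by blast
qed

section \<open>The outward normal of a curved cell\<close>

lemma matrix_injective:
  fixes A :: "real^'n^'n"
  assumes "det A \<noteq> 0" "A *v a = A *v b"
  shows "a = b"
proof -
  have "matrix_inv A *v (A *v a) = matrix_inv A *v (A *v b)" using assms(2) by simp
  then show ?thesis by (simp add: matrix_vector_mul_assoc matrix_inv_mult(2)[OF assms(1)])
qed

text \<open>To first order \<open>T z - T x\<close> is \<open>Dp x *v (z - x)\<close>, and its
  product with \<open>\<nu>\<close> is \<open>nrm F \<bullet> (z - x)\<close>, which is not positive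
  on \<open>P\<close>. The remainder is controlled because the Jacobian is bounded below.\<close>

lemma outward_normal_cone:
  assumes F: "F facet_of P" and x: "x \<in> F" and \<nu>: "transpose (Dp x) *v \<nu> = nrm F" and e: "e > 0"
  shows "\<forall>\<^sub>F y in at (T x) within K. (\<nu> /\<^sub>R norm \<nu>) \<bullet> (y - T x) \<le> e * norm (y - T x)"
proof -
  have xP: "x \<in> P" using x facet_props(2)[OF F] by blast
  let ?J = "Dp x" and ?N = "\<nu> /\<^sub>R norm \<nu>"
  have \<nu>0: "\<nu> \<noteq> 0" using \<nu> nrm_nonzero[OF F] by auto
  then have N1: "norm ?N = 1" by simp
  have NJ: "?N \<bullet> (?J *v h) = (nrm F \<bullet> h) / norm \<nu>" for h
    unfolding inner_matrix_transpose[of ?N ?J h] matrix_vector_mult_scaleR \<nu> by (simp add: divide_inverse mult.commute)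
  have "inj ((*v) ?J)" using matrix_injective[OF det_nonzero[OF xP]] by (auto simp: inj_def)
  then obtain c where c: "c > 0" "\<And>h. c * norm h \<le> norm (?J *v h)"
    using linear_inj_bounded_below_pos[OF matrix_vector_mul_linear[of ?J]] by (metis mult.commute)
  \<comment> \<open>The bound c/2 keeps \<open>norm (T z - T x)\<close> at least c/2 times
    \<open>norm (z - x)\<close>; the bound e c/2 then makes the remainder at most
    \<open>e * norm (T z - T x)\<close>.\<close>
  define \<eta> where "\<eta> = min (c / 2) (e * c / 2)"
  have \<eta>: "\<eta> > 0" "\<eta> \<le> c / 2" "\<eta> \<le> e * c / 2" using c e by (auto simp: \<eta>_def)
  obtain d where d: "d > 0" "\<And>z. z \<in> P \<Longrightarrow> norm (z - x) < d \<Longrightarrow> norm (T z - T x - ?J *v (z - x)) \<le> \<eta> * norm (z - x)"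
    using T_has_derivative[OF xP] \<eta>(1) unfolding has_derivative_within_alt by metis
  obtain \<delta> where \<delta>: "\<delta> > 0" "\<And>y. y \<in> K \<Longrightarrow> dist y (T x) < \<delta> \<Longrightarrow> dist (Ti y) (Ti (T x)) < d"
    using Ti_cont d(1) xP unfolding continuous_on_iff by blast
  have "?N \<bullet> (y - T x) \<le> e * norm (y - T x)" if y: "y \<in> K" "dist y (T x) < \<delta>" for y
  proof -
    define z where "z = Ti y"
    have z: "z \<in> P" "T z = y" using T_Ti y by (auto simp: z_def)
    have "norm (z - x) < d" using \<delta>(2)[OF y] xP by (simp add: z_def dist_norm)
    from d(2)[OF z(1) this] have r: "norm (T z - T x - ?J *v (z - x)) \<le> \<eta> * norm (z - x)" .
    define r where "r = T z - T x - ?J *v (z - x)"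
    have split: "T z - T x = ?J *v (z - x) + r" by (simp add: r_def)
    have rn: "norm r \<le> \<eta> * norm (z - x)" using r by (simp add: r_def)
    have "norm (?J *v (z - x)) \<le> norm (T z - T x) + norm r"
      using norm_triangle_ineq4[of "T z - T x" r] by (simp add: r_def)
    moreover have "\<eta> * norm (z - x) \<le> c / 2 * norm (z - x)" using \<eta>(2) by (rule mult_right_mono) simp
    ultimately have low: "c / 2 * norm (z - x) \<le> norm (T z - T x)" using c(2)[of "z - x"] rn by linarith
    have "nrm F \<bullet> (z - x) \<le> 0"
      using facet_rep(2)[OF F z(1)] nrm_facet[OF F x] by (simp add: inner_diff_right)
    then have "?N \<bullet> (?J *v (z - x)) \<le> 0" unfolding NJ by (simp add: divide_nonpos_nonneg)
    moreover have "?N \<bullet> r \<le> norm r" using Cauchy_Schwarz_ineq2[of ?N r] N1 by simp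
    ultimately have "?N \<bullet> (T z - T x) \<le> norm r" unfolding split inner_add_right by linarith
    also have "\<dots> \<le> e * c / 2 * norm (z - x)"
      using rn mult_right_mono[OF \<eta>(3), of "norm (z - x)"] by simp
    also have "\<dots> = e * (c / 2 * norm (z - x))" by simp
    also have "\<dots> \<le> e * norm (T z - T x)" using low e by (intro mult_left_mono) auto
    finally show ?thesis using z(2) by simp
  qed
  then show ?thesis unfolding eventually_at using \<delta>(1) by blast
qed

text \<open>Near a relative interior point of \<open>F\<close> only the inequality of
  \<open>F\<close> is active, so every direction pointing strictly inward is admissible. The
  pull-back \<open>q\<close> of \<open>M\<close> is nonpositive on this open half-space and must be
  a nonnegative multiple of \<open>nrm F\<close>.\<close>

lemma outward_normal_unique:
  assumes F: "F facet_of P" and x: "x \<in> rel_interior F" and \<nu>: "transpose (Dp x) *v \<nu> = nrm F"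
    and M: "norm M = 1" "\<And>e. e > 0 \<Longrightarrow> \<forall>\<^sub>F y in at (T x) within K. M \<bullet> (y - T x) \<le> e * norm (y - T x)"
  shows "M = \<nu> /\<^sub>R norm \<nu>"
proof -
  have xF: "x \<in> F" using x rel_interior_subset by blast
  have xP: "x \<in> P" using xF facet_props(2)[OF F] by blast
  let ?J = "Dp x" and ?n = "nrm F"
  have nn: "?n \<bullet> ?n = 1" using facet_rep(1)[OF F] by (simp add: norm_eq_1)
  define q where "q = transpose ?J *v M"
  have qle: "q \<bullet> d \<le> 0" if d: "?n \<bullet> d < 0" for d
  proof (rule ccontr)
    assume "\<not> q \<bullet> d \<le> 0"
    then have pos: "q \<bullet> d > 0" by simp
    have d0: "d \<noteq> 0" using d by auto
    \<comment> \<open>Along \<open>d\<close> the remainder enters twice, through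
      \<open>M \<bullet> r\<close> and through the norm of \<open>T z - T x\<close>, hence the 2.
      The choice of \<open>e\<close> makes \<open>e * C < q \<bullet> d\<close>.\<close>
    define C where "C = norm (?J *v d) + 2 * norm d"
    have C: "C > 0" using d0 by (simp add: C_def add_nonneg_pos)
    define e where "e = min 1 ((q \<bullet> d) / (2 * C))"
    have e: "e > 0" "e \<le> 1" "e * C < q \<bullet> d"
    proof -
      show "e > 0" "e \<le> 1" using pos C by (auto simp: e_def)
      have "e * C \<le> (q \<bullet> d) / (2 * C) * C" using C by (intro mult_right_mono) (auto simp: e_def)
      then show "e * C < q \<bullet> d" using C pos by simp
    qed
    have ev1: "\<forall>\<^sub>F t in at_right 0. nrm F' \<bullet> (x + t *\<^sub>R d) \<le> off F'" if F': "F' facet_of P" for F'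
    proof (cases "F' = F")
      case True
      have "\<forall>\<^sub>F t in at_right (0::real). 0 < t" by (rule eventually_at_right_less)
      then show ?thesis
      proof eventually_elim
        case (elim t)
        then have "t * (?n \<bullet> d) \<le> 0" using d by (simp add: mult_nonneg_nonpos)
        then show ?case using True nrm_facet[OF F xF] by (simp add: inner_add_right)
      qed
    next
      case False
      have "((\<lambda>t. nrm F' \<bullet> (x + t *\<^sub>R d)) \<longlongrightarrow> nrm F' \<bullet> (x + 0 *\<^sub>R d)) (at_right 0)"
        by (intro tendsto_intros)
      moreover have "nrm F' \<bullet> (x + 0 *\<^sub>R d) < off F'" using rel_interior_strict[OF F F' _ x] False by auto
      ultimately have "\<forall>\<^sub>F t in at_right 0. nrm F' \<bullet> (x + t *\<^sub>R d) < off F'" by (rule order_tendstoD(2))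
      then show ?thesis by (rule eventually_mono) simp
    qed
    have ev2: "\<forall>\<^sub>F t in at_right 0. x + t *\<^sub>R d \<in> P"
    proof -
      have "\<forall>\<^sub>F t in at_right 0. \<forall>F'\<in>{F'. F' facet_of P}. nrm F' \<bullet> (x + t *\<^sub>R d) \<le> off F'"
        using ev1 by (intro eventually_ball_finite finite_facets) auto
      then show ?thesis by (rule eventually_mono) (simp add: mem_iff)
    qed
    obtain \<delta> where \<delta>: "\<delta> > 0" "\<And>y. y \<in> K \<Longrightarrow> y \<noteq> T x \<Longrightarrow> dist y (T x) < \<delta> \<Longrightarrow> M \<bullet> (y - T x) \<le> e * norm (y - T x)"
      using M(2)[OF e(1)] unfolding eventually_at by blast
    obtain d1 where d1: "d1 > 0" "\<And>z. z \<in> P \<Longrightarrow> dist z x < d1 \<Longrightarrow> dist (T z) (T x) < \<delta>"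
      using T_cont \<delta>(1) xP unfolding continuous_on_iff by blast
    obtain d2 where d2: "d2 > 0" "\<And>z. z \<in> P \<Longrightarrow> norm (z - x) < d2 \<Longrightarrow> norm (T z - T x - ?J *v (z - x)) \<le> e * norm (z - x)"
      using T_has_derivative[OF xP] e(1) unfolding has_derivative_within_alt by metis
    have "((\<lambda>t. norm (t *\<^sub>R d)) \<longlongrightarrow> norm (0 *\<^sub>R d)) (at_right 0)" by (intro tendsto_intros)
    then have "\<forall>\<^sub>F t in at_right 0. norm (t *\<^sub>R d) < min d1 d2"
      by (rule order_tendstoD(2)) (use d1 d2 in simp)
    moreover have "\<forall>\<^sub>F t in at_right (0::real). 0 < t" by (rule eventually_at_right_less)
    ultimately have "\<forall>\<^sub>F t in at_right 0. x + t *\<^sub>R d \<in> P \<and> norm (t *\<^sub>R d) < min d1 d2 \<and> 0 < t"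
      using ev2 by (simp add: eventually_conj_iff)
    then obtain t where t: "x + t *\<^sub>R d \<in> P" "norm (t *\<^sub>R d) < d1" "norm (t *\<^sub>R d) < d2" "0 < t"
      using eventually_happens'[OF trivial_limit_at_right_real] by fastforce
    define z where "z = x + t *\<^sub>R d"
    have "z \<noteq> x" using t(4) d0 by (simp add: z_def)
    then have "T z \<noteq> T x" using inj_onD[OF inj, of z x] xP t(1) by (auto simp: z_def)
    then have 1: "M \<bullet> (T z - T x) \<le> e * norm (T z - T x)"
      using t d1(2)[of z] by (intro \<delta>(2)) (auto simp: z_def dist_norm)
    define r where "r = T z - T x - ?J *v (t *\<^sub>R d)"
    have 2: "norm r \<le> e * (t * norm d)" using d2(2)[of z] t by (simp add: z_def r_def)
    have split: "T z - T x = t *\<^sub>R (?J *v d) + r" by (simp add: r_def matrix_vector_mult_scaleR)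
    have "norm (T z - T x) \<le> t * norm (?J *v d) + norm r"
      unfolding split using norm_triangle_ineq[of "t *\<^sub>R (?J *v d)" r] t(4) by simp
    then have 3: "e * norm (T z - T x) \<le> e * (t * norm (?J *v d) + norm r)" using e(1) by (intro mult_left_mono) auto
    have 4: "- norm r \<le> M \<bullet> r" using Cauchy_Schwarz_ineq2[of M r] M(1) by simp
    have 5: "e * norm r \<le> norm r" using e by (intro mult_left_le_one_le) auto
    have "t * (M \<bullet> (?J *v d)) = M \<bullet> (T z - T x) - M \<bullet> r" unfolding split by (simp add: inner_add_right)
    also have "\<dots> \<le> e * (t * norm (?J *v d)) + 2 * norm r"
      using 1 3 4 5 by (simp add: distrib_left)
    also have "\<dots> \<le> e * (t * norm (?J *v d)) + 2 * (e * (t * norm d))" using 2 by simp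
    also have "\<dots> = t * (e * C)" by (simp add: C_def algebra_simps)
    finally have "M \<bullet> (?J *v d) \<le> e * C" using t(4) by simp
    then show False using e(3) unfolding inner_matrix_transpose[of M] q_def by simp
  qed
  define h where "h = q - (q \<bullet> ?n) *\<^sub>R ?n"
  have nh: "?n \<bullet> h = 0" by (simp add: h_def inner_diff_right nn inner_commute)
  have qh: "q \<bullet> h = h \<bullet> h" using nh by (simp add: h_def inner_diff_left inner_diff_right inner_commute nn)
  have "h = 0"
  proof (rule ccontr)
    assume "h \<noteq> 0"
    then have hh: "h \<bullet> h > 0" by simp
    \<comment> \<open>The tangential direction \<open>h\<close> is tilted slightly inward to make
      \<open>qle\<close> applicable; this tilt costs at most half of
      \<open>h \<bullet> h\<close>.\<close>
    define \<kappa> where "\<kappa> = (h \<bullet> h) / (2 * (\<bar>q \<bullet> ?n\<bar> + 1))"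
    have \<kappa>: "\<kappa> > 0" using hh by (simp add: \<kappa>_def)
    have "q \<bullet> (h - \<kappa> *\<^sub>R ?n) \<le> 0" using \<kappa> by (intro qle) (simp add: inner_diff_right nh nn)
    then have "h \<bullet> h \<le> \<kappa> * (q \<bullet> ?n)" by (simp add: inner_diff_right qh)
    also have "\<dots> \<le> \<kappa> * (\<bar>q \<bullet> ?n\<bar> + 1)" using \<kappa> by (intro mult_left_mono) auto
    also have "\<dots> = (h \<bullet> h) / 2" by (simp add: \<kappa>_def field_simps)
    finally show False using hh by simp
  qed
  then have q: "q = (q \<bullet> ?n) *\<^sub>R ?n" by (simp add: h_def)
  have "q \<bullet> (- ?n) \<le> 0" by (rule qle) (simp add: nn)
  then have l0: "q \<bullet> ?n \<ge> 0" by simp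
  have "transpose ?J *v ((q \<bullet> ?n) *\<^sub>R \<nu>) = (q \<bullet> ?n) *\<^sub>R ?n"
    unfolding matrix_vector_mult_scaleR \<nu> ..
  then have "transpose ?J *v M = transpose ?J *v ((q \<bullet> ?n) *\<^sub>R \<nu>)"
    by (rule trans[OF trans[OF q_def[symmetric] q] sym])
  moreover have "det (transpose ?J) \<noteq> 0" by (subst det_transpose) (rule det_nonzero[OF xP])
  ultimately have Ml: "M = (q \<bullet> ?n) *\<^sub>R \<nu>" by (rule matrix_injective[rotated])
  have "\<nu> \<noteq> 0" using \<nu> nrm_nonzero[OF F] by auto
  moreover have "(q \<bullet> ?n) * norm \<nu> = 1" using arg_cong[OF Ml, of norm] M(1) l0 by simp
  ultimately have "q \<bullet> ?n = inverse (norm \<nu>)" by (simp add: field_simps)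
  then show ?thesis using Ml by simp
qed

lemma outward_normal_K:
  assumes F: "F facet_of P" and x: "x \<in> rel_interior F" and \<nu>: "transpose (Dp x) *v \<nu> = nrm F"
  shows "outward_normal K (T x) = \<nu> /\<^sub>R norm \<nu>"
  unfolding outward_normal_def
proof (rule the_equality)
  have "\<nu> \<noteq> 0" using \<nu> nrm_nonzero[OF F] by auto
  then show "norm (\<nu> /\<^sub>R norm \<nu>) = 1 \<and>
      (\<forall>e>0. \<forall>\<^sub>F y in at (T x) within K. (\<nu> /\<^sub>R norm \<nu>) \<bullet> (y - T x) \<le> e * norm (y - T x))"
    using outward_normal_cone[OF F _ \<nu>] x rel_interior_subset by (auto simp del: inner_scaleR_left)
qed (use outward_normal_unique[OF F x \<nu>] in blast)

end

section \<open>Surface integrals over curved facets\<close>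

lemma continuous_on_matrix_mult:
  fixes A :: "'a::topological_space \<Rightarrow> real^'n^'m" and B :: "'a \<Rightarrow> real^'k^'n"
  assumes "continuous_on S A" "continuous_on S B"
  shows "continuous_on S (\<lambda>x. A x ** B x)"
  unfolding matrix_matrix_mult_def
  by (intro continuous_on_vec_lambda continuous_on_sum continuous_on_mult continuous_on_component assms)

lemma continuous_on_transpose:
  fixes A :: "'a::topological_space \<Rightarrow> real^'n^'m"
  assumes "continuous_on S A"
  shows "continuous_on S (\<lambda>x. transpose (A x))"
  unfolding transpose_def by (intro continuous_on_vec_lambda continuous_on_component assms)

context param_cell
begin

lemma area_factor_normal:
  assumes F: "F facet_of P" and x: "x \<in> F"
  obtains \<nu> where "transpose (Dp x) *v \<nu> = nrm F" "\<nu> \<noteq> 0"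
    "area_factor F (jac P T x) = \<bar>det (Dp x)\<bar> * norm \<nu>"
proof -
  have xP: "x \<in> P" using x facet_props(2)[OF F] by blast
  have d: "det (transpose (Dp x)) \<noteq> 0" by (subst det_transpose) (rule det_nonzero[OF xP])
  define \<nu> where "\<nu> = matrix_inv (transpose (Dp x)) *v nrm F"
  have \<nu>: "transpose (Dp x) *v \<nu> = nrm F"
    unfolding \<nu>_def matrix_vector_mul_assoc matrix_inv_mult(1)[OF d] by simp
  moreover have "\<nu> \<noteq> 0" using \<nu> nrm_nonzero[OF F] by auto
  ultimately show ?thesis
    using that area_factor_eq[OF F det_nonzero[OF xP]] jac_eq[OF xP] by simp
qed

lemma area_factor_pos:
  assumes "F facet_of P" "x \<in> F"
  shows "area_factor F (jac P T x) > 0"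
proof -
  have "x \<in> P" using assms facet_props(2) by blast
  moreover obtain \<nu> where "transpose (Dp x) *v \<nu> = nrm F" "\<nu> \<noteq> 0"
    "area_factor F (jac P T x) = \<bar>det (Dp x)\<bar> * norm \<nu>"
    using area_factor_normal[OF assms] .
  ultimately show ?thesis using det_nonzero by simp
qed

lemma area_factor_continuous:
  assumes "F facet_of P"
  shows "continuous_on F (\<lambda>x. area_factor F (jac P T x))"
proof (rule continuous_on_eq)
  show "continuous_on F (\<lambda>x. area_factor F (Dp x))"
    unfolding area_factor_def Let_def
    by (intro continuous_on_real_sqrt continuous_on_det continuous_on_add continuous_on_matrix_mult
        continuous_on_transpose Dp_cont continuous_on_const)
  show "area_factor F (Dp x) = area_factor F (jac P T x)" if "x \<in> F" for x
    using that facet_props(2)[OF assms] jac_eq by auto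
qed

lemma T_measurable:
  assumes F: "F facet_of P"
  shows "T \<in> flat_measure F \<rightarrow>\<^sub>M restrict_space borel (T ` F)"
proof (rule measurable_restrict_space2)
  have "continuous_on F T" using T_cont facet_props(2)[OF F] continuous_on_subset by blast
  then show "T \<in> flat_measure F \<rightarrow>\<^sub>M borel"
    unfolding measurable_cong_sets[OF sets_flat_measure refl] by (rule borel_measurable_continuous_on_restrict)
qed simp

lemma area_measurable:
  assumes F: "F facet_of P"
  shows "(\<lambda>x. area_factor F (jac P T x)) \<in> borel_measurable (flat_measure F)"
  unfolding measurable_cong_sets[OF sets_flat_measure refl]
  by (rule borel_measurable_continuous_on_restrict[OF area_factor_continuous[OF F]])

lemma space_surface_measure [simp]: "space (surface_measure P T F) = T ` F"
  by (simp add: surface_measure_def space_restrict_space)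

lemma AE_surface_measure:
  assumes F: "F facet_of P" and A: "A \<in> sets (restrict_space borel (T ` F))"
    and ae: "AE x in flat_measure F. T x \<in> A"
  shows "AE y in surface_measure P T F. y \<in> A"
  unfolding surface_measure_def
proof (rule AE_completion, subst AE_distr_iff)
  show "T \<in> density (flat_measure F) (\<lambda>x. ennreal (area_factor F (jac P T x))) \<rightarrow>\<^sub>M restrict_space borel (T ` F)"
    using T_measurable[OF F] by simp
  show "{y \<in> space (restrict_space borel (T ` F)). y \<in> A} \<in> sets (restrict_space borel (T ` F))"
    using A sets.sets_into_space[OF A] by (simp add: Collect_conj_eq Int_absorb1 Int_def[symmetric])
  show "AE x in density (flat_measure F) (\<lambda>x. ennreal (area_factor F (jac P T x))). T x \<in> A"
    using ae area_measurable[OF F] by (subst AE_density) (auto elim: eventually_mono)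
qed

lemma measurable_surface_measure:
  fixes h :: "real^'n \<Rightarrow> real"
  shows "h \<in> borel_measurable (restrict_space borel (T ` F)) \<Longrightarrow> h \<in> borel_measurable (surface_measure P T F)"
  unfolding surface_measure_def by (intro measurable_completion) simp

lemma surface_measure_integral:
  fixes h :: "real^'n \<Rightarrow> real"
  assumes F: "F facet_of P" and h: "h \<in> borel_measurable (restrict_space borel (T ` F))"
  shows "integrable (surface_measure P T F) h \<longleftrightarrow> integrable (flat_measure F) (\<lambda>x. area_factor F (jac P T x) * h (T x))"
    and "(\<integral>y. h y \<partial>surface_measure P T F) = (\<integral>x. area_factor F (jac P T x) * h (T x) \<partial>flat_measure F)"
proof -
  let ?D = "density (flat_measure F) (\<lambda>x. ennreal (area_factor F (jac P T x)))"
  have T: "T \<in> ?D \<rightarrow>\<^sub>M restrict_space borel (T ` F)" using T_measurable[OF F] by simp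
  have hT: "(\<lambda>x. h (T x)) \<in> borel_measurable (flat_measure F)" using T_measurable[OF F] h by (rule measurable_compose)
  have pos: "AE x in flat_measure F. 0 \<le> area_factor F (jac P T x)"
    by (rule AE_I2) (use area_factor_pos[OF F] in \<open>auto intro: less_imp_le\<close>)
  have hm: "h \<in> borel_measurable (distr ?D (restrict_space borel (T ` F)) T)" using h by simp
  show "integrable (surface_measure P T F) h \<longleftrightarrow> integrable (flat_measure F) (\<lambda>x. area_factor F (jac P T x) * h (T x))"
    unfolding surface_measure_def integrable_completion[OF hm] integrable_distr_eq[OF T h]
    using integrable_density[OF hT area_measurable[OF F] pos] by simp
  show "(\<integral>y. h y \<partial>surface_measure P T F) = (\<integral>x. area_factor F (jac P T x) * h (T x) \<partial>flat_measure F)"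
    unfolding surface_measure_def integral_completion[OF hm] integral_distr[OF T h]
    using integral_density[OF hT area_measurable[OF F] pos] by simp
qed

lemma square_integrable_surface_measure:
  fixes h :: "real^'n \<Rightarrow> real"
  assumes F: "F facet_of P" and h: "h \<in> borel_measurable (restrict_space borel (T ` F))"
    and B: "\<And>y. y \<in> T ` F \<Longrightarrow> \<bar>h y\<bar> \<le> B"
  shows "square_integrable (surface_measure P T F) h"
  unfolding square_integrable_def
proof
  show "h \<in> borel_measurable (surface_measure P T F)" using h by (rule measurable_surface_measure)
  have h2: "(\<lambda>y. (norm (h y))\<^sup>2) \<in> borel_measurable (restrict_space borel (T ` F))" using h by measurable
  interpret finite_measure "flat_measure F" by (rule finite_measure_flat[OF F])
  have "compact ((\<lambda>x. area_factor F (jac P T x)) ` F)"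
    by (intro compact_continuous_image area_factor_continuous facet_props F)
  then obtain C where C: "\<And>x. x \<in> F \<Longrightarrow> \<bar>area_factor F (jac P T x)\<bar> \<le> C"
    using compact_imp_bounded[of "(\<lambda>x. area_factor F (jac P T x)) ` F"] by (auto simp: bounded_iff)
  have "integrable (flat_measure F) (\<lambda>x. area_factor F (jac P T x) * (norm (h (T x)))\<^sup>2)"
  proof (rule integrable_const_bound)
    show "(\<lambda>x. area_factor F (jac P T x) * (norm (h (T x)))\<^sup>2) \<in> borel_measurable (flat_measure F)"
      using area_measurable[OF F] measurable_compose[OF T_measurable[OF F] h2] by (rule borel_measurable_times)
    have "norm (area_factor F (jac P T x) * (norm (h (T x)))\<^sup>2) \<le> C * B\<^sup>2" if "x \<in> F" for x
    proof -
      have "\<bar>h (T x)\<bar>\<^sup>2 \<le> B\<^sup>2" using B[of "T x"] that by (intro power_mono) auto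
      moreover have "0 \<le> C" using C[OF that] by linarith
      ultimately show ?thesis
        using C[OF that] unfolding norm_mult by (intro mult_mono) auto
    qed
    then show "AE x in flat_measure F. norm (area_factor F (jac P T x) * (norm (h (T x)))\<^sup>2) \<le> C * B\<^sup>2"
      by (intro AE_I2) simp
  qed
  then show "integrable (surface_measure P T F) (\<lambda>y. (norm (h y))\<^sup>2)"
    using surface_measure_integral(1)[OF F h2] by simp
qed

text \<open>The normal component of \<open>w\<close> is
  \<open>(u x \<bullet> nrm F) / (det (Dp x) * norm \<nu>)\<close>, while the surface element
  contributes \<open>\<bar>det (Dp x)\<bar> * norm \<nu>\<close>; the quotient of the two factors is
  \<open>orient\<close>. The condition on \<open>h\<close> hides the points where the normal is not
  determined.\<close>

lemma surface_integral_piola: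
  assumes u: "continuous_on UNIV u" and w: "\<forall>x\<in>P. piola P T w x = u x"
    and v: "AE x in lebesgue_on K. v x = w x"
    and F: "F facet_of P" and h: "h \<in> borel_measurable (restrict_space borel (T ` F))"
    and h0: "\<And>x. x \<in> F - rel_interior F \<Longrightarrow> h (T x) = 0"
  shows "(\<integral>y. (cell_rep K v y \<bullet> outward_normal K y) * h y \<partial>surface_measure P T F) =
     orient * (\<integral>x. (u x \<bullet> nrm F) * h (T x) \<partial>flat_measure F)"
proof -
  have FP: "F \<subseteq> P" using facet_props(2)[OF F] .
  \<comment> \<open>A continuous stand-in for the normal component. It makes the integrand
    measurable and coincides with the original wherever \<open>h\<close> can be nonzero.\<close>
  define \<beta> where "\<beta> = (\<lambda>y. orient * (u (Ti y) \<bullet> nrm F) / area_factor F (jac P T (Ti y)))"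
  have eq: "(cell_rep K v y \<bullet> outward_normal K y) * h y = \<beta> y * h y" if y: "y \<in> T ` F" for y
  proof -
    obtain x where x: "x \<in> F" "y = T x" using y by blast
    then have xP: "x \<in> P" using FP by blast
    show ?thesis
    proof (cases "x \<in> rel_interior F")
      case False
      then show ?thesis using x h0[of x] by simp
    next
      case True
      obtain \<nu> where \<nu>: "transpose (Dp x) *v \<nu> = nrm F" "\<nu> \<noteq> 0"
        "area_factor F (jac P T x) = \<bar>det (Dp x)\<bar> * norm \<nu>"
        using area_factor_normal[OF F x(1)] .
      have n: "outward_normal K y = \<nu> /\<^sub>R norm \<nu>" using outward_normal_K[OF F True \<nu>(1)] x by simp
      have c: "cell_rep K v y = (1 / det (Dp x)) *\<^sub>R (Dp x *v u x)"
        using cell_rep_piola[OF w u v, of y] piola_inverse[OF w xP] x xP by simp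
      have "(Dp x *v u x) \<bullet> \<nu> = u x \<bullet> nrm F"
        by (metis \<nu>(1) inner_commute inner_matrix_transpose)
      then have "cell_rep K v y \<bullet> outward_normal K y = (u x \<bullet> nrm F) / (det (Dp x) * norm \<nu>)"
        unfolding n c by (simp add: field_simps)
      also have "\<dots> = \<beta> y"
      proof -
        have "orient \<noteq> 0" using orient(2) by auto
        then have "orient / \<bar>det (Dp x)\<bar> = 1 / det (Dp x)"
          using orient(1)[of x] xP det_nonzero[OF xP] by (simp add: field_simps)
        moreover have "\<beta> y = orient * (u x \<bullet> nrm F) / (\<bar>det (Dp x)\<bar> * norm \<nu>)"
          unfolding \<beta>_def x(2) Ti[OF xP] \<nu>(3) ..
        then have "\<beta> y = (orient / \<bar>det (Dp x)\<bar>) * ((u x \<bullet> nrm F) / norm \<nu>)"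
          by (simp only: times_divide_times_eq)
        ultimately have "\<beta> y = (1 / det (Dp x)) * ((u x \<bullet> nrm F) / norm \<nu>)" by (simp only:)
        then show ?thesis by simp
      qed
      finally show ?thesis by simp
    qed
  qed
  have Tc: "continuous_on (T ` F) Ti" using Ti_cont FP continuous_on_subset[of K Ti "T ` F"] by blast
  have TiF: "Ti ` T ` F = F" using FP by (force simp: image_image)
  have "continuous_on (T ` F) \<beta>"
    unfolding \<beta>_def
  proof (intro continuous_intros)
    show "continuous_on (T ` F) (\<lambda>y. u (Ti y))" using continuous_on_compose2[OF u Tc] by simp
    show "continuous_on (T ` F) (\<lambda>y. area_factor F (jac P T (Ti y)))"
      using continuous_on_compose2[OF area_factor_continuous[OF F] Tc] TiF by simp
    show "\<forall>y\<in>T ` F. area_factor F (jac P T (Ti y)) \<noteq> 0"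
      using area_factor_pos[OF F] TiF by (metis image_eqI less_irrefl)
  qed
  then have "\<beta> \<in> borel_measurable (restrict_space borel (T ` F))" by (rule borel_measurable_continuous_on_restrict)
  then have \<beta>h: "(\<lambda>y. \<beta> y * h y) \<in> borel_measurable (restrict_space borel (T ` F))" using h by measurable
  have "(\<integral>y. (cell_rep K v y \<bullet> outward_normal K y) * h y \<partial>surface_measure P T F) = (\<integral>y. \<beta> y * h y \<partial>surface_measure P T F)"
    by (rule Bochner_Integration.integral_cong[OF refl]) (simp add: eq)
  also have "\<dots> = (\<integral>x. area_factor F (jac P T x) * (\<beta> (T x) * h (T x)) \<partial>flat_measure F)"
    by (rule surface_measure_integral(2)[OF F \<beta>h])
  also have "\<dots> = (\<integral>x. orient * ((u x \<bullet> nrm F) * h (T x)) \<partial>flat_measure F)"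
  proof (rule Bochner_Integration.integral_cong[OF refl])
    fix x assume "x \<in> space (flat_measure F)"
    then have x: "x \<in> F" by simp
    then have "Ti (T x) = x" using FP by auto
    then show "area_factor F (jac P T x) * (\<beta> (T x) * h (T x)) = orient * ((u x \<bullet> nrm F) * h (T x))"
      using area_factor_pos[OF F x] by (simp add: \<beta>_def)
  qed
  finally show ?thesis by simp
qed

end

section \<open>Fields on a conforming mesh\<close>

lemma rel_interior_affine_image:
  fixes A :: "'a::euclidean_space \<Rightarrow> 'b::euclidean_space"
  assumes "linear A" "convex S"
  shows "rel_interior ((\<lambda>x. A x + c) ` S) = (\<lambda>x. A x + c) ` rel_interior S"
proof -
  have *: "(\<lambda>x. A x + c) ` X = (+) c ` A ` X" for X by (auto simp: image_image add.commute)
  show ?thesis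
    unfolding * rel_interior_translation rel_interior_convex_linear_image[OF assms, symmetric] ..
qed

lemma aff_dim_affine_image_le:
  fixes A :: "'a::euclidean_space \<Rightarrow> 'b::euclidean_space"
  assumes "linear A"
  shows "aff_dim ((\<lambda>x. A x + c) ` S) \<le> aff_dim S"
proof -
  have *: "(\<lambda>x. A x + c) ` S = (+) c ` A ` S" by (auto simp: image_image add.commute)
  show ?thesis unfolding * aff_dim_translation_eq by (rule aff_dim_linear_image_le[OF assms])
qed

context solid_polytope
begin

text \<open>A proper face that contains a facet has the same dimension, hence the same affine hull,
  and \<open>P\<close> meets that hull exactly in the facet.\<close>

lemma facet_maximal:
  assumes F: "F facet_of P" and f: "f face_of P" "f \<noteq> P" and sub: "F \<subseteq> f"
  shows "f = F"
proof -
  have "aff_dim f < aff_dim P" using face_of_aff_dim_lt[OF convex f] .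
  moreover have "aff_dim F = aff_dim P - 1" using F by (simp add: facet_of_def)
  moreover have "aff_dim F \<le> aff_dim f" using sub by (rule aff_dim_subset)
  ultimately have "aff_dim F = aff_dim f" by linarith
  then have "affine hull F = affine hull f" using aff_dim_eq_full_gen[OF sub] by simp
  then have "f \<subseteq> P \<inter> {x. nrm F \<bullet> x = off F}"
    using affine_hull_facet[OF F] face_of_imp_subset[OF f(1)] hull_subset[of f affine] by auto
  then show ?thesis using facet_rep(3)[OF F] sub by blast
qed

end

text \<open>The existential statements behind a member of \<open>V_h\<close> as fixed data: on the
  cell \<open>K\<close> the function \<open>v\<close> is represented by \<open>w K\<close>, whose
  Piola transform is \<open>u K\<close> with Jacobian \<open>Du K\<close>.\<close>

locale discrete_field = solid_polytope P for P :: "(real^'n) set" +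
  fixes \<Omega> :: "(real^'n) set" and mesh :: "(real^'n) set set"
    and T p :: "(real^'n) set \<Rightarrow> real^'n \<Rightarrow> real^'n" and Dp :: "(real^'n) set \<Rightarrow> real^'n \<Rightarrow> real^'n^'n"
    and v :: "real^'n \<Rightarrow> real^'n" and w u :: "(real^'n) set \<Rightarrow> real^'n \<Rightarrow> real^'n"
    and Du :: "(real^'n) set \<Rightarrow> real^'n \<Rightarrow> real^'n^'n"
  assumes finite_mesh: "finite mesh" and cover: "\<Union>mesh = closure \<Omega>" and open_domain: "open \<Omega>"
    and interior_cell_subset: "\<And>K. K \<in> mesh \<Longrightarrow> interior K \<subseteq> \<Omega>"
    and T_image: "\<And>K. K \<in> mesh \<Longrightarrow> T K ` P = K"
    and cell: "\<And>K. K \<in> mesh \<Longrightarrow> param_cell P (T K) (p K) (Dp K)"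
    and interiors_disjoint: "\<And>K L. K \<in> mesh \<Longrightarrow> L \<in> mesh \<Longrightarrow> K \<noteq> L \<Longrightarrow> interior K \<inter> interior L = {}"
    and common_face: "\<And>K L. K \<in> mesh \<Longrightarrow> L \<in> mesh \<Longrightarrow> K \<noteq> L \<Longrightarrow>
      \<exists>f g A c. f face_of P \<and> g face_of P \<and> linear A \<and> (\<lambda>x. A x + c) ` g = f \<and>
           K \<inter> L = T K ` f \<and> (\<forall>x\<in>g. T L x = T K (A x + c))"
    and u: "\<And>K. K \<in> mesh \<Longrightarrow> C1_field (u K) (Du K)"
    and w: "\<And>K. K \<in> mesh \<Longrightarrow> \<forall>x\<in>P. piola P (T K) (w K) x = u K x"
    and v: "\<And>K. K \<in> mesh \<Longrightarrow> AE x in lebesgue_on K. v x = w K x"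
begin

definition orientation :: "(real^'n) set \<Rightarrow> real" where
  "orientation K = param_cell.orient P (Dp K)"

lemma orientation_sq: "K \<in> mesh \<Longrightarrow> orientation K * orientation K = 1"
  unfolding orientation_def by (rule param_cell.orient(2)[OF cell])

lemma inj_T: "K \<in> mesh \<Longrightarrow> inj_on (T K) P"
  by (rule param_cell.inj[OF cell])

lemma u_cont: "K \<in> mesh \<Longrightarrow> continuous_on S (u K)"
proof -
  assume "K \<in> mesh"
  then have "\<And>x. (u K has_derivative (*v) (Du K x)) (at x)" using u by (simp add: C1_field_def)
  then have "continuous_on UNIV (u K)" by (intro has_derivative_continuous_on)
  then show ?thesis using continuous_on_subset by blast
qed

lemma compact_cell: "K \<in> mesh \<Longrightarrow> compact K"
  using param_cell.compact_K[OF cell] T_image by metis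

lemma cell_sets: "K \<in> mesh \<Longrightarrow> K \<in> sets lebesgue"
  using lmeasurable_compact[OF compact_cell] by (rule fmeasurableD)

lemma bounded_domain: "bounded \<Omega>"
proof -
  have "compact (closure \<Omega>)" unfolding cover[symmetric] using finite_mesh compact_cell by (rule compact_Union)
  then show ?thesis using compact_imp_bounded bounded_subset closure_subset by blast
qed

lemma sum_interior_indicator:
  fixes g :: "(real^'n) set \<Rightarrow> real^'n \<Rightarrow> real"
  assumes "K \<in> mesh" "x \<in> interior K"
  shows "(\<Sum>L\<in>mesh. indicator (interior L) x * g L x) = g K x"
proof -
  have "(\<Sum>L\<in>mesh. indicator (interior L) x * g L x) = (\<Sum>L\<in>mesh. if L = K then g K x else 0)"
    by (rule sum.cong) (use assms interiors_disjoint[OF assms(1)] in \<open>auto simp: indicator_def\<close>)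
  then show ?thesis using assms finite_mesh by simp
qed

text \<open>Off the null set of cell boundaries, every point of the domain lies in the interior of
  exactly one cell.\<close>

lemma integral_domain:
  fixes f :: "real^'n \<Rightarrow> real" and g :: "(real^'n) set \<Rightarrow> real^'n \<Rightarrow> real"
  assumes g: "\<And>K. K \<in> mesh \<Longrightarrow> continuous_on K (g K)"
    and f: "\<And>K. K \<in> mesh \<Longrightarrow> AE x in lebesgue_on K. f x = g K x"
  shows "(\<integral>x. f x \<partial>lebesgue_on \<Omega>) = (\<Sum>K\<in>mesh. \<integral>x. g K x \<partial>lebesgue_on K)"
proof -
  have \<Omega>: "\<Omega> \<in> sets lebesgue" using open_domain by auto
  have "AE x in lebesgue. \<forall>K\<in>mesh. x \<in> K \<longrightarrow> f x = g K x"
  proof (rule AE_finite_allI[OF finite_mesh])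
    fix K assume K: "K \<in> mesh"
    show "AE x in lebesgue. x \<in> K \<longrightarrow> f x = g K x"
      using f[OF K] cell_sets[OF K] by (subst (asm) AE_restrict_space_iff) auto
  qed
  moreover have "AE x in lebesgue. \<forall>K\<in>mesh. x \<notin> K - interior K"
  proof (rule AE_finite_allI[OF finite_mesh])
    fix K assume "K \<in> mesh"
    then have "negligible (K - interior K)" using param_cell.negligible_boundary[OF cell] T_image by metis
    then show "AE x in lebesgue. x \<notin> K - interior K" by (intro AE_not_in) (simp add: negligible_iff_null_sets)
  qed
  ultimately have "AE x in lebesgue. x \<in> \<Omega> \<longrightarrow> f x = (\<Sum>K\<in>mesh. indicator (interior K) x * g K x)"
  proof eventually_elim
    case (elim x)
    show ?case
    proof
      assume "x \<in> \<Omega>"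
      then have "x \<in> \<Union>mesh" unfolding cover using closure_subset by blast
      then obtain K where K: "K \<in> mesh" "x \<in> K" by blast
      then have "x \<in> interior K" using elim(2) by blast
      from sum_interior_indicator[OF K(1) this, of g] show "f x = (\<Sum>K\<in>mesh. indicator (interior K) x * g K x)"
        using elim(1) K by simp
    qed
  qed
  then have "AE x in lebesgue_on (\<Omega> \<inter> \<Omega>). f x = (\<Sum>K\<in>mesh. indicator (interior K) x * g K x)"
    using \<Omega> by (subst AE_restrict_space_iff) auto
  then have "(\<integral>x. f x \<partial>lebesgue_on \<Omega>) = (\<integral>x. (\<Sum>K\<in>mesh. indicator (interior K) x * g K x) \<partial>lebesgue_on \<Omega>)"
    by (intro integral_lebesgue_on_cong \<Omega>) simp_all
  also have "\<dots> = (\<Sum>K\<in>mesh. \<integral>x. indicator (interior K) x * g K x \<partial>lebesgue_on \<Omega>)"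
  proof (rule Bochner_Integration.integral_sum)
    fix K assume K: "K \<in> mesh"
    have "integrable (lebesgue_on (interior K)) (g K)"
      by (rule integrable_lebesgue_on_subset[OF integrable_continuous_compact[OF compact_cell g]])
        (use K interior_subset cell_sets in auto)
    then have "integrable lebesgue (\<lambda>x. indicator (interior K) x *\<^sub>R g K x)"
      by (subst (asm) integrable_restrict_space) auto
    moreover have "indicator (interior K) x *\<^sub>R g K x = indicator \<Omega> x *\<^sub>R (indicator (interior K) x * g K x)" for x
      using interior_cell_subset[OF K] by (auto simp: indicator_def)
    ultimately show "integrable (lebesgue_on \<Omega>) (\<lambda>x. indicator (interior K) x * g K x)"
      using \<Omega> by (subst integrable_restrict_space) (auto simp only: sets.Int_space_eq2 Int_iff)
  qed
  also have "\<dots> = (\<Sum>K\<in>mesh. \<integral>x. g K x \<partial>lebesgue_on K)"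
  proof (rule sum.cong[OF refl])
    fix K assume K: "K \<in> mesh"
    have "(\<integral>x. indicator (interior K) x * g K x \<partial>lebesgue_on \<Omega>) = (\<integral>x. indicator \<Omega> x *\<^sub>R (indicator (interior K) x * g K x) \<partial>lebesgue)"
      using \<Omega> by (intro integral_restrict_space) simp
    also have "\<dots> = (\<integral>x. indicator (interior K) x *\<^sub>R g K x \<partial>lebesgue)"
      by (rule Bochner_Integration.integral_cong) (use interior_cell_subset[OF K] in \<open>auto simp: indicator_def\<close>)
    also have "\<dots> = (\<integral>x. g K x \<partial>lebesgue_on (interior K))"
      by (intro integral_restrict_space[symmetric]) simp
    also have "\<dots> = (\<integral>x. g K x \<partial>lebesgue_on K)"
      using param_cell.integral_interior_K[OF cell[OF K], of "g K" "g K"] T_image[OF K] by simp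
    finally show "(\<integral>x. indicator (interior K) x * g K x \<partial>lebesgue_on \<Omega>) = (\<integral>x. g K x \<partial>lebesgue_on K)" .
  qed
  finally show ?thesis .
qed

lemma integral_gradient:
  assumes \<psi>: "\<psi> \<in> test_functions U"
  shows "(\<integral>x. v x \<bullet> grad \<psi> x \<partial>lebesgue_on \<Omega>) =
    (\<Sum>K\<in>mesh. orientation K * ((\<Sum>F | F facet_of P. \<integral>x. (u K x \<bullet> nrm F) * \<psi> (T K x) \<partial>flat_measure F) -
       (\<integral>x. trace (Du K x) * \<psi> (T K x) \<partial>lebesgue_on P)))"
proof -
  have "(\<integral>x. v x \<bullet> grad \<psi> x \<partial>lebesgue_on \<Omega>) = (\<Sum>K\<in>mesh. \<integral>x. w K x \<bullet> grad \<psi> x \<partial>lebesgue_on K)"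
  proof (rule integral_domain)
    fix K assume K: "K \<in> mesh"
    have "continuous_on K (w K)"
      using param_cell.piola_continuous[OF cell[OF K] w[OF K] u_cont[OF K]] T_image[OF K] by simp
    then show "continuous_on K (\<lambda>x. w K x \<bullet> grad \<psi> x)"
      by (intro continuous_intros continuous_on_subset[OF test_function_C1(2)[OF \<psi>]]) auto
    show "AE x in lebesgue_on K. v x \<bullet> grad \<psi> x = w K x \<bullet> grad \<psi> x"
      using v[OF K] by eventually_elim simp
  qed
  also have "\<dots> = (\<Sum>K\<in>mesh. orientation K * ((\<Sum>F | F facet_of P. \<integral>x. (u K x \<bullet> nrm F) * \<psi> (T K x) \<partial>flat_measure F) -
       (\<integral>x. trace (Du K x) * \<psi> (T K x) \<partial>lebesgue_on P)))"
  proof (rule sum.cong[OF refl])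
    fix K assume K: "K \<in> mesh"
    show "(\<integral>x. w K x \<bullet> grad \<psi> x \<partial>lebesgue_on K) = orientation K *
       ((\<Sum>F | F facet_of P. \<integral>x. (u K x \<bullet> nrm F) * \<psi> (T K x) \<partial>flat_measure F) -
       (\<integral>x. trace (Du K x) * \<psi> (T K x) \<partial>lebesgue_on P))"
      using param_cell.green_formula[OF cell[OF K] u[OF K] w[OF K] test_function_C1(1)[OF \<psi>] test_function_C1(2)[OF \<psi>]]
      by (simp add: T_image[OF K] orientation_def)
  qed
  finally show ?thesis .
qed

text \<open>Interiors are used because they are disjoint, so that one summand at most is active. The
  orientation cancels the one that \<open>integral_weak_div_piola\<close> produces, which makes
  every cell contribution a square.\<close>

definition div_pressure :: "real^'n \<Rightarrow> real" where
  "div_pressure x = (\<Sum>K\<in>mesh. indicator (interior K) x * (orientation K * trace (Du K (inv_into P (T K) x))))"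

lemma trace_cont: "K \<in> mesh \<Longrightarrow> continuous_on S (\<lambda>x. trace (Du K x))"
proof -
  assume "K \<in> mesh"
  then have "continuous_on UNIV (Du K)" using u by (simp add: C1_field_def)
  then have "continuous_on S (Du K)" by (rule continuous_on_subset) simp
  then show ?thesis unfolding trace_def by (intro continuous_on_sum continuous_on_component)
qed

lemma trace_inv_cont:
  assumes K: "K \<in> mesh"
  shows "continuous_on K (\<lambda>x. orientation K * trace (Du K (inv_into P (T K) x)))"
proof -
  have "continuous_on K (inv_into P (T K))"
    using param_cell.Ti_cont[OF cell[OF K]] T_image[OF K] by simp
  then have "continuous_on K (\<lambda>x. trace (Du K (inv_into P (T K) x)))"
    by (rule continuous_on_compose2[OF trace_cont[OF K, of UNIV]]) simp
  then show ?thesis by (rule continuous_on_mult_left)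
qed

lemma square_integrable_div_pressure: "square_integrable (lebesgue_on \<Omega>) div_pressure"
  unfolding square_integrable_def
proof
  define h where "h = (\<lambda>K x. indicator (interior K) x * (orientation K * trace (Du K (inv_into P (T K) x))))"
  have hm: "h K \<in> borel_measurable borel" if "K \<in> mesh" for K
    using borel_measurable_continuous_on_indicator[of "interior K", OF _ continuous_on_subset[OF trace_inv_cont[OF that] interior_subset]]
    by (simp add: h_def)
  have dp: "div_pressure = (\<lambda>x. \<Sum>K\<in>mesh. h K x)" by (simp add: fun_eq_iff div_pressure_def h_def)
  have "div_pressure \<in> borel_measurable borel" unfolding dp using hm by (rule borel_measurable_sum)
  then show m: "div_pressure \<in> borel_measurable (lebesgue_on \<Omega>)"
    by (intro measurable_restrict_space1 measurable_completion) simp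
  have "\<exists>B. \<forall>x. \<bar>h K x\<bar> \<le> B" if K: "K \<in> mesh" for K
  proof -
    have "compact ((\<lambda>x. orientation K * trace (Du K (inv_into P (T K) x))) ` K)"
      by (intro compact_continuous_image trace_inv_cont compact_cell K)
    then obtain B where B: "\<And>x. x \<in> K \<Longrightarrow> \<bar>orientation K * trace (Du K (inv_into P (T K) x))\<bar> \<le> B"
      using compact_imp_bounded[of "(\<lambda>x. orientation K * trace (Du K (inv_into P (T K) x))) ` K"]
      by (auto simp: bounded_iff)
    have "\<bar>h K x\<bar> \<le> max B 0" for x
    proof (cases "x \<in> interior K")
      case True
      then have "x \<in> K" using interior_subset by blast
      from B[OF this] True show ?thesis by (simp add: h_def)
    qed (simp add: h_def)
    then show ?thesis by blast
  qed
  then obtain B where B: "\<And>K x. K \<in> mesh \<Longrightarrow> \<bar>h K x\<bar> \<le> B K" by metis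
  have bd: "\<bar>div_pressure x\<bar> \<le> (\<Sum>K\<in>mesh. B K)" for x
    unfolding dp by (rule order_trans[OF sum_abs sum_mono[OF B]])
  have "emeasure lborel \<Omega> < \<infinity>" using bounded_domain by (rule emeasure_bounded_finite)
  then have "finite_measure (lebesgue_on \<Omega>)"
    using open_domain by (intro finite_measureI) (simp add: emeasure_restrict_space)
  then interpret finite_measure "lebesgue_on \<Omega>" .
  show "integrable (lebesgue_on \<Omega>) (\<lambda>x. (norm (div_pressure x))\<^sup>2)"
  proof (rule integrable_const_bound)
    have "norm ((norm (div_pressure x))\<^sup>2) \<le> (\<Sum>K\<in>mesh. B K)\<^sup>2" for x
      using power_mono[OF bd[of x] abs_ge_zero, of 2] by simp
    then show "AE x in lebesgue_on \<Omega>. norm ((norm (div_pressure x))\<^sup>2) \<le> (\<Sum>K\<in>mesh. B K)\<^sup>2"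
      by (intro AE_I2)
    show "(\<lambda>x. (norm (div_pressure x))\<^sup>2) \<in> borel_measurable (lebesgue_on \<Omega>)" using m by measurable
  qed
qed

text \<open>The element \<open>q\<close> of the pressure space equals the classical divergence only
  up to a null set, so that null set has to be transported by the differentiable map
  \<open>T K\<close>.\<close>

lemma AE_div_pressure:
  assumes K: "K \<in> mesh" and q: "AE x in lebesgue_on (interior P). q x = trace (Du K x)"
  shows "AE x in lebesgue_on K. div_pressure x = orientation K * q (inv_into P (T K) x)"
proof -
  interpret C: param_cell P "T K" "p K" "Dp K" by (rule cell[OF K])
  define N where "N = {x \<in> interior P. q x \<noteq> trace (Du K x)}"
  have "AE x in lebesgue. x \<in> interior P \<longrightarrow> q x = trace (Du K x)"
    using q by (subst (asm) AE_restrict_space_iff) auto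
  then have "AE x in lebesgue. x \<notin> N" by eventually_elim (simp add: N_def)
  then have "negligible N" by (simp add: negligible_iff_null_sets completion.null_sets_iff_AE)
  moreover have "T K differentiable_on N"
    using C.diffeo interior_subset[of P] unfolding C1_diffeo_on_def
    by (auto intro: differentiable_on_subset simp: N_def)
  ultimately have "negligible (T K ` N)" by (intro negligible_differentiable_image_negligible) auto
  then have "negligible (T K ` N \<union> (K - interior K))"
    using C.negligible_boundary T_image[OF K] by simp
  then have "AE x in lebesgue. x \<notin> T K ` N \<union> (K - interior K)"
    by (intro AE_not_in) (simp only: negligible_iff_null_sets)
  then have "AE x in lebesgue. x \<in> K \<longrightarrow> div_pressure x = orientation K * q (inv_into P (T K) x)"
  proof eventually_elim
    case (elim x)
    show ?case
    proof
      assume "x \<in> K"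
      then have int: "x \<in> interior K" using elim by blast
      then have "x \<in> T K ` interior P" using C.interior_K T_image[OF K] by simp
      then obtain z where z: "z \<in> interior P" "x = T K z" by blast
      have "inv_into P (T K) x = z" using z interior_subset[of P] C.Ti by blast
      moreover have "q z = trace (Du K z)" using z elim by (auto simp: N_def)
      moreover have "div_pressure x = orientation K * trace (Du K (inv_into P (T K) x))"
        unfolding div_pressure_def by (rule sum_interior_indicator[OF K int])
      ultimately show "div_pressure x = orientation K * q (inv_into P (T K) x)" by simp
    qed
  qed
  then show ?thesis using cell_sets[OF K] by (subst AE_restrict_space_iff) auto
qed

text \<open>For this pressure \<open>b_h\<close> is minus the sum over all cells of the integrals of
  \<open>(trace (Du K x))\<^sup>2\<close>. A vanishing sum of nonnegative terms has only vanishing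
  terms.\<close>

lemma divergence_free_on_cells:
  assumes b: "b_h P mesh T v (div_pressure, \<lambda>_. 0) = 0" and K: "K \<in> mesh"
  shows "AE x in lebesgue_on P. trace (Du K x) = 0"
proof -
  have Ps: "P \<in> sets lebesgue" using lmeasurable_compact[OF compact] by (rule fmeasurableD)
  have cellint: "(\<integral>x. div_pressure x * weak_div (interior K) v x \<partial>lebesgue_on K) = (\<integral>x. (trace (Du K x))\<^sup>2 \<partial>lebesgue_on P)"
    if K: "K \<in> mesh" for K
  proof -
    interpret C: param_cell P "T K" "p K" "Dp K" by (rule cell[OF K])
    have "(\<integral>x. div_pressure x * weak_div (interior K) v x \<partial>lebesgue_on K) =
        orientation K * (\<integral>x. div_pressure (T K x) * trace (Du K x) \<partial>lebesgue_on P)"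
      using C.integral_weak_div_piola[OF u[OF K] w[OF K], of v div_pressure, unfolded T_image[OF K], OF v[OF K]]
      by (simp add: orientation_def)
    also have "(\<integral>x. div_pressure (T K x) * trace (Du K x) \<partial>lebesgue_on P) =
        (\<integral>x. orientation K * (trace (Du K x))\<^sup>2 \<partial>lebesgue_on P)"
    proof (rule integral_lebesgue_on_cong[OF Ps Ps])
      have "AE x in lebesgue. x \<notin> frontier P"
        using negligible_convex_frontier[OF convex] by (intro AE_not_in) (simp add: negligible_iff_null_sets)
      then have "AE x in lebesgue. x \<in> P \<longrightarrow> div_pressure (T K x) * trace (Du K x) = orientation K * (trace (Du K x))\<^sup>2"
      proof eventually_elim
        case (elim x)
        show ?case
        proof
          assume x: "x \<in> P"
          then have "x \<in> interior P" using elim closure_subset[of P] by (auto simp: frontier_def)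
          then have "T K x \<in> interior (T K ` P)" unfolding C.interior_K by (rule imageI)
          then have int: "T K x \<in> interior K" by (simp only: T_image[OF K])
          have "div_pressure (T K x) = orientation K * trace (Du K (inv_into P (T K) (T K x)))"
            unfolding div_pressure_def by (rule sum_interior_indicator[OF K int])
          then show "div_pressure (T K x) * trace (Du K x) = orientation K * (trace (Du K x))\<^sup>2"
            using x by (simp add: power2_eq_square)
        qed
      qed
      then show "AE x in lebesgue_on (P \<inter> P). div_pressure (T K x) * trace (Du K x) = orientation K * (trace (Du K x))\<^sup>2"
        using Ps by (subst AE_restrict_space_iff) auto
    qed simp
    also have "orientation K * \<dots> = (\<integral>x. (trace (Du K x))\<^sup>2 \<partial>lebesgue_on P)"
      using orientation_sq[OF K] by (simp add: mult.assoc[symmetric])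
    finally show ?thesis .
  qed
  have "(\<Sum>K\<in>mesh. \<integral>x. div_pressure x * weak_div (interior K) v x \<partial>lebesgue_on K) = 0"
    using b by (simp add: b_h_def)
  then have "(\<Sum>K\<in>mesh. \<integral>x. (trace (Du K x))\<^sup>2 \<partial>lebesgue_on P) = 0" using cellint by simp
  then have "(\<integral>x. (trace (Du K x))\<^sup>2 \<partial>lebesgue_on P) = 0"
    using K finite_mesh by (subst (asm) sum_nonneg_eq_0_iff) auto
  moreover have "integrable (lebesgue_on P) (\<lambda>x. (trace (Du K x))\<^sup>2)"
    by (intro integrable_continuous_compact compact continuous_intros trace_cont K)
  ultimately have "AE x in lebesgue_on P. (trace (Du K x))\<^sup>2 = 0"
    by (subst (asm) integral_nonneg_eq_0_iff_AE) auto
  then show ?thesis by simp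
qed

section \<open>Matching of mesh facets and cancellation of their fluxes\<close>

lemma image_T_eq_iff: "K \<in> mesh \<Longrightarrow> A \<subseteq> P \<Longrightarrow> B \<subseteq> P \<Longrightarrow> T K ` A = T K ` B \<longleftrightarrow> A = B"
  using inj_on_image_eq_iff[OF inj_T] .

lemma cell_not_subset: "K \<in> mesh \<Longrightarrow> L \<in> mesh \<Longrightarrow> K \<noteq> L \<Longrightarrow> \<not> K \<subseteq> L"
proof
  assume K: "K \<in> mesh" "L \<in> mesh" "K \<noteq> L" and "K \<subseteq> L"
  then have "interior K \<subseteq> interior L" by (intro interior_mono)
  then have "interior K = {}" using interiors_disjoint[OF K] by blast
  moreover have "interior K \<noteq> {}" using param_cell.interior_K_nonempty[OF cell[OF K(1)]] T_image[OF K(1)] by simp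
  ultimately show False by simp
qed

text \<open>Pulled back to \<open>K\<close>, the common part of the cells is a face \<open>g\<close>
  that meets the relative interior of \<open>F\<close>, hence contains \<open>F\<close>; it is
  proper because cells are not nested, so it is \<open>F\<close>. Conformity is applied in both
  orders: the two affine maps bound the dimensions against each other, so the matching face in
  \<open>L\<close> is a facet too.\<close>

lemma common_facet:
  assumes K: "K \<in> mesh" and L: "L \<in> mesh" "L \<noteq> K" and F: "F facet_of P"
    and x: "x \<in> rel_interior F" "T K x \<in> L"
  shows "\<exists>A c F'. linear A \<and> F' facet_of P \<and> (\<lambda>x. A x + c) ` F = F' \<and> T L ` F' = T K ` F \<and>
    (\<forall>x\<in>F. T K x = T L (A x + c))"
proof -
  obtain f g A c where f: "f face_of P" and g: "g face_of P" and A: "linear A" "(\<lambda>x. A x + c) ` g = f"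
    and LK: "L \<inter> K = T L ` f" and TA: "\<forall>x\<in>g. T K x = T L (A x + c)"
    using common_face[OF L(1) K L(2)] by blast
  obtain f' g' A' c' where f': "f' face_of P" and g': "g' face_of P" and A': "linear A'" "(\<lambda>x. A' x + c') ` g' = f'"
    and KL: "K \<inter> L = T K ` f'" and TA': "\<forall>x\<in>g'. T L x = T K (A' x + c')"
    using common_face[OF K L(1) L(2)[symmetric]] by blast
  have sub: "f \<subseteq> P" "g \<subseteq> P" "f' \<subseteq> P" "g' \<subseteq> P" using f g f' g' face_of_imp_subset by blast+
  have "T K ` g = (\<lambda>x. T L (A x + c)) ` g" by (rule image_cong) (use TA in auto)
  also have "\<dots> = T L ` f" unfolding A(2)[symmetric] by (simp add: image_image)
  finally have Kg: "T K ` g = T L ` f" .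
  have "T L ` g' = (\<lambda>x. T K (A' x + c')) ` g'" by (rule image_cong) (use TA' in auto)
  also have "\<dots> = T K ` f'" unfolding A'(2)[symmetric] by (simp add: image_image)
  finally have Lg': "T L ` g' = T K ` f'" .
  have "T K ` f' = T K ` g" using KL LK Kg by (simp add: Int_commute)
  then have fg: "f' = g" using image_T_eq_iff[OF K] sub by simp
  have "T L ` g' = T L ` f" using Lg' KL LK by (simp add: Int_commute)
  then have gf: "g' = f" using image_T_eq_iff[OF L(1)] sub by simp
  have xP: "x \<in> P" using x(1) rel_interior_subset facet_props(2)[OF F] by blast
  have "T K x \<in> K" using xP T_image[OF K] by blast
  then have "T K x \<in> T K ` g" using x(2) LK Kg by blast
  then have "x \<in> g" using inj_T[OF K] xP sub(2) by (auto dest: inj_onD)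
  then have "F \<subseteq> g" using subset_of_face_of[OF g facet_props(2)[OF F]] x(1) by blast
  moreover have "g \<noteq> P"
  proof
    assume "g = P"
    then have "K = L \<inter> K" using T_image[OF K] Kg LK by simp
    then show False using cell_not_subset[OF K L(1) L(2)[symmetric]] by blast
  qed
  ultimately have gF: "g = F" using facet_maximal[OF F g] by blast
  have "aff_dim f \<le> aff_dim F" using aff_dim_affine_image_le[OF A(1), of c g] A(2) gF by simp
  moreover have "aff_dim F \<le> aff_dim f" using aff_dim_affine_image_le[OF A'(1), of c' g'] A'(2) gF fg gf by simp
  moreover have "f \<noteq> {}" using A(2) gF facet_props(3)[OF F] by blast
  ultimately have "f facet_of P" using f F by (simp add: facet_of_def)
  then show ?thesis using A gF Kg TA by (intro exI[of _ A] exI[of _ c] exI[of _ f]) simp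
qed

lemma facet_map:
  assumes K: "K \<in> mesh" and F: "F facet_of P" and L: "L \<in> mesh" and F': "F' facet_of P"
    and eq: "T L ` F' = T K ` F"
  shows "\<exists>A c. linear A \<and> (\<lambda>x. A x + c) ` F = F' \<and> (\<forall>x\<in>F. T K x = T L (A x + c))"
proof (cases "L = K")
  case True
  then have "F' = F" using eq image_T_eq_iff[OF K] facet_props(2) F F' by blast
  then show ?thesis using True by (intro exI[of _ id] exI[of _ 0]) (simp add: linear_id)
next
  case False
  obtain x where x: "x \<in> rel_interior F" using facet_props(6)[OF F] by blast
  have "T K x \<in> T L ` F'" unfolding eq using x rel_interior_subset by blast
  then have "T K x \<in> L" using T_image[OF L] facet_props(2)[OF F'] by blast
  from common_facet[OF K L False F x this] obtain A c F'' where
    *: "linear A" "F'' facet_of P" "(\<lambda>x. A x + c) ` F = F''" "T L ` F'' = T K ` F"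
    "\<forall>x\<in>F. T K x = T L (A x + c)" by (elim exE conjE)
  from *(4) eq have "T L ` F'' = T L ` F'" by simp
  then have "F'' = F'" using image_T_eq_iff[OF L facet_props(2)[OF *(2)] facet_props(2)[OF F']] by simp
  then show ?thesis using *(1,3,5) by (intro exI[of _ A] exI[of _ c]) simp
qed

lemma facet_rel_interior_image:
  assumes K: "K \<in> mesh" and F: "F facet_of P" and L: "L \<in> mesh" and F': "F' facet_of P"
    and eq: "T L ` F' = T K ` F"
  shows "T L ` rel_interior F' = T K ` rel_interior F"
proof -
  obtain A c where A: "linear A" "(\<lambda>x. A x + c) ` F = F'" "\<forall>x\<in>F. T K x = T L (A x + c)"
    using facet_map[OF assms] by blast
  have "rel_interior F' = (\<lambda>x. A x + c) ` rel_interior F"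
    using rel_interior_affine_image[OF A(1) facet_props(4)[OF F], of c] A(2) by simp
  then have "T L ` rel_interior F' = (\<lambda>x. T L (A x + c)) ` rel_interior F" by (simp add: image_image)
  also have "\<dots> = T K ` rel_interior F"
    by (rule image_cong) (use A(3) subsetD[OF rel_interior_subset[of F]] in auto)
  finally show ?thesis .
qed

text \<open>A facet of the same cell that contains a relative interior point of another coincides
  with it. For different cells \<open>common_facet\<close> first moves \<open>F\<close> to a facet
  of \<open>L\<close>. Hence a pressure supported on the image of \<open>rel_interior F\<close> is
  invisible on all other mesh facets.\<close>

lemma facets_disjoint:
  assumes K: "K \<in> mesh" and F: "F facet_of P" and L: "L \<in> mesh" and F': "F' facet_of P"
    and neq: "T L ` F' \<noteq> T K ` F"
  shows "T L ` F' \<inter> T K ` rel_interior F = {}"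
proof (rule ccontr)
  assume "T L ` F' \<inter> T K ` rel_interior F \<noteq> {}"
  then obtain x z where x: "x \<in> rel_interior F" and z: "z \<in> F'" "T L z = T K x" by auto
  have xF: "x \<in> F" using x rel_interior_subset by blast
  have P: "x \<in> P" "z \<in> P" using facet_props(2) F F' xF z by blast+
  show False
  proof (cases "L = K")
    case True
    then have "x = z" using z P inj_T[OF K] by (auto dest: inj_onD)
    then have "F \<subseteq> F'" using x z subset_of_face_of[OF facet_props(1)[OF F'] facet_props(2)[OF F]] by blast
    then show False using facet_eq_if_subset[OF F F'] neq True by blast
  next
    case False
    have "T K x \<in> L" using z P T_image[OF L] by (metis imageI)
    from common_facet[OF K L False F x this] obtain A c F'' where
      *: "linear A" "F'' facet_of P" "(\<lambda>x. A x + c) ` F = F''" "T L ` F'' = T K ` F"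
      "\<forall>x\<in>F. T K x = T L (A x + c)" by (elim exE conjE)
    have "rel_interior F'' = (\<lambda>x. A x + c) ` rel_interior F"
      using rel_interior_affine_image[OF *(1) facet_props(4)[OF F], of c] *(3) by simp
    then have ri: "A x + c \<in> rel_interior F''" using x by simp
    then have "A x + c \<in> P" using rel_interior_subset facet_props(2)[OF *(2)] by blast
    moreover have "T L (A x + c) = T L z" using *(5) xF z by simp
    ultimately have "A x + c = z" using P inj_T[OF L] by (auto dest: inj_onD)
    then have "F'' \<subseteq> F'"
      using ri z subset_of_face_of[OF facet_props(1)[OF F'] facet_props(2)[OF *(2)]] by blast
    then have "F'' = F'" using facet_eq_if_subset[OF *(2) F'] by blast
    then show False using *(4) neq by simp
  qed
qed

text \<open>All parametrizations of one mesh facet, compared as sets. By injectivity each cell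
  contributes at most one, so a facet shared by two cells is listed once for each.\<close>

definition copies :: "(real^'n) set \<Rightarrow> (real^'n) set \<Rightarrow> ((real^'n) set \<times> (real^'n) set) set" where
  "copies K F = {(L, F'). L \<in> mesh \<and> F' facet_of P \<and> T L ` F' = T K ` F}"

lemma finite_copies: "finite (copies K F)"
  by (rule finite_subset[of _ "mesh \<times> {F. F facet_of P}"]) (use finite_mesh finite_facets in \<open>auto simp: copies_def\<close>)

text \<open>The weights \<open>\<kappa>\<close> stand for the orientation of each copy times the constant ratio between the
  measures of the reference facets.\<close>

definition jump :: "((real^'n) set \<times> (real^'n) set \<Rightarrow> real) \<Rightarrow> (real^'n) set \<Rightarrow> (real^'n) set \<Rightarrow> real^'n \<Rightarrow> real" where
  "jump \<kappa> K F y = (\<Sum>(L, F')\<in>copies K F. \<kappa> (L, F') * (u L (inv_into P (T L) y) \<bullet> nrm F'))"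

lemma continuous_flux:
  assumes "L \<in> mesh" "F' facet_of P"
  shows "continuous_on (T L ` F') (\<lambda>y. u L (inv_into P (T L) y) \<bullet> nrm F')"
proof -
  have "T L ` F' \<subseteq> T L ` P" using facet_props(2)[OF assms(2)] by (rule image_mono)
  then have "continuous_on (T L ` F') (inv_into P (T L))"
    using param_cell.Ti_cont[OF cell[OF assms(1)]] continuous_on_subset by metis
  from continuous_on_compose2[OF u_cont[OF assms(1), of UNIV] this]
  show ?thesis by (intro continuous_on_inner continuous_on_const) simp
qed

lemma continuous_jump: "continuous_on (T K ` F) (jump \<kappa> K F)"
  unfolding jump_def[abs_def] case_prod_unfold
proof (rule continuous_on_sum, rule continuous_on_mult_left)
  fix z assume "z \<in> copies K F"
  then have "fst z \<in> mesh" "snd z facet_of P" "T (fst z) ` snd z = T K ` F" by (auto simp: copies_def)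
  then show "continuous_on (T K ` F) (\<lambda>y. u (fst z) (inv_into P (T (fst z)) y) \<bullet> nrm (snd z))"
    using continuous_flux by metis
qed

text \<open>Every copy is an affine reparametrization of \<open>F\<close>, so its integral is a
  constant multiple of one over \<open>F\<close>. The order of quantifiers matters: one \<kappa>
  must serve both the facet pressure, which is itself built from \<kappa>, and later the test
  function.\<close>

lemma jump_weights:
  assumes K: "K \<in> mesh" and F: "F facet_of P"
  shows "\<exists>\<kappa>. \<forall>h B. h \<in> borel_measurable (restrict_space borel (T K ` F)) \<longrightarrow> (\<forall>y\<in>T K ` F. \<bar>h y\<bar> \<le> B) \<longrightarrow>
    (\<Sum>(L, F')\<in>copies K F. orientation L * (\<integral>x. (u L x \<bullet> nrm F') * h (T L x) \<partial>flat_measure F')) =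
    (\<integral>x. jump \<kappa> K F (T K x) * h (T K x) \<partial>flat_measure F)"
proof -
  have pair: "\<exists>k. \<forall>h. h \<in> borel_measurable (restrict_space borel (T K ` F)) \<longrightarrow>
      orientation (fst z) * (\<integral>x. (u (fst z) x \<bullet> nrm (snd z)) * h (T (fst z) x) \<partial>flat_measure (snd z)) =
      k * (\<integral>x. (u (fst z) (inv_into P (T (fst z)) (T K x)) \<bullet> nrm (snd z)) * h (T K x) \<partial>flat_measure F)"
    if z: "z \<in> copies K F" for z
  proof -
    obtain L F' where zz: "z = (L, F')" "L \<in> mesh" "F' facet_of P" "T L ` F' = T K ` F"
      using z by (auto simp: copies_def)
    obtain A c where A: "linear A" "(\<lambda>x. A x + c) ` F = F'" and TA: "\<forall>x\<in>F. T K x = T L (A x + c)"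
      using facet_map[OF K F zz(2-4)] by blast
    have "inj_on (\<lambda>x. A x + c) F"
    proof (rule inj_onI)
      fix x y assume xy: "x \<in> F" "y \<in> F" "A x + c = A y + c"
      then have "T K x = T K y" using TA by simp
      then show "x = y" using inj_T[OF K] facet_props(2)[OF F] xy by (auto dest: inj_onD)
    qed
    from integral_flat_measure_affine[OF zz(3) F A this] obtain \<delta> where
      \<delta>: "\<forall>h :: real^'n \<Rightarrow> real. h \<in> borel_measurable (restrict_space borel F') \<longrightarrow>
        (\<integral>x. h x \<partial>flat_measure F') = \<delta> * (\<integral>x. h (A x + c) \<partial>flat_measure F)" ..
    show ?thesis
    proof (intro exI[of _ "orientation L * \<delta>"] allI impI)
      fix h :: "real^'n \<Rightarrow> real" assume h: "h \<in> borel_measurable (restrict_space borel (T K ` F))"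
      have "(\<lambda>x. h (T L x)) \<in> borel_measurable (flat_measure F')"
        using param_cell.T_measurable[OF cell[OF zz(2)] zz(3)] h zz(4) by (auto intro: measurable_compose)
      then have "(\<lambda>x. h (T L x)) \<in> borel_measurable (restrict_space borel F')"
        by (simp only: measurable_cong_sets[OF sets_flat_measure refl])
      moreover have "(\<lambda>x. u L x \<bullet> nrm F') \<in> borel_measurable (restrict_space borel F')"
        by (intro borel_measurable_continuous_on_restrict continuous_on_inner continuous_on_const u_cont zz(2))
      ultimately have "(\<lambda>x. (u L x \<bullet> nrm F') * h (T L x)) \<in> borel_measurable (restrict_space borel F')"
        by (rule borel_measurable_times[rotated])
      from \<delta>[rule_format, OF this] have "(\<integral>x. (u L x \<bullet> nrm F') * h (T L x) \<partial>flat_measure F') =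
          \<delta> * (\<integral>x. (u L (A x + c) \<bullet> nrm F') * h (T L (A x + c)) \<partial>flat_measure F)" .
      also have "(\<integral>x. (u L (A x + c) \<bullet> nrm F') * h (T L (A x + c)) \<partial>flat_measure F) =
          (\<integral>x. (u L (inv_into P (T L) (T K x)) \<bullet> nrm F') * h (T K x) \<partial>flat_measure F)"
      proof (rule Bochner_Integration.integral_cong[OF refl])
        fix x assume "x \<in> space (flat_measure F)"
        then have x: "x \<in> F" by simp
        then have "A x + c \<in> P" using A(2) facet_props(2)[OF zz(3)] by blast
        then have "inv_into P (T L) (T L (A x + c)) = A x + c" by (rule inv_into_f_f[OF inj_T[OF zz(2)]])
        then show "(u L (A x + c) \<bullet> nrm F') * h (T L (A x + c)) =
            (u L (inv_into P (T L) (T K x)) \<bullet> nrm F') * h (T K x)" using TA x by simp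
      qed
      finally show "orientation (fst z) * (\<integral>x. (u (fst z) x \<bullet> nrm (snd z)) * h (T (fst z) x) \<partial>flat_measure (snd z)) =
          orientation L * \<delta> * (\<integral>x. (u (fst z) (inv_into P (T (fst z)) (T K x)) \<bullet> nrm (snd z)) * h (T K x) \<partial>flat_measure F)"
        by (simp add: zz(1))
    qed
  qed
  then have "\<forall>z\<in>copies K F. \<exists>k. \<forall>h. h \<in> borel_measurable (restrict_space borel (T K ` F)) \<longrightarrow>
      orientation (fst z) * (\<integral>x. (u (fst z) x \<bullet> nrm (snd z)) * h (T (fst z) x) \<partial>flat_measure (snd z)) =
      k * (\<integral>x. (u (fst z) (inv_into P (T (fst z)) (T K x)) \<bullet> nrm (snd z)) * h (T K x) \<partial>flat_measure F)" ..
  from bchoice[OF this] obtain \<kappa> where \<kappa>: "\<forall>z\<in>copies K F. \<forall>h. h \<in> borel_measurable (restrict_space borel (T K ` F)) \<longrightarrow>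
      orientation (fst z) * (\<integral>x. (u (fst z) x \<bullet> nrm (snd z)) * h (T (fst z) x) \<partial>flat_measure (snd z)) =
      \<kappa> z * (\<integral>x. (u (fst z) (inv_into P (T (fst z)) (T K x)) \<bullet> nrm (snd z)) * h (T K x) \<partial>flat_measure F)" ..
  show ?thesis
  proof (intro exI[of _ \<kappa>] allI impI)
    fix h :: "real^'n \<Rightarrow> real" and B
    assume h: "h \<in> borel_measurable (restrict_space borel (T K ` F))" and B: "\<forall>y\<in>T K ` F. \<bar>h y\<bar> \<le> B"
    let ?f = "\<lambda>z x. (u (fst z) (inv_into P (T (fst z)) (T K x)) \<bullet> nrm (snd z)) * h (T K x)"
    have hT: "(\<lambda>x. h (T K x)) \<in> borel_measurable (flat_measure F)"
      using param_cell.T_measurable[OF cell[OF K] F] h by (rule measurable_compose)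
    have int: "integrable (flat_measure F) (?f z)" if z: "z \<in> copies K F" for z
    proof (rule Bochner_Integration.integrable_bound)
      have zz: "fst z \<in> mesh" "snd z facet_of P" "T (fst z) ` snd z = T K ` F" using z by (auto simp: copies_def)
      have "continuous_on F (T K)"
        using param_cell.T_cont[OF cell[OF K]] facet_props(2)[OF F] by (rule continuous_on_subset)
      then have "continuous_on F (\<lambda>x. u (fst z) (inv_into P (T (fst z)) (T K x)) \<bullet> nrm (snd z))"
        by (rule continuous_on_compose2[OF continuous_flux[OF zz(1,2), unfolded zz(3)]]) simp
      then have i: "integrable (flat_measure F) (\<lambda>x. u (fst z) (inv_into P (T (fst z)) (T K x)) \<bullet> nrm (snd z))"
        by (rule integrable_flat_measure[OF F])
      then show "integrable (flat_measure F) (\<lambda>x. B * (u (fst z) (inv_into P (T (fst z)) (T K x)) \<bullet> nrm (snd z)))"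
        by (rule integrable_mult_right)
      show "?f z \<in> borel_measurable (flat_measure F)"
        using borel_measurable_integrable[OF i] hT by (rule borel_measurable_times)
      have "norm (?f z x) \<le> norm (B * (u (fst z) (inv_into P (T (fst z)) (T K x)) \<bullet> nrm (snd z)))" if "x \<in> F" for x
      proof -
        have "\<bar>h (T K x)\<bar> \<le> \<bar>B\<bar>" using bspec[OF B imageI[OF that]] by linarith
        then show ?thesis
          using mult_right_mono[of "\<bar>h (T K x)\<bar>" "\<bar>B\<bar>" "\<bar>u (fst z) (inv_into P (T (fst z)) (T K x)) \<bullet> nrm (snd z)\<bar>"]
          by (simp add: abs_mult mult.commute)
      qed
      then show "AE x in flat_measure F. norm (?f z x) \<le> norm (B * (u (fst z) (inv_into P (T (fst z)) (T K x)) \<bullet> nrm (snd z)))"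
        by (intro AE_I2) simp
    qed
    have "(\<Sum>(L, F')\<in>copies K F. orientation L * (\<integral>x. (u L x \<bullet> nrm F') * h (T L x) \<partial>flat_measure F')) =
        (\<Sum>z\<in>copies K F. \<kappa> z * (\<integral>x. ?f z x \<partial>flat_measure F))"
      unfolding case_prod_unfold by (intro sum.cong refl \<kappa>[rule_format] h)
    also have "\<dots> = (\<Sum>z\<in>copies K F. \<integral>x. \<kappa> z * ?f z x \<partial>flat_measure F)" by simp
    also have "\<dots> = (\<integral>x. (\<Sum>z\<in>copies K F. \<kappa> z * ?f z x) \<partial>flat_measure F)"
      by (rule Bochner_Integration.integral_sum[symmetric]) (intro integrable_mult_right int)
    also have "\<dots> = (\<integral>x. jump \<kappa> K F (T K x) * h (T K x) \<partial>flat_measure F)"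
      by (simp add: jump_def case_prod_unfold sum_distrib_right mult.assoc)
    finally show "(\<Sum>(L, F')\<in>copies K F. orientation L * (\<integral>x. (u L x \<bullet> nrm F') * h (T L x) \<partial>flat_measure F')) =
        (\<integral>x. jump \<kappa> K F (T K x) * h (T K x) \<partial>flat_measure F)" .
  qed
qed

text \<open>Cut off to the relative interior because \<^const>\<open>outward_normal\<close> is arbitrary on its boundary.\<close>

definition facet_pressure :: "((real^'n) set \<times> (real^'n) set \<Rightarrow> real) \<Rightarrow> (real^'n) set \<Rightarrow> (real^'n) set \<Rightarrow> real^'n \<Rightarrow> real" where
  "facet_pressure \<kappa> K F y = indicator (T K ` rel_interior F) y *\<^sub>R jump \<kappa> K F y"

text \<open>By injectivity the image is the difference of two compact sets, the images of the facet
  and of its relative boundary.\<close>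

lemma rel_interior_image_borel:
  assumes K: "K \<in> mesh" and F: "F facet_of P"
  shows "T K ` rel_interior F \<in> sets borel"
proof -
  have FP: "F \<subseteq> P" using facet_props(2)[OF F] .
  have cont: "continuous_on S (T K)" if "S \<subseteq> F" for S
    using param_cell.T_cont[OF cell[OF K]] by (rule continuous_on_subset) (use that FP in blast)
  have "rel_frontier F = F - rel_interior F" using facet_props(5)[OF F] by (simp add: rel_frontier_def compact_imp_closed)
  then have "compact (F - rel_interior F)" using compact_rel_frontier[OF facet_props(5)[OF F]] by simp
  then have "compact (T K ` (F - rel_interior F))" by (intro compact_continuous_image cont) auto
  moreover have "compact (T K ` F)" by (intro compact_continuous_image cont facet_props F) auto
  moreover have "T K ` rel_interior F = T K ` F - T K ` (F - rel_interior F)"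
    using inj_on_image_set_diff[OF inj_T[OF K], of F "F - rel_interior F"] FP rel_interior_subset[of F]
    by (simp add: double_diff) blast
  ultimately show ?thesis by (simp only:) (intro sets.Diff borel_compact)
qed

lemma facet_pressure_measurable:
  assumes "K \<in> mesh" "F facet_of P"
  shows "facet_pressure \<kappa> K F \<in> borel_measurable borel"
proof -
  have "continuous_on (T K ` rel_interior F) (jump \<kappa> K F)"
    using continuous_jump by (rule continuous_on_subset) (use rel_interior_subset in blast)
  then show ?thesis
    unfolding facet_pressure_def[abs_def] by (intro borel_measurable_continuous_on_indicator rel_interior_image_borel assms)
qed

lemma facet_pressure_other:
  assumes "K \<in> mesh" "F facet_of P" "L \<in> mesh" "F' facet_of P" "T L ` F' \<noteq> T K ` F" "y \<in> T L ` F'"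
  shows "facet_pressure \<kappa> K F y = 0"
  using facets_disjoint[OF assms(1-5)] assms(6) by (auto simp: facet_pressure_def indicator_def)

lemma facet_pressure_boundary:
  assumes K: "K \<in> mesh" and F: "F facet_of P" and L: "L \<in> mesh" and F': "F' facet_of P"
    and x: "x \<in> F' - rel_interior F'"
  shows "facet_pressure \<kappa> K F (T L x) = 0"
proof (cases "T L ` F' = T K ` F")
  case True
  from facet_rel_interior_image[OF K F L F' True] have "T K ` rel_interior F = T L ` rel_interior F'" by simp
  moreover have "T L x \<notin> T L ` rel_interior F'"
    using x inj_T[OF L] facet_props(2)[OF F'] rel_interior_subset[of F'] by (auto dest!: inj_onD)
  ultimately show ?thesis by (simp add: facet_pressure_def)
next
  case False
  then show ?thesis using facet_pressure_other[OF K F L F' False] x by blast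
qed

text \<open>On facets that are not copies the pressure vanishes; on copies it vanishes at the
  relative boundary, as \<open>surface_integral_piola\<close> requires.\<close>

lemma b_h_facet_pressure:
  assumes K: "K \<in> mesh" and F: "F facet_of P"
  shows "b_h P mesh T v (\<lambda>_. 0, facet_pressure \<kappa> K F) =
    (\<Sum>(L, F')\<in>copies K F. orientation L * (\<integral>x. (u L x \<bullet> nrm F') * facet_pressure \<kappa> K F (T L x) \<partial>flat_measure F'))"
proof -
  let ?h = "facet_pressure \<kappa> K F"
  let ?t = "\<lambda>L F'. orientation L * (\<integral>x. (u L x \<bullet> nrm F') * ?h (T L x) \<partial>flat_measure F')"
  have "(\<integral>y. (cell_rep L v y \<bullet> outward_normal L y) * ?h y \<partial>surface_measure P (T L) F') = ?t L F'"
    if L: "L \<in> mesh" and F': "F' facet_of P" for L F'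
  proof -
    interpret C: param_cell P "T L" "p L" "Dp L" by (rule cell[OF L])
    have "?h \<in> borel_measurable (restrict_space borel (T L ` F'))"
      by (intro measurable_restrict_space1 facet_pressure_measurable K F)
    from C.surface_integral_piola[OF u_cont[OF L] w[OF L], unfolded T_image[OF L], OF v[OF L] F' this]
    show ?thesis using facet_pressure_boundary[OF K F L F'] by (simp add: orientation_def)
  qed
  then have "b_h P mesh T v (\<lambda>_. 0, ?h) = (\<Sum>L\<in>mesh. \<Sum>F' | F' facet_of P. ?t L F')"
    by (simp add: b_h_def)
  also have "\<dots> = (\<Sum>(L, F')\<in>mesh \<times> {F'. F' facet_of P}. ?t L F')" by (rule sum.cartesian_product)
  also have "\<dots> = (\<Sum>(L, F')\<in>copies K F. ?t L F')"
  proof (rule sum.mono_neutral_right)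
    show "\<forall>z\<in>mesh \<times> {F'. F' facet_of P} - copies K F. (case z of (L, F') \<Rightarrow> ?t L F') = 0"
    proof clarify
      fix L F' assume z: "L \<in> mesh" "F' facet_of P" "(L, F') \<notin> copies K F"
      then have "T L ` F' \<noteq> T K ` F" by (auto simp: copies_def)
      then have "?h (T L x) = 0" if "x \<in> F'" for x using facet_pressure_other[OF K F z(1,2)] that by blast
      then have "(\<integral>x. (u L x \<bullet> nrm F') * ?h (T L x) \<partial>flat_measure F') = (\<integral>x. 0 \<partial>flat_measure F')"
        by (intro Bochner_Integration.integral_cong) auto
      then show "?t L F' = 0" by simp
    qed
  qed (use finite_mesh finite_facets in \<open>auto simp: copies_def\<close>)
  finally show ?thesis .
qed

text \<open>With \<kappa> from \<open>jump_weights\<close>, testing with the facet pressure gives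
  the integral of the squared jump over the relative interior, so the jump is zero almost
  everywhere. The same \<kappa> then turns the fluxes against \<open>\<psi>\<close> into the
  integral of jump times \<open>\<psi>\<close>.\<close>

lemma flux_cancels:
  assumes K: "K \<in> mesh" and F: "F facet_of P"
    and b: "\<And>\<kappa>. b_h P mesh T v (\<lambda>_. 0, facet_pressure \<kappa> K F) = 0" and \<psi>: "continuous_on UNIV \<psi>"
  shows "(\<Sum>(L, F')\<in>copies K F. orientation L * (\<integral>x. (u L x \<bullet> nrm F') * \<psi> (T L x) \<partial>flat_measure F')) = 0"
proof -
  obtain \<kappa> where \<kappa>: "\<forall>h B. h \<in> borel_measurable (restrict_space borel (T K ` F)) \<longrightarrow> (\<forall>y\<in>T K ` F. \<bar>h y\<bar> \<le> B) \<longrightarrow>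
    (\<Sum>(L, F')\<in>copies K F. orientation L * (\<integral>x. (u L x \<bullet> nrm F') * h (T L x) \<partial>flat_measure F')) =
    (\<integral>x. jump \<kappa> K F (T K x) * h (T K x) \<partial>flat_measure F)" using jump_weights[OF K F] ..
  have "continuous_on F (T K)"
    using param_cell.T_cont[OF cell[OF K]] facet_props(2)[OF F] by (rule continuous_on_subset)
  then have cF: "compact (T K ` F)" by (intro compact_continuous_image facet_props F)
  have bounded_on: "\<exists>B. \<forall>y\<in>T K ` F. \<bar>f y\<bar> \<le> B" if "continuous_on (T K ` F) f" for f :: "real^'n \<Rightarrow> real"
    using compact_imp_bounded[OF compact_continuous_image[OF that cF]] by (auto simp: bounded_iff)
  let ?h = "facet_pressure \<kappa> K F" and ?J = "\<lambda>x. jump \<kappa> K F (T K x)"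
  have hm: "?h \<in> borel_measurable (restrict_space borel (T K ` F))"
    by (intro measurable_restrict_space1 facet_pressure_measurable K F)
  obtain B where B: "\<And>y. y \<in> T K ` F \<Longrightarrow> \<bar>jump \<kappa> K F y\<bar> \<le> B" using bounded_on[OF continuous_jump] by blast
  have Bh: "\<bar>?h y\<bar> \<le> B" if "y \<in> T K ` F" for y
    using B[OF that] abs_ge_zero[of "jump \<kappa> K F y"] by (auto simp: facet_pressure_def indicator_def)
  have "(\<integral>x. ?J x * ?h (T K x) \<partial>flat_measure F) = 0"
    using \<kappa>[rule_format, OF hm Bh] b[of \<kappa>] b_h_facet_pressure[OF K F, of \<kappa>] by simp
  moreover have nn: "?J x * ?h (T K x) \<ge> 0" for x by (simp add: facet_pressure_def indicator_def)
  moreover have "integrable (flat_measure F) (\<lambda>x. ?J x * ?h (T K x))"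
  proof -
    interpret finite_measure "flat_measure F" by (rule finite_measure_flat[OF F])
    have Tm: "T K \<in> flat_measure F \<rightarrow>\<^sub>M restrict_space borel (T K ` F)"
      by (rule param_cell.T_measurable[OF cell[OF K] F])
    have Jm: "jump \<kappa> K F \<in> borel_measurable (restrict_space borel (T K ` F))"
      by (intro borel_measurable_continuous_on_restrict continuous_jump)
    show ?thesis
    proof (rule integrable_const_bound)
      show "(\<lambda>x. ?J x * ?h (T K x)) \<in> borel_measurable (flat_measure F)"
        using measurable_compose[OF Tm Jm] measurable_compose[OF Tm hm] by (rule borel_measurable_times)
      have "norm (?J x * ?h (T K x)) \<le> B * B" if "x \<in> F" for x
        unfolding norm_mult using B[of "T K x"] Bh[of "T K x"] that
        by (intro mult_mono) (auto intro: order_trans[OF abs_ge_zero])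
      then show "AE x in flat_measure F. norm (?J x * ?h (T K x)) \<le> B * B" by (intro AE_I2) simp
    qed
  qed
  ultimately have "AE x in flat_measure F. ?J x * ?h (T K x) = 0"
    by (subst (asm) integral_nonneg_eq_0_iff_AE) auto
  \<comment> \<open>On the relative interior the indicator is 1 and the product is the square of the
    jump; the relative boundary is a null set of the flat measure.\<close>
  then have J0: "AE x in flat_measure F. ?J x = 0"
    using AE_flat_measure_rel_interior[OF F]
    by eventually_elim (auto simp: facet_pressure_def indicator_def)
  have \<psi>m: "\<psi> \<in> borel_measurable (restrict_space borel (T K ` F))"
    by (intro measurable_restrict_space1 borel_measurable_continuous_onI \<psi>)
  obtain C where C: "\<And>y. y \<in> T K ` F \<Longrightarrow> \<bar>\<psi> y\<bar> \<le> C"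
    using bounded_on[OF continuous_on_subset[OF \<psi>]] by blast
  have "(\<integral>x. ?J x * \<psi> (T K x) \<partial>flat_measure F) = 0"
    by (rule integral_eq_zero_AE) (use J0 in \<open>auto elim: eventually_mono\<close>)
  then show ?thesis using \<kappa>[rule_format, OF \<psi>m C] by simp
qed

lemma weak_divergence_vanishes:
  assumes q: "b_h P mesh T v (div_pressure, \<lambda>_. 0) = 0"
    and qbar: "\<And>K F \<kappa>. K \<in> mesh \<Longrightarrow> F facet_of P \<Longrightarrow> b_h P mesh T v (\<lambda>_. 0, facet_pressure \<kappa> K F) = 0"
    and \<psi>: "\<psi> \<in> test_functions U"
  shows "(\<integral>x. v x \<bullet> grad \<psi> x \<partial>lebesgue_on \<Omega>) = 0"
proof -
  let ?t = "\<lambda>(K, F). orientation K * (\<integral>x. (u K x \<bullet> nrm F) * \<psi> (T K x) \<partial>flat_measure F)"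
  let ?S = "mesh \<times> {F. F facet_of P}"
  have "(\<integral>x. trace (Du K x) * \<psi> (T K x) \<partial>lebesgue_on P) = 0" if K: "K \<in> mesh" for K
    by (rule integral_eq_zero_AE) (use divergence_free_on_cells[OF q K] in \<open>auto elim: eventually_mono\<close>)
  then have "(\<integral>x. v x \<bullet> grad \<psi> x \<partial>lebesgue_on \<Omega>) = (\<Sum>K\<in>mesh. \<Sum>F | F facet_of P. ?t (K, F))"
    unfolding integral_gradient[OF \<psi>] by (simp add: sum_distrib_left)
  also have "\<dots> = (\<Sum>z\<in>?S. ?t z)" by (simp add: sum.cartesian_product)
  \<comment> \<open>The pairs of a cell and a reference facet are regrouped by the mesh facet that
    they parametrize; each group is one of the sets \<open>copies K F\<close>, whose fluxes
    cancel.\<close>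
  also have "\<dots> = (\<Sum>\<Phi>\<in>(\<lambda>(K, F). T K ` F) ` ?S. \<Sum>z | z \<in> ?S \<and> (\<lambda>(K, F). T K ` F) z = \<Phi>. ?t z)"
    by (rule sum.image_gen) (use finite_mesh finite_facets in auto)
  also have "\<dots> = 0"
  proof (rule sum.neutral, clarify)
    fix K F assume K: "K \<in> mesh" and F: "F facet_of P"
    have "{z. z \<in> ?S \<and> (\<lambda>(K, F). T K ` F) z = T K ` F} = copies K F" by (auto simp: copies_def)
    then show "(\<Sum>z | z \<in> ?S \<and> (\<lambda>(K, F). T K ` F) z = T K ` F. ?t z) = 0"
      using flux_cancels[OF K F qbar[OF K F] test_function_C1(3)[OF \<psi>]] by simp
  qed
  finally show ?thesis .
qed

end

section \<open>Admissibility of the test pressures\<close>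

text \<open>At \<open>x\<close> the derivative is determined in all directions towards points of
  \<open>S\<close>, and these span the space when \<open>S\<close> has interior points. It settles
  \<open>frechet_derivative\<close> within the closed reference cell at boundary points.\<close>

lemma has_derivative_unique_convex:
  fixes f :: "'a::euclidean_space \<Rightarrow> 'b::real_normed_vector"
  assumes S: "convex S" "interior S \<noteq> {}" and x: "x \<in> S"
    and A: "(f has_derivative A) (at x within S)" and B: "(f has_derivative B) (at x within S)"
  shows "A = B"
proof -
  have lA: "linear A" and lB: "linear B" using A B has_derivative_linear by auto
  have on_S: "A (z - x) = B (z - x)" if z: "z \<in> S" for z
  proof (rule ccontr)
    assume ne: "A (z - x) \<noteq> B (z - x)"
    define h where "h = z - x"
    have h0: "h \<noteq> 0" using ne linear_0[OF lA] linear_0[OF lB] by (auto simp: h_def)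
    \<comment> \<open>A quarter of the gap per unit length: two error terms of this size bound the
      gap by half of itself.\<close>
    define e where "e = norm (A h - B h) / (4 * norm h)"
    have e: "e > 0" using ne h0 by (simp add: e_def h_def)
    obtain d1 where d1: "d1 > 0" "\<forall>y\<in>S. norm (y - x) < d1 \<longrightarrow> norm (f y - f x - A (y - x)) \<le> e * norm (y - x)"
      using A e unfolding has_derivative_within_alt by blast
    obtain d2 where d2: "d2 > 0" "\<forall>y\<in>S. norm (y - x) < d2 \<longrightarrow> norm (f y - f x - B (y - x)) \<le> e * norm (y - x)"
      using B e unfolding has_derivative_within_alt by blast
    define t where "t = min 1 (min d1 d2 / (2 * norm h))"
    have t: "0 < t" "t \<le> 1" "t * norm h < d1" "t * norm h < d2"
    proof -
      show "0 < t" "t \<le> 1" using d1(1) d2(1) h0 by (auto simp: t_def)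
      have "t * norm h \<le> min d1 d2 / (2 * norm h) * norm h" by (intro mult_right_mono) (auto simp: t_def)
      also have "\<dots> = min d1 d2 / 2" using h0 by simp
      finally show "t * norm h < d1" "t * norm h < d2" using d1(1) d2(1) by (auto simp: min_def split: if_splits)
    qed
    define y where "y = x + t *\<^sub>R h"
    have "y = (1 - t) *\<^sub>R x + t *\<^sub>R z" by (simp add: y_def h_def algebra_simps)
    then have yS: "y \<in> S" using convexD_alt[OF S(1) x z, of t] t by simp
    have yx: "y - x = t *\<^sub>R h" "norm (y - x) = t * norm h" using t(1) by (simp_all add: y_def)
    have "norm (f y - f x - A (y - x)) \<le> e * (t * norm h)" "norm (f y - f x - B (y - x)) \<le> e * (t * norm h)"
      using d1(2) d2(2) yS t yx(2) by metis+
    then have "norm (A (y - x) - B (y - x)) \<le> 2 * (e * (t * norm h))"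
      using norm_triangle_ineq4[of "f y - f x - B (y - x)" "f y - f x - A (y - x)"] by simp
    moreover have "A (y - x) - B (y - x) = t *\<^sub>R (A h - B h)"
      unfolding yx(1) by (simp add: linear_scale[OF lA] linear_scale[OF lB] scaleR_diff_right)
    ultimately have "t * norm (A h - B h) \<le> t * (2 * (e * norm h))" using t(1) by (simp add: mult_ac)
    then have "norm (A h - B h) \<le> 2 * (e * norm h)" using t(1) by simp
    also have "\<dots> = norm (A h - B h) / 2" using h0 by (simp add: e_def)
    finally have "norm (A h - B h) \<le> 0" by simp
    then show False using ne by (simp add: h_def)
  qed
  obtain z where "z \<in> interior S" using S(2) by blast
  then obtain r where r: "r > 0" "ball z r \<subseteq> S" unfolding mem_interior by blast
  show ?thesis
  proof
    fix k
    show "A k = B k"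
    proof (cases "k = 0")
      case True
      then show ?thesis using linear_0[OF lA] linear_0[OF lB] by simp
    next
      case False
      \<comment> \<open>Any direction \<open>k\<close> is, up to scaling, the difference of two
        points of a ball contained in \<open>S\<close>.\<close>
      define s where "s = r / (2 * norm k)"
      have s: "s > 0" using r False by (simp add: s_def)
      have "norm (s *\<^sub>R k) = r / 2" using False r(1) by (simp add: s_def)
      then have "z + s *\<^sub>R k \<in> ball z r" "z \<in> ball z r" using r(1) by (simp_all add: dist_norm)
      then have "A (z + s *\<^sub>R k - x) = B (z + s *\<^sub>R k - x)" "A (z - x) = B (z - x)" using on_S r(2) by blast+
      moreover have "z + s *\<^sub>R k - x = (z - x) + s *\<^sub>R k" by simp
      ultimately have "s *\<^sub>R A k = s *\<^sub>R B k"
        by (simp only: linear_add[OF lA] linear_add[OF lB] linear_scale[OF lA] linear_scale[OF lB]) simp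
      then show ?thesis using s by simp
    qed
  qed
qed

context solid_polytope
begin

text \<open>The reference cell is itself a cell parametrized by the identity, so
  \<open>outward_normal_K\<close> applies with \<open>nrm F\<close> as \<nu>.\<close>

lemma outward_normal_facet:
  assumes F: "F facet_of P" and x: "x \<in> rel_interior F"
  shows "outward_normal P x = nrm F"
proof -
  have jac_id: "jac P id y = mat 1" if y: "y \<in> P" for y
  proof -
    have d: "(id has_derivative id) (at y within P)" by (rule has_derivative_id)
    then have "(id has_derivative frechet_derivative id (at y within P)) (at y within P)"
      using frechet_derivative_works differentiableI by blast
    from has_derivative_unique_convex[OF convex interior_nonempty y this d]
    show ?thesis by (simp add: jac_def matrix_id_mat_1)
  qed
  have "(id has_derivative (*v) (mat 1 :: real^'n^'n)) (at y)" for y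
  proof -
    have "(*v) (mat 1 :: real^'n^'n) = id" by (simp add: fun_eq_iff)
    then show ?thesis by (simp only: has_derivative_id)
  qed
  then have "C1_field id (\<lambda>_. mat 1 :: real^'n^'n)" by (simp add: C1_field_def)
  moreover have "C1_diffeo_on P id"
    unfolding C1_diffeo_on_def
  proof (intro conjI)
    show "continuous_on P (jac P id)"
      by (rule continuous_on_eq[OF continuous_on_const[of P "mat 1"]]) (simp add: jac_id)
  qed (simp_all add: jac_id differentiable_on_id[unfolded id_def] id_def[symmetric] differentiable_on_id)
  ultimately interpret I: param_cell P id id "\<lambda>_. mat 1" by unfold_locales simp_all
  show ?thesis
    using I.outward_normal_K[OF F x, of "nrm F"] facet_rep(1)[OF F] by (simp add: transpose_mat)
qed

end

context discrete_field
begin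

lemma facet_pressure_bounded:
  assumes K: "K \<in> mesh" and F: "F facet_of P"
  shows "\<exists>B. \<forall>y. \<bar>facet_pressure \<kappa> K F y\<bar> \<le> B"
proof -
  have "continuous_on F (T K)"
    using param_cell.T_cont[OF cell[OF K]] facet_props(2)[OF F] by (rule continuous_on_subset)
  then have "compact (T K ` F)" by (intro compact_continuous_image facet_props F)
  then have "compact (jump \<kappa> K F ` T K ` F)" using continuous_jump by (intro compact_continuous_image[OF _ \<open>compact (T K ` F)\<close>])
  from compact_imp_bounded[OF this] obtain B where B: "\<forall>y\<in>T K ` F. \<bar>jump \<kappa> K F y\<bar> \<le> B"
    by (auto simp: bounded_iff)
  have "\<bar>facet_pressure \<kappa> K F y\<bar> \<le> max B 0" for y
  proof (cases "y \<in> T K ` rel_interior F")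
    case True
    then have "y \<in> T K ` F" using rel_interior_subset by blast
    then have "\<bar>jump \<kappa> K F y\<bar> \<le> B" using B by blast
    then show ?thesis using True by (simp add: facet_pressure_def)
  qed (simp add: facet_pressure_def)
  then show ?thesis by blast
qed

lemma AE_facet_pressure:
  assumes K: "K \<in> mesh" and F: "F facet_of P" and LF: "(L, F') \<in> copies K F"
  shows "AE y in surface_measure P (T L) F'. facet_pressure \<kappa> K F y = jump \<kappa> K F y"
proof -
  have L: "L \<in> mesh" and F': "F' facet_of P" and eq: "T L ` F' = T K ` F" using LF by (auto simp: copies_def)
  interpret C: param_cell P "T L" "p L" "Dp L" by (rule cell[OF L])
  have sub: "T L ` rel_interior F' \<subseteq> T L ` F'" using rel_interior_subset by blast
  have "T L ` rel_interior F' \<in> sets (restrict_space borel (T L ` F'))"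
    using rel_interior_image_borel[OF L F'] sub by (auto simp: sets_restrict_space)
  then have "AE y in surface_measure P (T L) F'. y \<in> T L ` rel_interior F'"
    by (rule C.AE_surface_measure[OF F']) (use AE_flat_measure_rel_interior[OF F'] in \<open>auto elim: eventually_mono\<close>)
  then show ?thesis
    by eventually_elim (simp add: facet_pressure_def facet_rel_interior_image[OF K F L F' eq])
qed

end

lemma finite_dim_space_closed:
  assumes "finite_dim_space V"
  shows "(\<lambda>x. 0) \<in> V" and "f \<in> V \<Longrightarrow> (\<lambda>x. r *\<^sub>R f x) \<in> V"
    and "f \<in> V \<Longrightarrow> g \<in> V \<Longrightarrow> (\<lambda>x. f x + g x) \<in> V"
proof -
  obtain B where V: "V = {f. \<exists>c. f = (\<lambda>x. \<Sum>b\<in>B. c b *\<^sub>R b x)}"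
    using assms by (auto simp: finite_dim_space_def)
  show "(\<lambda>x. 0) \<in> V" unfolding V by (auto intro!: exI[of _ "\<lambda>_. 0"])
  show "(\<lambda>x. r *\<^sub>R f x) \<in> V" if f: "f \<in> V"
  proof -
    obtain c where "f = (\<lambda>x. \<Sum>b\<in>B. c b *\<^sub>R b x)" using f unfolding V by blast
    then have "(\<lambda>x. r *\<^sub>R f x) = (\<lambda>x. \<Sum>b\<in>B. (r * c b) *\<^sub>R b x)" by (simp add: scaleR_sum_right)
    then show ?thesis unfolding V by (intro CollectI exI)
  qed
  show "(\<lambda>x. f x + g x) \<in> V" if fg: "f \<in> V" "g \<in> V"
  proof -
    obtain c where "f = (\<lambda>x. \<Sum>b\<in>B. c b *\<^sub>R b x)" using fg(1) unfolding V by blast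
    moreover obtain d where "g = (\<lambda>x. \<Sum>b\<in>B. d b *\<^sub>R b x)" using fg(2) unfolding V by blast
    ultimately have "(\<lambda>x. f x + g x) = (\<lambda>x. \<Sum>b\<in>B. (c b + d b) *\<^sub>R b x)"
      by (simp add: scaleR_add_left sum.distrib)
    then show ?thesis unfolding V by (intro CollectI exI)
  qed
qed

lemma pulled_space_closed:
  assumes "finite_dim_space V"
  shows "(\<lambda>y. 0) \<in> pulled_space S V T" and "q \<in> pulled_space S V T \<Longrightarrow> (\<lambda>y. r * q y) \<in> pulled_space S V T"
    and "q \<in> pulled_space S V T \<Longrightarrow> q' \<in> pulled_space S V T \<Longrightarrow> (\<lambda>y. q y + q' y) \<in> pulled_space S V T"
proof -
  show "(\<lambda>y. 0) \<in> pulled_space S V T"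
    unfolding pulled_space_def using finite_dim_space_closed(1)[OF assms] by fastforce
  show "(\<lambda>y. r * q y) \<in> pulled_space S V T" if q: "q \<in> pulled_space S V T"
  proof -
    obtain f where "f \<in> V" "\<forall>x\<in>S. q (T x) = f x" using q unfolding pulled_space_def by blast
    then show ?thesis
      unfolding pulled_space_def using finite_dim_space_closed(2)[OF assms, of f r] by (intro CollectI bexI[of _ "\<lambda>x. r *\<^sub>R f x"]) auto
  qed
  show "(\<lambda>y. q y + q' y) \<in> pulled_space S V T" if q: "q \<in> pulled_space S V T" "q' \<in> pulled_space S V T"
  proof -
    obtain f where "f \<in> V" "\<forall>x\<in>S. q (T x) = f x" using q(1) unfolding pulled_space_def by blast
    moreover obtain g where "g \<in> V" "\<forall>x\<in>S. q' (T x) = g x" using q(2) unfolding pulled_space_def by blast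
    ultimately show ?thesis
      unfolding pulled_space_def using finite_dim_space_closed(3)[OF assms, of f g] by (intro CollectI bexI[of _ "\<lambda>x. f x + g x"]) auto
  qed
qed

lemma pulled_space_sum:
  assumes "finite_dim_space V" "finite I" "\<And>i. i \<in> I \<Longrightarrow> q i \<in> pulled_space S V T"
  shows "(\<lambda>y. \<Sum>i\<in>I. q i y) \<in> pulled_space S V T"
  using assms(2,3) by (induction I rule: finite_induct) (auto intro: pulled_space_closed[OF assms(1)])

lemma lagrange_reference_solid_polytope:
  fixes Khat :: "(real^'n) set"
  assumes "lagrange_reference Khat G"
  shows "solid_polytope Khat"
proof -
  have "int CARD('n) simplex Khat \<or> (\<exists>a b. box a b \<noteq> {} \<and> Khat = cbox a b)"
    using assms unfolding lagrange_reference_def by blast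
  then show ?thesis
  proof
    assume s: "int CARD('n) simplex Khat"
    then have "aff_dim Khat = int DIM(real^'n)" using aff_dim_simplex by simp
    then have "affine hull Khat = UNIV" using aff_dim_eq_full by blast
    then have "interior Khat = rel_interior Khat" by (rule rel_interior_interior[symmetric])
    moreover have "convex Khat" using polytope_imp_convex[OF simplex_imp_polytope[OF s]] .
    moreover have "Khat \<noteq> {}" using \<open>affine hull Khat = UNIV\<close> by auto
    ultimately have "interior Khat \<noteq> {}" using rel_interior_eq_empty by metis
    then show ?thesis using simplex_imp_polytope[OF s] by unfold_locales
  next
    assume "\<exists>a b. box a b \<noteq> {} \<and> Khat = cbox a b"
    then obtain a b where "box a b \<noteq> {}" "Khat = cbox a b" by blast
    then show ?thesis using polytope_interval[of a b] by unfold_locales (simp_all add: interior_cbox)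
  qed
qed

lemma lagrange_reference_polynomial:
  fixes Khat :: "(real^'n) set"
  assumes "lagrange_reference Khat G" "q \<in> G"
  shows "real_polynomial_function q"
proof -
  have mono: "real_polynomial_function (\<lambda>x::real^'n. \<Prod>i\<in>UNIV. (x $ i) ^ \<alpha> i)" for \<alpha>
    by (intro real_polynomial_function_prod real_polynomial_function_power real_polynomial_function.intros(1) bounded_linear_vec_nth) simp
  have ps: "real_polynomial_function q" if "q \<in> poly_span A" for A
  proof -
    obtain c where c: "q = (\<lambda>x. \<Sum>\<alpha>\<in>A. c \<alpha> * (\<Prod>i\<in>UNIV. (x $ i) ^ \<alpha> i))"
      using \<open>q \<in> poly_span A\<close> unfolding poly_span_def by blast
    show ?thesis
    proof (cases "finite A")
      case True
      then show ?thesis unfolding c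
        by (intro real_polynomial_function_sum real_polynomial_function.intros(2,4) mono)
    next
      \<comment> \<open>A sum over an infinite set is 0 by convention, so \<open>q\<close> is then
        the zero polynomial.\<close>
      case False
      then show ?thesis unfolding c by (simp add: real_polynomial_function.intros(2))
    qed
  qed
  then show ?thesis using assms unfolding lagrange_reference_def by blast
qed

lemma conforming_mesh_param_cell:
  fixes Khat :: "(real^'n) set"
  assumes G: "lagrange_reference Khat G" and mesh: "conforming_mesh Khat G mesh T \<Omega>" and K: "K \<in> mesh"
  shows "\<exists>p Dp. param_cell Khat (T K) p Dp"
proof -
  have "\<forall>i. \<exists>p\<in>G. \<forall>x\<in>Khat. T K x $ i = p x" and diffeo: "C1_diffeo_on Khat (T K)"
    using mesh K unfolding conforming_mesh_def by blast+
  then obtain p where p: "\<And>i. p i \<in> G" "\<And>i x. x \<in> Khat \<Longrightarrow> T K x $ i = p i x" by metis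
  have "real_polynomial_function (\<lambda>x. (\<chi> i. p i x) $ i)" for i
    using lagrange_reference_polynomial[OF G p(1)[of i]] by simp
  then obtain D where "C1_field (\<lambda>x. \<chi> i. p i x) D" using C1_field_if_components[of "\<lambda>x. \<chi> i. p i x"] by blast
  moreover have "T K x = (\<chi> i. p i x)" if "x \<in> Khat" for x using p(2)[OF that] by (simp add: vec_eq_iff)
  ultimately have "param_cell Khat (T K) (\<lambda>x. \<chi> i. p i x) D"
    using lagrange_reference_solid_polytope[OF G] diffeo
    by (simp add: param_cell_def param_cell_axioms_def)
  then show ?thesis by blast
qed

theorem lemma2:
  fixes \<Omega> Khat :: "(real^'n) set"
    and G :: "(real^'n \<Rightarrow> real) set"
    and mesh :: "(real^'n) set set"
    and T :: "(real^'n) set \<Rightarrow> real^'n \<Rightarrow> real^'n"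
    and Vhat :: "(real^'n \<Rightarrow> real^'n) set"
    and Qhat :: "(real^'n \<Rightarrow> real) set"
    and Qbarhat :: "(real^'n) set \<Rightarrow> (real^'n \<Rightarrow> real) set"
  assumes "CARD('n) \<in> {2, 3}"
    and "open \<Omega>"
    and "lagrange_reference Khat G"
    and "conforming_mesh Khat G mesh T \<Omega>"
    and "finite_dim_space Vhat"
    and "\<forall>v\<in>Vhat. polynomial_function v"
    and "Vhat \<subseteq> H_div (interior Khat)"
    and "\<And>F. F facet_of Khat \<Longrightarrow> finite_dim_space (Qbarhat F)"
    and "\<And>F. F facet_of Khat \<Longrightarrow> \<forall>r\<in>Qbarhat F. real_polynomial_function r"
    and "\<And>F v. F facet_of Khat \<Longrightarrow> v \<in> Vhat \<Longrightarrow>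
           \<exists>r\<in>Qbarhat F. \<forall>x\<in>rel_interior F. r x = v x \<bullet> outward_normal Khat x"
    and "\<And>K L F F'. K \<in> mesh \<Longrightarrow> L \<in> mesh \<Longrightarrow> F facet_of Khat \<Longrightarrow> F' facet_of Khat \<Longrightarrow>
           T K ` F = T L ` F' \<Longrightarrow>
           pulled_space F (Qbarhat F) (T K) = pulled_space F' (Qbarhat F') (T L)"
    and "finite_dim_space Qhat"
    and "\<forall>v\<in>Vhat. \<exists>q\<in>Qhat. has_weak_div (interior Khat) v q"
  shows "X_h Khat Vhat Qhat Qbarhat mesh T \<Omega> \<subseteq> weakly_div_free \<Omega>"
proof
  fix v
  assume "v \<in> X_h Khat Vhat Qhat Qbarhat mesh T \<Omega>"
  note X = this[unfolded X_h_def mem_Collect_eq]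
  note V = conjunct1[OF X, unfolded V_h_def mem_Collect_eq] and b0 = conjunct2[OF X]
  note sq = conjunct1[OF V] and cells = conjunct2[OF V]
  \<comment> \<open>The local representative and its reference field are packed into one pair, so
    that a single choice over the mesh picks both.\<close>
  have "\<forall>K\<in>mesh. \<exists>wu. snd wu \<in> Vhat \<and> (\<forall>x\<in>Khat. piola Khat (T K) (fst wu) x = snd wu x) \<and>
      (AE x in lebesgue_on K. v x = fst wu x)"
  proof
    fix K assume "K \<in> mesh"
    from bspec[OF cells this] obtain w where w: "w \<in> V_cell Khat Vhat (T K)" "AE x in lebesgue_on K. v x = w x" ..
    from w(1) obtain u where "u \<in> Vhat" "\<forall>x\<in>Khat. piola Khat (T K) w x = u x"
      unfolding V_cell_def by (elim CollectE bexE)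
    with w(2) show "\<exists>wu. snd wu \<in> Vhat \<and> (\<forall>x\<in>Khat. piola Khat (T K) (fst wu) x = snd wu x) \<and>
        (AE x in lebesgue_on K. v x = fst wu x)"
      by (intro exI[of _ "(w, u)"]) simp
  qed
  from bchoice[OF this] obtain wu where wu: "\<forall>K\<in>mesh. snd (wu K) \<in> Vhat \<and>
      (\<forall>x\<in>Khat. piola Khat (T K) (fst (wu K)) x = snd (wu K) x) \<and> (AE x in lebesgue_on K. v x = fst (wu K) x)" ..
  define w u where "w = (\<lambda>K. fst (wu K))" and "u = (\<lambda>K. snd (wu K))"
  have uV: "u K \<in> Vhat" if "K \<in> mesh" for K using wu that by (simp add: u_def)
  have "\<forall>K\<in>mesh. \<exists>D. C1_field (u K) D"
    by (intro ballI C1_field_polynomial_function bspec[OF assms(6)] uV)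
  from bchoice[OF this] obtain Du where Du: "\<forall>K\<in>mesh. C1_field (u K) (Du K)" ..
  have "\<forall>K\<in>mesh. \<exists>c. param_cell Khat (T K) (fst c) (snd c)"
    using conforming_mesh_param_cell[OF assms(3,4)] by fastforce
  from bchoice[OF this] obtain c where c: "\<forall>K\<in>mesh. param_cell Khat (T K) (fst (c K)) (snd (c K))" ..
  note conforming = assms(4)[unfolded conforming_mesh_def]
  note mesh = conjunct1[OF conforming] conjunct1[OF conjunct2[OF conforming]]
    conjunct1[OF conjunct2[OF conjunct2[OF conforming]]]
  note cell_image = conjunct1[OF conjunct2[OF conjunct2[OF conjunct2[OF conforming]]]]
  note meet = conjunct2[OF conjunct2[OF conjunct2[OF conjunct2[OF conforming]]]]
  interpret S: solid_polytope Khat by (rule lagrange_reference_solid_polytope[OF assms(3)])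
  interpret D: discrete_field Khat \<Omega> mesh T "\<lambda>K. fst (c K)" "\<lambda>K. snd (c K)" v w u Du
  proof (intro discrete_field.intro discrete_field_axioms.intro)
    show "solid_polytope Khat" by (rule S.solid_polytope_axioms)
    show "finite mesh" "\<Union>mesh = closure \<Omega>" by (fact mesh)+
    show "open \<Omega>" by fact
    fix K assume K: "K \<in> mesh"
    show "interior K \<subseteq> \<Omega>" using mesh(3) K by (rule bspec)
    show "T K ` Khat = K" using bspec[OF cell_image K] by (elim conjE) (rule sym)
    show "param_cell Khat (T K) (fst (c K)) (snd (c K))" using c K by (rule bspec)
    show "C1_field (u K) (Du K)" using Du K by (rule bspec)
    show "\<forall>x\<in>Khat. piola Khat (T K) (w K) x = u K x" "AE x in lebesgue_on K. v x = w K x"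
      using wu K by (simp_all add: w_def u_def)
    fix L assume L: "L \<in> mesh" "K \<noteq> L"
    show "interior K \<inter> interior L = {}" using meet[rule_format, OF K L] by (rule conjunct1)
    show "\<exists>f g A c. f face_of Khat \<and> g face_of Khat \<and> linear A \<and> (\<lambda>x. A x + c) ` g = f \<and>
           K \<inter> L = T K ` f \<and> (\<forall>x\<in>g. T L x = T K (A x + c))" using meet[rule_format, OF K L] by (rule conjunct2)
  qed
  have zero_sq: "square_integrable M (\<lambda>_. 0::real)" for M :: "(real^'n) measure"
    by (simp add: square_integrable_def)
  have zero_Q: "(\<lambda>_. 0) \<in> Q_h Khat Qhat mesh T \<Omega>"
    unfolding Q_h_def using pulled_space_closed(1)[OF assms(12)] by (auto simp: zero_sq intro!: bexI[of _ "\<lambda>_. 0"])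
  have zero_Qbar: "(\<lambda>_. 0) \<in> Qbar_h Khat Qbarhat mesh T"
    unfolding Qbar_h_def using pulled_space_closed(1)[OF assms(8)] by (auto simp: zero_sq intro!: bexI[of _ "\<lambda>_. 0"])
  have div_Q: "D.div_pressure \<in> Q_h Khat Qhat mesh T \<Omega>"
    unfolding Q_h_def
  proof (intro CollectI conjI ballI)
    show "square_integrable (lebesgue_on \<Omega>) D.div_pressure" by (rule D.square_integrable_div_pressure)
    fix K assume K: "K \<in> mesh"
    obtain q where q: "q \<in> Qhat" "has_weak_div (interior Khat) (u K) q" using assms(13) uV[OF K] by blast
    have ae: "AE x in lebesgue_on (interior Khat). q x = trace (Du K x)"
      using has_weak_div_unique[OF open_interior q(2) S.has_weak_div_C1_field] Du K by blast
    let ?r = "\<lambda>x. D.orientation K * q (inv_into Khat (T K) x)"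
    have "(\<lambda>x. q (inv_into Khat (T K) x)) \<in> pulled_space Khat Qhat (T K)"
      unfolding pulled_space_def using q(1) D.inj_T[OF K] by (intro CollectI bexI[of _ q]) simp_all
    then have "?r \<in> pulled_space Khat Qhat (T K)" by (rule pulled_space_closed(2)[OF assms(12)])
    then show "\<exists>r\<in>pulled_space Khat Qhat (T K). AE x in lebesgue_on K. D.div_pressure x = r x"
      using D.AE_div_pressure[OF K ae] by (intro bexI[of _ ?r])
  qed
  have flux: "(\<lambda>y. u L (inv_into Khat (T L) y) \<bullet> S.nrm F) \<in> pulled_space F (Qbarhat F) (T L)"
    if L: "L \<in> mesh" and F: "F facet_of Khat" for L F
  proof -
    obtain r where r: "r \<in> Qbarhat F" "\<forall>x\<in>rel_interior F. r x = u L x \<bullet> outward_normal Khat x"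
      using assms(10)[OF F uV[OF L]] by blast
    have cl: "closure (rel_interior F) = F"
      using convex_closure_rel_interior[OF S.facet_props(4)[OF F]] S.facet_props(5)[OF F]
      by (simp add: compact_imp_closed)
    \<comment> \<open>The normal-trace condition is available on the relative interior only, while
      \<open>pulled_space\<close> asks for equality on the closed facet; both sides are continuous,
      so it extends.\<close>
    have "continuous_on (closure (rel_interior F)) (\<lambda>x. r x - u L x \<bullet> S.nrm F)"
      using bspec[OF assms(9)[OF F] r(1)]
      by (intro continuous_on_diff continuous_on_inner continuous_on_const D.u_cont[OF L] continuous_on_polymonial_function)
        (simp add: real_polynomial_function_eq)
    moreover have "r x - u L x \<bullet> S.nrm F = 0" if "x \<in> rel_interior F" for x
      using r(2) S.outward_normal_facet[OF F that] that by simp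
    ultimately have "r x - u L x \<bullet> S.nrm F = 0" if "x \<in> F" for x
      using continuous_constant_on_closure[of "rel_interior F" _ 0 x] that cl by blast
    then have "u L (inv_into Khat (T L) (T L x)) \<bullet> S.nrm F = r x" if "x \<in> F" for x
      using that D.inj_T[OF L] S.facet_props(2)[OF F] by (simp add: subset_iff)
    then show ?thesis unfolding pulled_space_def using r(1) by blast
  qed
  have facet_Qbar: "D.facet_pressure \<kappa> K F \<in> Qbar_h Khat Qbarhat mesh T"
    if K: "K \<in> mesh" and F: "F facet_of Khat" for \<kappa> K F
    unfolding Qbar_h_def
  proof (intro CollectI ballI allI impI conjI)
    fix L F' assume L: "L \<in> mesh" and F': "F' facet_of Khat"
    interpret C: param_cell Khat "T L" "fst (c L)" "snd (c L)" using c L by blast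
    obtain B where "\<forall>y. \<bar>D.facet_pressure \<kappa> K F y\<bar> \<le> B" using D.facet_pressure_bounded[OF K F] by blast
    then show "square_integrable (surface_measure Khat (T L) F') (D.facet_pressure \<kappa> K F)"
      by (intro C.square_integrable_surface_measure[OF F'] measurable_restrict_space1 D.facet_pressure_measurable K F) blast
    show "\<exists>r\<in>pulled_space F' (Qbarhat F') (T L). AE x in surface_measure Khat (T L) F'. D.facet_pressure \<kappa> K F x = r x"
    proof (cases "(L, F') \<in> D.copies K F")
      case False
      then have "T L ` F' \<noteq> T K ` F" using L F' by (auto simp: D.copies_def)
      then have "AE x in surface_measure Khat (T L) F'. D.facet_pressure \<kappa> K F x = 0"
        by (intro AE_I2) (simp add: D.facet_pressure_other[OF K F L F'])
      then show ?thesis using pulled_space_closed(1)[OF assms(8)[OF F']] by (intro bexI[of _ "\<lambda>_. 0"])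
    next
      case True
      \<comment> \<open>\<open>Qbar_h\<close> tests membership in every parametrization of the
        facet. As the generated space does not depend on the adjacent cell, it is enough to place
        the jump in the space of the pair \<open>(K, F)\<close>.\<close>
      then have "pulled_space F (Qbarhat F) (T K) = pulled_space F' (Qbarhat F') (T L)"
        using assms(11)[OF L K F' F] by (simp add: D.copies_def)
      moreover have "D.jump \<kappa> K F \<in> pulled_space F (Qbarhat F) (T K)"
        unfolding D.jump_def[abs_def] case_prod_unfold
      proof (intro pulled_space_sum pulled_space_closed(2) assms(8)[OF F] D.finite_copies)
        fix z assume "z \<in> D.copies K F"
        then have z: "fst z \<in> mesh" "snd z facet_of Khat" "T (fst z) ` snd z = T K ` F" by (auto simp: D.copies_def)
        \<comment> \<open>Each summand belongs to the space generated from its own cell and is moved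
          to the common one by the same independence.\<close>
        then show "(\<lambda>y. u (fst z) (inv_into Khat (T (fst z)) y) \<bullet> S.nrm (snd z)) \<in> pulled_space F (Qbarhat F) (T K)"
          using flux[OF z(1,2)] assms(11)[OF z(1) K z(2) F z(3)] by simp
      qed
      ultimately show ?thesis using D.AE_facet_pressure[OF K F True] by blast
    qed
  qed
  have zero: "(\<integral>x. v x \<bullet> grad \<psi> x \<partial>lebesgue_on \<Omega>) = 0" if "\<psi> \<in> test_functions \<Omega>" for \<psi>
    using b0 div_Q zero_Q zero_Qbar facet_Qbar that by (intro D.weak_divergence_vanishes) auto
  \<comment> \<open>The identity just proved also exhibits 0 as a weak divergence on the whole
    domain, which is the part of H(div) that a piecewise field does not have by itself.\<close>
  then have "has_weak_div \<Omega> v (\<lambda>_. 0)" by (simp add: has_weak_div_def zero_sq)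
  then show "v \<in> weakly_div_free \<Omega>" using sq zero unfolding weakly_div_free_def H_div_def by blast
qed

end
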